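(* Let $d\in\{2,3\}$, $T>0$, and let the pair $(u,h)\in C([0,T];L^{2}(\mathbb{T}^d))$ be a weak solution of the inviscid Hall-MHD equations $$\begin{aligned}&u_{t}+u\cdot\nabla u-h\cdot\nabla h+\nabla\Pi =0,\\ &h_{t}+u\cdot\nabla h-h\cdot\nabla u+\nabla\times\big[(\nabla\times h)\times h\big]=0,\\ &\mathrm{div}\,u=\mathrm{div}\,h=0.\end{aligned}$$ If $$u\in L^{3}(0,T;\underline{B}^{1/3}_{3,VMO}(\mathbb{T}^d))\quad\text{and}\quad h\in L^{3}(0,T;\underline{B}^{2/3}_{3,VMO}(\mathbb{T}^d)),$$ then the total energy is invariant, i.e. for all $t\in[0,T]$ $$\frac12\int_{\mathbb{T}^d}\big(|u(x,t)|^2+|h(x,t)|^2\big)dx=\frac12\int_{\mathbb{T}^d}\big(|u(x,0)|^2+|h(x,0)|^2\big)dx .$$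
   Context: $\mathbb{T}^d$ is the $d$-dimensional torus (periodic boundary conditions). The ion inertial length is normalized to $1$. When $d=2$, fields are regarded as $\mathbb{R}^3$-valued functions depending only on $(x_1,x_2)$, so that curl and cross product make sense. Weak solution of the inviscid Hall-MHD equations: a pair $(u,h)$ that is (at least weakly) continuous from $[0,T]$ into $L^2(\mathbb{T}^d)$, with $u,h$ divergence-free in the sense of distributions, such that for every divergence-free test vector field $\varphi\in C_0^\infty((0,T)\times\mathbb{T}^d)$, $$\int_0^T\!\!\int_{\mathbb{T}^d}\Big(\partial_t\varphi\cdot u+\sum_{i,k}\partial_k\varphi_i\,(u_iu_k-h_ih_k)\Big)dx\,dt=0,$$ $$\int_0^T\!\!\int_{\mathbb{T}^d}\Big(\partial_t\varphi\cdot h+\sum_{i,k}\partial_k\varphi_i\,(h_iu_k-u_ih_k)+\sum_{i,k}h_ih_k\,\partial_k(\nabla\times\varphi)_i\Big)dx\,dt=0.$$ The Besov-VMO space $L^r(0,T;\underline{B}^{\alpha}_{q,VMO}(\mathbb{T}^d))$ consists of $f\in L^r(0,T;L^q(\mathbb{T}^d))$ with $$\lim_{\varepsilon\to0}\frac1{\varepsilon^\alpha}\left(\int_0^T\Big[\int_{\mathbb{T}^d}\frac{1}{|B_\varepsilon(0)|}\int_{B_\varepsilon(0)}|f(x,t)-f(x-y,t)|^q\,dy\,dx\Big]^{r/q}dt\right)^{1/r}=0 .$$ *)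

theory Defs
  imports "HOL-Analysis.Analysis"
begin

text \<open>
  The torus is \<open>\<real>\<^sup>d / \<int>\<^sup>d\<close>: a field on it is a function on \<^typ>\<open>real ^ 'd\<close> with period 1 in each
  coordinate, integrated over the unit cell. All vector fields take values in \<^typ>\<open>real ^ 3\<close>, also
  when \<open>d = 2\<close>. A numbering \<open>\<iota> :: 'd \<Rightarrow> 3\<close> says which of \<open>x\<^sub>1, x\<^sub>2, x\<^sub>3\<close> a coordinate of
  \<^typ>\<open>real ^ 'd\<close> is; for \<open>d = 2\<close> its range is \<open>{1, 2}\<close>. (In the type \<^typ>\<open>3\<close>, \<open>3 = 0\<close>.)
\<close>

definition periodic :: "(real ^ 'd \<Rightarrow> 'b) \<Rightarrow> bool" where
  "periodic f \<longleftrightarrow> (\<forall>x i. f (x + axis i 1) = f x)"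

definition torus_integral :: "(real ^ 'd \<Rightarrow> real) \<Rightarrow> real" where
  "torus_integral f = (LBINT x:cbox 0 (\<chi> i. 1). f x)"

definition torus_integrable :: "(real ^ 'd \<Rightarrow> real) \<Rightarrow> bool" where
  "torus_integrable f \<longleftrightarrow> set_integrable lborel (cbox 0 (\<chi> i. 1)) f"


subsection \<open>Differential operators\<close>

text \<open>If no coordinate carries the number \<open>k\<close> (\<open>d = 2\<close>, \<open>k = 3\<close>), the direction is 0, and hence
  \<open>\<partial>\<^sub>k f = 0\<close>: the field does not depend on \<open>x\<^sub>k\<close>.\<close>

definition direction :: "('d \<Rightarrow> 3) \<Rightarrow> 3 \<Rightarrow> real ^ 'd" where
  "direction \<iota> k = (\<chi> i. if \<iota> i = k then 1 else 0)"

definition partial :: "('d::finite \<Rightarrow> 3) \<Rightarrow> 3 \<Rightarrow> (real ^ 'd \<Rightarrow> 'b::real_normed_vector) \<Rightarrow> real ^ 'd \<Rightarrow> 'b" where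
  "partial \<iota> k f x = vector_derivative (\<lambda>s. f (x + s *\<^sub>R direction \<iota> k)) (at 0)"

definition divergence :: "('d::finite \<Rightarrow> 3) \<Rightarrow> (real ^ 'd \<Rightarrow> real ^ 3) \<Rightarrow> real ^ 'd \<Rightarrow> real" where
  "divergence \<iota> f x = (\<Sum>k\<in>UNIV. partial \<iota> k f x $ k)"

definition curl :: "('d::finite \<Rightarrow> 3) \<Rightarrow> (real ^ 'd \<Rightarrow> real ^ 3) \<Rightarrow> real ^ 'd \<Rightarrow> real ^ 3" where
  "curl \<iota> f x = vector
     [partial \<iota> 2 f x $ 3 - partial \<iota> 3 f x $ 2,
      partial \<iota> 3 f x $ 1 - partial \<iota> 1 f x $ 3,
      partial \<iota> 1 f x $ 2 - partial \<iota> 2 f x $ 1]"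

primrec C_upto :: "nat \<Rightarrow> ('a::euclidean_space \<Rightarrow> 'b::real_normed_vector) \<Rightarrow> bool" where
  "C_upto 0 f \<longleftrightarrow> continuous_on UNIV f"
| "C_upto (Suc n) f \<longleftrightarrow> (\<forall>x. f differentiable (at x)) \<and>
     (\<forall>b\<in>Basis. C_upto n (\<lambda>x. frechet_derivative f (at x) b))"

definition smooth :: "('a::euclidean_space \<Rightarrow> 'b::real_normed_vector) \<Rightarrow> bool" where
  "smooth f \<longleftrightarrow> (\<forall>n. C_upto n f)"


subsection \<open>Function spaces\<close>

text \<open>Elements of the spaces below are given by representatives. A time-dependent field has one that
  is jointly Borel measurable and periodic for every time.\<close>

definition time_field :: "real \<Rightarrow> (real \<Rightarrow> real ^ 'd \<Rightarrow> real ^ 3) \<Rightarrow> bool" where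
  "time_field T f \<longleftrightarrow>
     set_borel_measurable borel ({0..T} \<times> UNIV) (\<lambda>(t, x). f t x) \<and>
     (\<forall>t\<in>{0..T}. periodic (f t))"

definition L2_torus :: "(real ^ 'd \<Rightarrow> real ^ 3) \<Rightarrow> bool" where
  "L2_torus f \<longleftrightarrow> f \<in> borel_measurable borel \<and> periodic f \<and>
     torus_integrable (\<lambda>x. (norm (f x))\<^sup>2)"

definition weakly_continuous_L2 :: "real \<Rightarrow> (real \<Rightarrow> real ^ 'd \<Rightarrow> real ^ 3) \<Rightarrow> bool" where
  "weakly_continuous_L2 T f \<longleftrightarrow> time_field T f \<and> (\<forall>t\<in>{0..T}. L2_torus (f t)) \<and>
     (\<forall>g. L2_torus g \<longrightarrow> continuous_on {0..T} (\<lambda>t. torus_integral (\<lambda>x. f t x \<bullet> g x)))"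

definition continuous_L2 :: "real \<Rightarrow> (real \<Rightarrow> real ^ 'd \<Rightarrow> real ^ 3) \<Rightarrow> bool" where
  "continuous_L2 T f \<longleftrightarrow> time_field T f \<and> (\<forall>t\<in>{0..T}. L2_torus (f t)) \<and>
     (\<forall>s\<in>{0..T}. ((\<lambda>t. sqrt (torus_integral (\<lambda>x. (norm (f t x - f s x))\<^sup>2))) \<longlongrightarrow> 0)
        (at s within {0..T}))"

definition in_LrLq :: "real \<Rightarrow> real \<Rightarrow> real \<Rightarrow> (real \<Rightarrow> real ^ 'd \<Rightarrow> real ^ 3) \<Rightarrow> bool" where
  "in_LrLq r q T f \<longleftrightarrow> time_field T f \<and>
     (AE t in lborel. t \<in> {0..T} \<longrightarrow> torus_integrable (\<lambda>x. norm (f t x) powr q)) \<and>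
     set_integrable lborel {0..T} (\<lambda>t. torus_integral (\<lambda>x. norm (f t x) powr q) powr (r / q))"

definition in_Lr_Besov_VMO ::
  "real \<Rightarrow> real \<Rightarrow> real \<Rightarrow> real \<Rightarrow> (real \<Rightarrow> real ^ 'd \<Rightarrow> real ^ 3) \<Rightarrow> bool" where
  "in_Lr_Besov_VMO r \<alpha> q T f \<longleftrightarrow> in_LrLq r q T f \<and>
     ((\<lambda>\<epsilon>. 1 / \<epsilon> powr \<alpha> *
        (LBINT t:{0..T}.
           torus_integral (\<lambda>x. 1 / measure lborel (ball (0 :: real ^ 'd) \<epsilon>) *
             (LBINT y:ball 0 \<epsilon>. norm (f t x - f t (x - y)) powr q)) powr (r / q)) powr (1 / r))
      \<longlongrightarrow> 0) (at_right 0)"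


subsection \<open>Weak solutions\<close>

definition weakly_div_free :: "('d::finite \<Rightarrow> 3) \<Rightarrow> (real ^ 'd \<Rightarrow> real ^ 3) \<Rightarrow> bool" where
  "weakly_div_free \<iota> f \<longleftrightarrow>
     (\<forall>\<psi> :: real ^ 'd \<Rightarrow> real. smooth \<psi> \<and> periodic \<psi> \<longrightarrow>
        torus_integral (\<lambda>x. \<Sum>k\<in>UNIV. f x $ k * partial \<iota> k \<psi> x) = 0)"

definition test_field :: "('d::finite \<Rightarrow> 3) \<Rightarrow> real \<Rightarrow> (real \<Rightarrow> real ^ 'd \<Rightarrow> real ^ 3) \<Rightarrow> bool" where
  "test_field \<iota> T \<phi> \<longleftrightarrow>
     smooth (\<lambda>(t, x). \<phi> t x) \<and> (\<forall>t. periodic (\<phi> t)) \<and>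
     (\<exists>a b. 0 < a \<and> b < T \<and> (\<forall>t x. t \<notin> {a..b} \<longrightarrow> \<phi> t x = 0)) \<and>
     (\<forall>t x. divergence \<iota> (\<phi> t) x = 0)"

definition weak_solution ::
  "('d::finite \<Rightarrow> 3) \<Rightarrow> real \<Rightarrow> (real \<Rightarrow> real ^ 'd \<Rightarrow> real ^ 3) \<Rightarrow> (real \<Rightarrow> real ^ 'd \<Rightarrow> real ^ 3) \<Rightarrow> bool"
where
  "weak_solution \<iota> T u h \<longleftrightarrow>
     weakly_continuous_L2 T u \<and> weakly_continuous_L2 T h \<and>
     (\<forall>t\<in>{0..T}. weakly_div_free \<iota> (u t) \<and> weakly_div_free \<iota> (h t)) \<and>
     (\<forall>\<phi>. test_field \<iota> T \<phi> \<longrightarrow>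
        (LBINT t:{0..T}. torus_integral (\<lambda>x.
           vector_derivative (\<lambda>s. \<phi> s x) (at t) \<bullet> u t x
           + (\<Sum>i\<in>UNIV. \<Sum>k\<in>UNIV. partial \<iota> k (\<phi> t) x $ i *
                (u t x $ i * u t x $ k - h t x $ i * h t x $ k)))) = 0 \<and>
        (LBINT t:{0..T}. torus_integral (\<lambda>x.
           vector_derivative (\<lambda>s. \<phi> s x) (at t) \<bullet> h t x
           + (\<Sum>i\<in>UNIV. \<Sum>k\<in>UNIV. partial \<iota> k (\<phi> t) x $ i *
                (h t x $ i * u t x $ k - u t x $ i * h t x $ k))
           + (\<Sum>i\<in>UNIV. \<Sum>k\<in>UNIV. h t x $ i * h t x $ k *
                partial \<iota> k (curl \<iota> (\<phi> t)) x $ i))) = 0)"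

end

theory Submission
  imports Defs
begin

text \<open>
  Let \<open>\<eta>\<close> be an even mollifier at scale \<open>\<epsilon>\<close> and \<open>U = \<eta> * u\<close>, \<open>H = \<eta> * h\<close>. The weak formulation, tested with
  the divergence-free fields \<open>\<eta> * U(s)\<close> and \<open>\<eta> * H(s)\<close> frozen at a time \<open>s\<close>, computes the time increments of
  \<open>\<integral> |U|\<^sup>2 + |H|\<^sup>2\<close>; strong continuity in \<open>L\<^sup>2\<close> allows \<open>s\<close> to be replaced by the running time, without any
  mollification in time. In the resulting flux the products \<open>\<eta> * (a b)\<close> may be replaced by the commutators
  \<open>\<eta> * (a b) - (\<eta> * a) (\<eta> * b)\<close>, because smooth divergence-free fields conserve energy (for the Hall term,
  because \<open>J \<times> H\<close> is orthogonal to \<open>J = curl H\<close>). By the identity of Constantin, E and Titi the commutators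
  are quadratic in the increments of the fields. Hence, with \<open>A\<close> the ball average of the cubed increments, the
  flux is at most a constant times \<open>(A u + A h) / \<epsilon> + A h / \<epsilon>\<^sup>2\<close>, which tends to 0 in \<open>L\<^sup>1(0, T)\<close> by
  the two Besov-VMO hypotheses. As \<open>A\<close> also controls \<open>U - u\<close> and \<open>H - h\<close>, the energy is within \<open>o(1)\<close> of a
  constant in \<open>L\<^sup>1(0, T)\<close>, and it is continuous.
\<close>

text \<open>The natural test field, the twice mollified solution at the running time, need not be
  smooth in time, so it is not admissible. Freezing it costs an error bounded by the L^1 distance of
  the fields at two times, with a factor depending on \<epsilon>. That is harmless: \<epsilon> is
  fixed while the time derivative is taken. The one estimate that must be sharp in \<epsilon> is
  that of the flux at equal times. In it each commutator meets a derivative of a mollified field.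
  Apart from the Hall term there is one derivative, hence a factor 1/\<epsilon>, paid for by cubed
  increments of size o(\<epsilon>), that is, by exponent 1/3. The Hall term has a derivative of a
  curl, hence 1/\<epsilon>^2, but all its factors come from h, so exponent 2/3 is asked of h alone.
  A product of three increments is at most the sum of their cubes, so increments of different fields
  are never weighed against each other. Cubes must also control the squares in the energy. This is
  done by splitting at a threshold, which is fixed before \<epsilon> tends to 0.\<close>

section \<open>Calculus of smooth functions\<close>

definition dir_deriv :: "'a::euclidean_space \<Rightarrow> ('a \<Rightarrow> 'b::real_normed_vector) \<Rightarrow> 'a \<Rightarrow> 'b" where
  "dir_deriv b f = (\<lambda>x. frechet_derivative f (at x) b)"

lemma C_upto_Suc_iff:
  "C_upto (Suc n) f \<longleftrightarrow> (\<forall>x. f differentiable (at x)) \<and> (\<forall>b\<in>Basis. C_upto n (dir_deriv b f))"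
  by (simp add: dir_deriv_def)

declare C_upto.simps(2) [simp del]

lemma dir_deriv_eq:
  assumes "(f has_derivative f') (at x)"
  shows "dir_deriv b f x = f' b"
  using frechet_derivative_at[OF assms] by (simp add: dir_deriv_def)

lemma has_derivative_dir_deriv:
  "f differentiable (at x) \<Longrightarrow> (f has_derivative (\<lambda>b. dir_deriv b f x)) (at x)"
  by (simp add: dir_deriv_def frechet_derivative_works[symmetric])

lemma dir_deriv_basis:
  fixes f :: "'a::euclidean_space \<Rightarrow> 'b::real_normed_vector"
  assumes "f differentiable (at x)"
  shows "dir_deriv b f x = (\<Sum>i\<in>Basis. (b \<bullet> i) *\<^sub>R dir_deriv i f x)"
proof -
  have "linear (\<lambda>b. dir_deriv b f x)"
    using has_derivative_dir_deriv[OF assms] has_derivative_linear by blast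
  then have "dir_deriv (\<Sum>i\<in>Basis. (b \<bullet> i) *\<^sub>R i) f x = (\<Sum>i\<in>Basis. (b \<bullet> i) *\<^sub>R dir_deriv i f x)"
    by (subst linear_sum[of "\<lambda>b. dir_deriv b f x"]) (auto simp: linear_cmul[of "\<lambda>b. dir_deriv b f x"])
  then show ?thesis by (simp add: euclidean_representation)
qed

lemma C_upto_SucI:
  assumes "\<And>x. (f has_derivative D x) (at x)" "\<And>b. b \<in> Basis \<Longrightarrow> C_upto n (\<lambda>x. D x b)"
  shows "C_upto (Suc n) f"
proof -
  have "dir_deriv b f = (\<lambda>x. D x b)" for b
    using dir_deriv_eq[OF assms(1)] by blast
  then show ?thesis
    using assms unfolding C_upto_Suc_iff by (auto intro: differentiableI)
qed

lemma C_upto_SucD: "C_upto (Suc n) f \<Longrightarrow> C_upto n f"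
proof (induction n arbitrary: f)
  case 0
  then show ?case
    by (simp add: C_upto_Suc_iff continuous_on_eq_continuous_at differentiable_imp_continuous_within)
next
  case (Suc n)
  then show ?case
    unfolding C_upto_Suc_iff[of "Suc n"] C_upto_Suc_iff[of n] by blast
qed

lemma C_upto_const: "C_upto n (\<lambda>x. c)"
  by (induction n arbitrary: c) (auto simp: dir_deriv_def C_upto.simps(2))

lemma C_upto_bounded_linear:
  assumes "bounded_linear L"
  shows "C_upto n f \<Longrightarrow> C_upto n (\<lambda>x. L (f x))"
proof (induction n arbitrary: f)
  case 0
  then show ?case
    using bounded_linear.continuous_on[OF assms] by simp
next
  case (Suc n)
  show ?case
  proof (rule C_upto_SucI)
    show "((\<lambda>x. L (f x)) has_derivative (\<lambda>b. L (dir_deriv b f x))) (at x)" for x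
      by (rule bounded_linear.has_derivative[OF assms])
        (use Suc.prems in \<open>auto simp: C_upto_Suc_iff intro!: has_derivative_dir_deriv\<close>)
  qed (use Suc in \<open>auto simp: C_upto_Suc_iff\<close>)
qed

lemma C_upto_add:
  "C_upto n f \<Longrightarrow> C_upto n g \<Longrightarrow> C_upto n (\<lambda>x. f x + g x)"
proof (induction n arbitrary: f g)
  case 0
  then show ?case by (simp add: continuous_on_add)
next
  case (Suc n)
  show ?case
  proof (rule C_upto_SucI)
    show "((\<lambda>x. f x + g x) has_derivative (\<lambda>b. dir_deriv b f x + dir_deriv b g x)) (at x)" for x
      by (intro has_derivative_add has_derivative_dir_deriv)
        (use Suc.prems in \<open>auto simp: C_upto_Suc_iff\<close>)
  qed (use Suc in \<open>auto simp: C_upto_Suc_iff\<close>)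
qed

lemma C_upto_sum: "(\<And>i. i \<in> I \<Longrightarrow> C_upto n (f i)) \<Longrightarrow> C_upto n (\<lambda>x. \<Sum>i\<in>I. f i x)"
  by (induction I rule: infinite_finite_induct) (auto simp: C_upto_const C_upto_add)

lemma C_upto_bounded_bilinear:
  assumes "bounded_bilinear B"
  shows "C_upto n f \<Longrightarrow> C_upto n g \<Longrightarrow> C_upto n (\<lambda>x. B (f x) (g x))"
proof (induction n arbitrary: f g)
  case 0
  then show ?case using bounded_bilinear.continuous_on[OF assms] by simp
next
  case (Suc n)
  have "C_upto n f" "C_upto n g" using Suc.prems C_upto_SucD by blast+
  moreover have "C_upto n (dir_deriv b f)" "C_upto n (dir_deriv b g)" if "b \<in> Basis" for b
    using Suc.prems that unfolding C_upto_Suc_iff by blast+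
  ultimately have "C_upto n (\<lambda>x. B (f x) (dir_deriv b g x) + B (dir_deriv b f x) (g x))"
    if "b \<in> Basis" for b
    using that by (intro C_upto_add Suc.IH)
  moreover have "((\<lambda>x. B (f x) (g x)) has_derivative
      (\<lambda>b. B (f x) (dir_deriv b g x) + B (dir_deriv b f x) (g x))) (at x)" for x
    by (intro bounded_bilinear.FDERIV[OF assms] has_derivative_dir_deriv)
      (use Suc.prems in \<open>auto simp: C_upto_Suc_iff\<close>)
  ultimately show ?case
    by (rule C_upto_SucI[rotated])
qed

text \<open>\<open>C_upto\<close> only asks for basis directions. Other directions occur in the
  chain rule, and \<open>direction \<iota> k\<close> is a sum of basis vectors that may be 0.
  Linearity of the Frechet derivative reduces them to the basis.\<close>

lemma C_upto_dir_deriv: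
  assumes "C_upto (Suc n) f"
  shows "C_upto n (dir_deriv b f)"
proof -
  have "dir_deriv b f = (\<lambda>x. \<Sum>i\<in>Basis. (b \<bullet> i) *\<^sub>R dir_deriv i f x)"
    using assms dir_deriv_basis unfolding C_upto_Suc_iff by blast
  then show ?thesis
    using assms unfolding C_upto_Suc_iff
    by (auto intro!: C_upto_sum C_upto_bounded_linear[OF bounded_linear_scaleR_right])
qed

text \<open>The direction \<open>dir_deriv b p x\<close> in the chain rule varies with x. Expanded
  in the fixed basis it leaves products of derivatives of \<open>p\<close> with the functions
  \<open>dir_deriv i f\<close> composed with \<open>p\<close>, and the induction hypothesis, which
  is general in \<open>f\<close> and \<open>p\<close>, applies to the latter.\<close>

lemma C_upto_compose:
  "C_upto n f \<Longrightarrow> C_upto n p \<Longrightarrow> C_upto n (\<lambda>x. f (p x))"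
proof (induction n arbitrary: f p)
  case 0
  then show ?case using continuous_on_compose2[of UNIV f UNIV p] by simp
next
  case (Suc n)
  have df: "f differentiable at x" and dp: "p differentiable at y" for x y
    using Suc.prems by (auto simp: C_upto_Suc_iff)
  have "((\<lambda>x. f (p x)) has_derivative (\<lambda>b. dir_deriv (dir_deriv b p x) f (p x))) (at x)" for x
    using has_derivative_compose[OF has_derivative_dir_deriv[OF dp] has_derivative_dir_deriv[OF df]] .
  then have d: "((\<lambda>x. f (p x)) has_derivative
      (\<lambda>b. \<Sum>i\<in>Basis. (dir_deriv b p x \<bullet> i) *\<^sub>R dir_deriv i f (p x))) (at x)" for x
    by (simp add: dir_deriv_basis[OF df, symmetric])
  have "C_upto n p" using Suc.prems C_upto_SucD by blast
  moreover have "C_upto n (dir_deriv i f)" "C_upto n (dir_deriv j p)" for i j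
    using Suc.prems C_upto_dir_deriv by blast+
  ultimately show ?case
    using d by (intro C_upto_SucI[OF d] C_upto_sum C_upto_bounded_bilinear[OF bounded_bilinear_scaleR]
        C_upto_bounded_linear[OF bounded_linear_inner_left] Suc.IH)
qed

lemma C_upto_linear:
  assumes "bounded_linear L"
  shows "C_upto n L"
proof (cases n)
  case 0
  then show ?thesis using linear_continuous_on[OF assms] by simp
next
  case (Suc m)
  then show ?thesis
    using C_upto_SucI[where D="\<lambda>_. L"] bounded_linear_imp_has_derivative[OF assms] C_upto_const by blast
qed

text \<open>The derivative of 1/g contains 1/g again, so regularity climbs one order at a time: if
  1/g is of class n, then so is its derivative.\<close>

lemma C_upto_inverse:
  fixes g :: "'a::euclidean_space \<Rightarrow> real"
  assumes nz: "\<And>x. g x \<noteq> 0"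
  shows "C_upto n g \<Longrightarrow> C_upto n (\<lambda>x. inverse (g x))"
proof (induction n)
  case 0
  then show ?case using nz by (auto intro!: continuous_on_inverse)
next
  case (Suc n)
  have d: "((\<lambda>x. inverse (g x)) has_derivative (\<lambda>b. - (inverse (g x) * dir_deriv b g x * inverse (g x)))) (at x)" for x
    by (intro Deriv.has_derivative_inverse nz has_derivative_dir_deriv)
      (use Suc.prems in \<open>auto simp: C_upto_Suc_iff\<close>)
  have "C_upto n (\<lambda>x. inverse (g x))" using Suc C_upto_SucD by blast
  then show ?case
    using Suc.prems C_upto_dir_deriv
    by (intro C_upto_SucI[OF d] C_upto_bounded_linear[OF bounded_linear_minus[OF bounded_linear_ident]]
        C_upto_bounded_bilinear[OF bounded_bilinear_mult])
qed

lemma smooth_imp_differentiable: "smooth f \<Longrightarrow> f differentiable (at x)"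
  unfolding smooth_def using C_upto_Suc_iff by blast

lemma smooth_imp_continuous: "smooth f \<Longrightarrow> continuous_on A f"
  unfolding smooth_def using C_upto.simps(1) continuous_on_subset by blast

lemma smooth_has_derivative: "smooth f \<Longrightarrow> (f has_derivative (\<lambda>b. dir_deriv b f x)) (at x)"
  by (simp add: has_derivative_dir_deriv smooth_imp_differentiable)

lemma smooth_dir_deriv: "smooth f \<Longrightarrow> smooth (dir_deriv b f)"
  unfolding smooth_def using C_upto_dir_deriv by blast

lemma smooth_const: "smooth (\<lambda>x. c)"
  by (simp add: smooth_def C_upto_const)

lemma smooth_linear: "bounded_linear L \<Longrightarrow> smooth L"
  by (simp add: smooth_def C_upto_linear)

lemma smooth_bounded_linear: "bounded_linear L \<Longrightarrow> smooth f \<Longrightarrow> smooth (\<lambda>x. L (f x))"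
  by (simp add: smooth_def C_upto_bounded_linear)

lemma smooth_add: "smooth f \<Longrightarrow> smooth g \<Longrightarrow> smooth (\<lambda>x. f x + g x)"
  by (simp add: smooth_def C_upto_add)

lemma smooth_minus: "smooth f \<Longrightarrow> smooth (\<lambda>x. - f x)"
  using smooth_bounded_linear[OF bounded_linear_minus[OF bounded_linear_ident]] by blast

lemma smooth_diff: "smooth f \<Longrightarrow> smooth g \<Longrightarrow> smooth (\<lambda>x. f x - g x)"
  using smooth_add[of f "\<lambda>x. - g x"] by (simp add: smooth_minus)

lemma smooth_sum: "(\<And>i. i \<in> I \<Longrightarrow> smooth (f i)) \<Longrightarrow> smooth (\<lambda>x. \<Sum>i\<in>I. f i x)"
  by (simp add: smooth_def C_upto_sum)

lemma smooth_mult: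
  fixes f g :: "'a::euclidean_space \<Rightarrow> real"
  shows "smooth f \<Longrightarrow> smooth g \<Longrightarrow> smooth (\<lambda>x. f x * g x)"
  unfolding smooth_def by (intro allI C_upto_bounded_bilinear[OF bounded_bilinear_mult]) blast+

lemma smooth_scaleR: "smooth f \<Longrightarrow> smooth g \<Longrightarrow> smooth (\<lambda>x. f x *\<^sub>R g x)"
  unfolding smooth_def by (intro allI C_upto_bounded_bilinear[OF bounded_bilinear_scaleR]) blast+

lemma smooth_inner: "smooth f \<Longrightarrow> smooth g \<Longrightarrow> smooth (\<lambda>x. f x \<bullet> g x)"
  unfolding smooth_def by (intro allI C_upto_bounded_bilinear[OF bounded_bilinear_inner]) blast+

lemma smooth_compose: "smooth f \<Longrightarrow> smooth p \<Longrightarrow> smooth (\<lambda>x. f (p x))"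
  by (simp add: smooth_def C_upto_compose)

lemma smooth_divide:
  fixes f g :: "'a::euclidean_space \<Rightarrow> real"
  assumes "smooth f" "smooth g" "\<And>x. g x \<noteq> 0"
  shows "smooth (\<lambda>x. f x / g x)"
  using assms C_upto_inverse[of g] smooth_mult[of f "\<lambda>x. inverse (g x)"]
  by (simp add: smooth_def divide_inverse)

lemma smooth_ident: "smooth (\<lambda>x. x)"
  by (simp add: smooth_linear bounded_linear_ident)

lemma smooth_vec_nth: "smooth f \<Longrightarrow> smooth (\<lambda>x. f x $ i)"
  using smooth_bounded_linear[OF bounded_linear_vec_nth] by blast

lemma dir_deriv_mult:
  fixes f g :: "'a::euclidean_space \<Rightarrow> real"
  shows "smooth f \<Longrightarrow> smooth g \<Longrightarrow>
    dir_deriv b (\<lambda>x. f x * g x) x = f x * dir_deriv b g x + dir_deriv b f x * g x"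
  by (rule dir_deriv_eq[OF has_derivative_mult[OF smooth_has_derivative smooth_has_derivative]])

lemma dir_deriv_bounded_linear:
  assumes "bounded_linear L" "smooth f"
  shows "dir_deriv b (\<lambda>x. L (f x)) x = L (dir_deriv b f x)"
  by (intro dir_deriv_eq bounded_linear.has_derivative[OF assms(1)] smooth_has_derivative assms(2))

lemma dir_deriv_vec_nth: "smooth f \<Longrightarrow> dir_deriv b (\<lambda>x. f x $ i) x = dir_deriv b f x $ i"
  using dir_deriv_bounded_linear[OF bounded_linear_vec_nth] .

text \<open>Differentiation along a line agrees with the Frechet derivative, also in the direction 0
  of a missing coordinate, where both vanish. For smooth functions \<open>partial\<close> is handled
  through \<open>dir_deriv\<close> from here on.\<close>

lemma partial_eq_dir_deriv:
  assumes "f differentiable (at x)"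
  shows "partial \<iota> k f x = dir_deriv (direction \<iota> k) f x"
proof -
  have "((\<lambda>s. x + s *\<^sub>R direction \<iota> k) has_derivative (\<lambda>s. s *\<^sub>R direction \<iota> k)) (at 0)"
    by (auto intro!: derivative_eq_intros)
  moreover have "(f has_derivative (\<lambda>b. dir_deriv b f x)) (at (x + 0 *\<^sub>R direction \<iota> k))"
    using has_derivative_dir_deriv[OF assms] by simp
  ultimately have "((\<lambda>s. f (x + s *\<^sub>R direction \<iota> k)) has_derivative
      (\<lambda>s. dir_deriv (s *\<^sub>R direction \<iota> k) f x)) (at 0)"
    by (rule has_derivative_compose)
  moreover have "linear (\<lambda>b. dir_deriv b f x)"
    using has_derivative_dir_deriv[OF assms] has_derivative_linear by blast
  ultimately have "((\<lambda>s. f (x + s *\<^sub>R direction \<iota> k)) has_vector_derivative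
      dir_deriv (direction \<iota> k) f x) (at 0)"
    by (simp add: has_vector_derivative_def linear_cmul[of "\<lambda>b. dir_deriv b f x"])
  then show ?thesis
    unfolding partial_def by (rule vector_derivative_at)
qed

lemma partial_smooth: "smooth f \<Longrightarrow> partial \<iota> k f = dir_deriv (direction \<iota> k) f"
  using partial_eq_dir_deriv smooth_imp_differentiable by blast

subsection \<open>Smooth cut-off functions\<close>

text \<open>The function exp(-1/x), extended by 0, times powers of 1/x. The powers are included
  because the family is then closed under differentiation up to linear combinations, so smoothness
  at 0 follows for all members at once by induction.\<close>

definition exp_flat :: "nat \<Rightarrow> real \<Rightarrow> real" where
  "exp_flat k x = (if x > 0 then inverse x ^ k * exp (- inverse x) else 0)"

lemma exp_flat_lim: "(exp_flat k \<longlongrightarrow> 0) (at_right 0)"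
proof -
  have "((\<lambda>x. inverse x ^ k / exp (inverse x)) \<longlongrightarrow> (0::real)) (at_right 0)"
    by (rule filterlim_compose[OF tendsto_power_div_exp_0 filterlim_inverse_at_top_right])
  then show ?thesis
    by (rule Lim_transform_eventually)
      (auto simp: eventually_at_right_field exp_flat_def exp_minus divide_inverse intro!: exI[of _ 1])
qed

lemma exp_flat_deriv:
  "(exp_flat k has_real_derivative exp_flat (k + 2) x - k * exp_flat (k + 1) x) (at x)"
proof -
  consider "x > 0" | "x < 0" | "x = 0" by linarith
  then show ?thesis
  proof cases
    case 1
    have "((\<lambda>x. inverse x ^ k * exp (- inverse x)) has_real_derivative
        inverse x ^ k * (exp (- inverse x) * (inverse x)\<^sup>2) +
        k * (- (inverse x)\<^sup>2 * inverse x ^ (k - 1)) * exp (- inverse x)) (at x)"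
      using 1 by (auto intro!: derivative_eq_intros simp: power2_eq_square)
    moreover have "inverse x ^ k * (exp (- inverse x) * (inverse x)\<^sup>2) +
        k * (- (inverse x)\<^sup>2 * inverse x ^ (k - 1)) * exp (- inverse x) =
        exp_flat (k + 2) x - k * exp_flat (k + 1) x"
      using 1 by (cases k) (simp_all add: exp_flat_def power2_eq_square algebra_simps)
    ultimately have "((\<lambda>x. inverse x ^ k * exp (- inverse x)) has_real_derivative
        exp_flat (k + 2) x - k * exp_flat (k + 1) x) (at x)"
      by (rule DERIV_cong)
    then show ?thesis
      by (rule has_field_derivative_transform_within_open[where S="{0<..}"])
        (use 1 in \<open>auto simp: exp_flat_def\<close>)
  next
    case 2
    have "((\<lambda>x. 0) has_real_derivative exp_flat (k + 2) x - k * exp_flat (k + 1) x) (at x)"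
      using 2 by (simp add: exp_flat_def)
    then show ?thesis
      by (rule has_field_derivative_transform_within_open[where S="{..<0}"])
        (use 2 in \<open>auto simp: exp_flat_def\<close>)
  next
    case 3
    \<comment> \<open>The difference quotient at 0 is, from the right, the next member
      \<open>exp_flat (k + 1)\<close> of the family, whose limit is known; from the left it is
      0.\<close>
    have "((\<lambda>y. (exp_flat k y - exp_flat k 0) / (y - 0)) \<longlongrightarrow> 0) (at_right 0)"
      by (rule Lim_transform_eventually[OF exp_flat_lim[of "k + 1"]])
        (auto simp: eventually_at_right_field exp_flat_def divide_inverse intro!: exI[of _ 1])
    moreover have "((\<lambda>y. (exp_flat k y - exp_flat k 0) / (y - 0)) \<longlongrightarrow> 0) (at_left 0)"
      by (rule Lim_transform_eventually[OF tendsto_const])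
        (auto simp: eventually_at_left_field exp_flat_def intro!: exI[of _ "-1"])
    ultimately show ?thesis
      using 3 by (simp add: has_field_derivative_iff filterlim_split_at exp_flat_def)
  qed
qed

lemma smooth_exp_flat: "smooth (exp_flat k)"
proof -
  have "C_upto n (exp_flat k)" for n
  proof (induction n arbitrary: k)
    case 0
    show ?case
      using DERIV_isCont[OF exp_flat_deriv] by (auto simp: continuous_on_eq_continuous_at)
  next
    case (Suc n)
    have d: "(exp_flat k has_derivative (\<lambda>h. (exp_flat (k + 2) x - k * exp_flat (k + 1) x) * h)) (at x)" for x
      using exp_flat_deriv[of k x] by (simp add: has_field_derivative_def)
    have "C_upto n (\<lambda>x. exp_flat (k + 2) x + (- real k) * exp_flat (k + 1) x)"
      by (intro C_upto_add
          C_upto_bounded_linear[OF bounded_linear_mult_right] Suc)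
    then show ?case
      using C_upto_SucI[OF d, of n] by simp
  qed
  then show ?thesis by (simp add: smooth_def)
qed

text \<open>The denominator is positive everywhere because x and 1 - x are never both nonpositive.
  The function serves to build cut-offs in time.\<close>

definition smooth_step :: "real \<Rightarrow> real" where
  "smooth_step x = exp_flat 0 x / (exp_flat 0 x + exp_flat 0 (1 - x))"

lemma smooth_smooth_step: "smooth smooth_step"
  unfolding smooth_step_def
  by (intro smooth_divide smooth_add smooth_exp_flat smooth_compose[OF smooth_exp_flat]
      smooth_diff smooth_const smooth_ident)
    (auto simp: exp_flat_def add_pos_pos less_imp_neq[symmetric])

lemma smooth_step_0: "x \<le> 0 \<Longrightarrow> smooth_step x = 0"
  and smooth_step_1: "x \<ge> 1 \<Longrightarrow> smooth_step x = 1"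
  and smooth_step_bounds: "0 \<le> smooth_step x" "smooth_step x \<le> 1"
  by (auto simp: smooth_step_def exp_flat_def divide_le_eq_1 add_pos_pos)

subsection \<open>Lebesgue measure on the torus\<close>

text \<open>Half-open, unlike the closed cell in \<open>torus_integral\<close>, so that its integer
  translates partition the space.\<close>

definition torus_cell :: "(real ^ 'd) set" where
  "torus_cell = {x. \<forall>i. 0 \<le> x $ i \<and> x $ i < 1}"

definition torus :: "(real ^ 'd) measure" where
  "torus = density lborel (indicator torus_cell :: _ \<Rightarrow> real)"

lemma torus_cell_borel [measurable]: "torus_cell \<in> sets borel"
proof -
  have "torus_cell = (\<Inter>i. {x :: real ^ 'd. 0 \<le> x $ i} \<inter> {x. x $ i < 1})"
    by (auto simp: torus_cell_def)
  also have "\<dots> \<in> sets borel"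
    by (intro sets.finite_INT sets.Int borel_closed borel_open closed_Collect_le open_Collect_less
        continuous_intros) auto
  finally show ?thesis .
qed

lemma sets_torus [measurable_cong, simp]: "sets torus = sets borel"
  by (simp add: torus_def)

lemma space_torus [simp]: "space torus = UNIV"
  by (simp add: torus_def)

lemma emeasure_torus:
  assumes [measurable]: "A \<in> sets borel"
  shows "emeasure torus A = emeasure lborel (A \<inter> torus_cell)"
proof -
  have "emeasure torus A = (\<integral>\<^sup>+x. ennreal (indicator torus_cell x) * indicator A x \<partial>lborel)"
    unfolding torus_def by (rule emeasure_density) auto
  also have "\<dots> = (\<integral>\<^sup>+x. indicator (A \<inter> torus_cell) x \<partial>lborel)"
    by (intro nn_integral_cong) (auto split: split_indicator)
  finally show ?thesis by simp
qed

text \<open>Both cells lie between the open and the closed unit box, which have the same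
  volume.\<close>

lemma AE_torus_cell: "AE x in lborel. x \<in> cbox 0 (\<chi> i. 1) \<longleftrightarrow> x \<in> (torus_cell :: (real ^ 'd) set)"
proof -
  let ?C = "cbox 0 (\<chi> i. 1) :: (real ^ 'd) set" and ?B = "box 0 (\<chi> i. 1) :: (real ^ 'd) set"
  have "emeasure lborel (?C - ?B) = 0"
    by (subst emeasure_Diff)
      (auto simp: emeasure_lborel_box_eq emeasure_lborel_cbox_eq box_subset_cbox inner_axis Basis_vec_def)
  then have "?C - ?B \<in> null_sets lborel" by auto
  then have "AE x in lborel. x \<notin> ?C - ?B" by (rule AE_not_in)
  moreover have "?B \<subseteq> torus_cell" "torus_cell \<subseteq> ?C"
    by (auto simp: torus_cell_def mem_box_cart less_imp_le)
  ultimately show ?thesis by (auto elim!: eventually_mono)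
qed

lemma emeasure_torus_UNIV: "emeasure (torus :: (real ^ 'd) measure) UNIV = 1"
proof -
  have "emeasure lborel (torus_cell :: (real ^ 'd) set) = emeasure lborel (cbox 0 (\<chi> i. 1) :: (real ^ 'd) set)"
    using AE_torus_cell by (intro emeasure_eq_AE) (auto elim!: eventually_mono)
  also have "\<dots> = 1"
    by (subst emeasure_lborel_cbox) (auto simp: Basis_vec_def inner_axis prod.neutral)
  finally show ?thesis
    by (simp add: emeasure_torus)
qed

lemma measure_torus_UNIV [simp]: "measure (torus :: (real ^ 'd) measure) UNIV = 1"
  by (simp add: measure_def emeasure_torus_UNIV)

interpretation torus: finite_measure torus
  by standard (simp add: emeasure_torus_UNIV)

interpretation lborel_torus: pair_sigma_finite lborel torus ..

lemma integral_torus: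
  fixes f :: "real ^ 'd \<Rightarrow> 'b::{banach, second_countable_topology}"
  assumes [measurable]: "f \<in> borel_measurable borel"
  shows "integral\<^sup>L torus f = (LBINT x:cbox 0 (\<chi> i. 1). f x)"
proof -
  have "integral\<^sup>L torus f = (\<integral>x. indicator torus_cell x *\<^sub>R f x \<partial>lborel)"
    unfolding torus_def by (rule integral_density) auto
  also have "\<dots> = (LBINT x:cbox 0 (\<chi> i. 1). f x)"
    unfolding set_lebesgue_integral_def using AE_torus_cell
    by (intro integral_cong_AE) (auto elim!: eventually_mono split: split_indicator)
  finally show ?thesis .
qed

lemma torus_integral_eq:
  "f \<in> borel_measurable borel \<Longrightarrow> torus_integral f = integral\<^sup>L torus f"
  by (simp add: torus_integral_def integral_torus)

lemma torus_integrable_eq: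
  fixes f :: "real ^ 'd \<Rightarrow> real"
  assumes [measurable]: "f \<in> borel_measurable borel"
  shows "torus_integrable f \<longleftrightarrow> integrable torus f"
proof -
  have "integrable torus f \<longleftrightarrow> integrable lborel (\<lambda>x. indicator torus_cell x *\<^sub>R f x)"
    unfolding torus_def by (rule integrable_density) auto
  also have "\<dots> \<longleftrightarrow> torus_integrable f"
    unfolding torus_integrable_def set_integrable_def using AE_torus_cell
    by (intro integrable_cong_AE) (auto elim!: eventually_mono split: split_indicator)
  finally show ?thesis by simp
qed

section \<open>Integer translations and the invariance of torus integrals\<close>

definition int_vec :: "int ^ 'd \<Rightarrow> real ^ 'd" where
  "int_vec k = (\<chi> i. of_int (k $ i))"

lemma periodic_int:
  assumes "periodic f"
  shows "f (x + of_int m *\<^sub>R axis i 1) = f x"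
proof -
  have step: "f (y + axis i 1) = f y" for y
    using assms by (simp add: periodic_def)
  have nat: "f (y + of_nat n *\<^sub>R axis i 1) = f y" for n y
  proof (induction n)
    case (Suc n)
    then show ?case
      using step[of "y + of_nat n *\<^sub>R axis i 1"] by (simp add: algebra_simps)
  qed simp
  show ?thesis
  proof (cases "m \<ge> 0")
    case True
    then show ?thesis using nat[of x "nat m"] by simp
  next
    case False
    then show ?thesis using nat[of "x + of_int m *\<^sub>R axis i 1" "nat (- m)"] by simp
  qed
qed

lemma periodic_int_vec:
  assumes "periodic f"
  shows "f (x + int_vec k) = f x"
proof -
  have "f (x + (\<Sum>i\<in>I. of_int (k $ i) *\<^sub>R axis i 1)) = f x" if "finite I" for I
    using that
  proof (induction I)
    case (insert i I)
    then show ?case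
      using periodic_int[OF assms, of "x + (\<Sum>i\<in>I. of_int (k $ i) *\<^sub>R axis i 1)" "k $ i" i]
      by (simp add: algebra_simps)
  qed simp
  moreover have "int_vec k = (\<Sum>i\<in>UNIV. of_int (k $ i) *\<^sub>R axis i 1)"
    by (simp add: int_vec_def vec_eq_iff axis_def if_distrib[of "\<lambda>x. _ * x"] cong: if_cong)
  ultimately show ?thesis by simp
qed

definition frac_vec :: "real ^ 'd \<Rightarrow> real ^ 'd" where
  "frac_vec x = (\<chi> i. frac (x $ i))"

lemma frac_vec_cell: "frac_vec x \<in> torus_cell"
  by (simp add: frac_vec_def torus_cell_def frac_lt_1)

lemma frac_vec_eq: "frac_vec x = x + int_vec (\<chi> i. - \<lfloor>x $ i\<rfloor>)"
  by (simp add: frac_vec_def int_vec_def vec_eq_iff frac_def)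

lemma frac_vec_int_vec: "frac_vec (x + int_vec k) = frac_vec x"
  by (simp add: frac_vec_def int_vec_def vec_eq_iff)

lemma periodic_frac_vec: "periodic f \<Longrightarrow> f (frac_vec x) = f x"
  by (simp add: frac_vec_eq periodic_int_vec)

lemma measurable_frac_vec [measurable]: "frac_vec \<in> borel_measurable borel"
  unfolding frac_vec_def frac_def
  by (subst borel_measurable_euclidean_space)
    (auto simp: Basis_vec_def inner_axis)

lemma cell_unique: "\<exists>!k. x - int_vec k \<in> torus_cell"
proof (rule ex1I)
  have "x - int_vec (\<chi> i. \<lfloor>x $ i\<rfloor>) = frac_vec x"
    by (simp add: frac_vec_def int_vec_def vec_eq_iff frac_def)
  then show "x - int_vec (\<chi> i. \<lfloor>x $ i\<rfloor>) \<in> torus_cell"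
    by (simp add: frac_vec_cell)
  show "k = (\<chi> i. \<lfloor>x $ i\<rfloor>)" if "x - int_vec k \<in> torus_cell" for k
    using that by (auto simp: torus_cell_def int_vec_def vec_eq_iff) (smt (verit) floor_unique)
qed

lemma emeasure_lborel_translate:
  assumes "S \<in> sets borel"
  shows "emeasure lborel {x. x + c \<in> S} = emeasure lborel (S :: 'a::euclidean_space set)"
proof -
  have "emeasure lborel S = emeasure (distr lborel borel ((+) c)) S"
    by (simp add: lborel_distr_plus)
  also have "\<dots> = emeasure lborel {x. x + c \<in> S}"
    using assms by (subst emeasure_distr) (auto simp: vimage_def add.commute)
  finally show ?thesis by simp
qed

text \<open>Two fundamental cells of the lattice are cut into pieces that agree up to lattice translations.\<close>

lemma int_vec_uminus: "int_vec (- k) = - int_vec k"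
  by (simp add: int_vec_def vec_eq_iff)

lemma translate_cell_borel: "{x. x + c \<in> torus_cell} \<in> sets borel"
  using measurable_sets_borel[of "\<lambda>x. x + c" borel torus_cell] by (simp add: vimage_def)

lemma emeasure_cell_translate:
  fixes A :: "(real ^ 'd) set"
  assumes A_borel: "A \<in> sets borel" and A: "\<And>x k. x + int_vec k \<in> A \<longleftrightarrow> x \<in> A"
  shows "emeasure lborel (A \<inter> {x. x - z \<in> torus_cell}) = emeasure lborel (A \<inter> torus_cell)"
proof -
  \<comment> \<open>\<open>P k\<close> is the part of \<open>A\<close> in the standard cell that the
    shift by \<open>z\<close> assigns to the lattice vector \<open>k\<close>. \<open>R k\<close> is
    its translate by \<open>- int_vec k\<close> and lies in the cell shifted by \<open>z\<close>.
    Reassembling the countably many pieces gives the two sides.\<close>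
  define P where "P k = A \<inter> torus_cell \<inter> {x. x + (- z - int_vec k) \<in> torus_cell}" for k
  define R where "R k = A \<inter> {x. x + int_vec k \<in> torus_cell} \<inter> {x. x + (- z) \<in> torus_cell}" for k
  have meas: "P k \<in> sets borel" "R k \<in> sets borel" for k
    unfolding P_def R_def by (intro sets.Int A_borel translate_cell_borel torus_cell_borel)+
  have uniq: "k = l" if "x - int_vec k \<in> torus_cell" "x - int_vec l \<in> torus_cell"
    for x :: "real ^ 'd" and k l
    using cell_unique that by metis
  have disjP: "disjoint_family P"
  proof (unfold disjoint_family_on_def, intro ballI impI equals0I)
    fix k l x assume "k \<noteq> l" "x \<in> P k \<inter> P l"
    then show False using uniq[where x="x - z" and k=k and l=l] by (simp add: P_def algebra_simps)
  qed
  have disjR: "disjoint_family R"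
  proof (unfold disjoint_family_on_def, intro ballI impI equals0I)
    fix k l x assume "k \<noteq> l" "x \<in> R k \<inter> R l"
    then show False
      using uniq[where k="- k" and l="- l" and x=x] by (simp add: R_def int_vec_uminus)
  qed
  have "A \<inter> torus_cell = (\<Union>k. P k)"
  proof (intro equalityI subsetI)
    fix x assume "x \<in> A \<inter> torus_cell"
    moreover obtain k where "x - z - int_vec k \<in> torus_cell" using cell_unique by metis
    ultimately have "x \<in> P k" by (simp add: P_def algebra_simps)
    then show "x \<in> (\<Union>k. P k)" by blast
  qed (simp add: P_def)
  then have "emeasure lborel (A \<inter> torus_cell) = emeasure lborel (\<Union>k. P k)"
    by (rule arg_cong)
  also have "\<dots> = (\<integral>\<^sup>+k. emeasure lborel (P k) \<partial>count_space UNIV)"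
    by (rule emeasure_UN_countable[OF _ _ disjP]) (simp_all add: meas)
  also have "\<dots> = (\<integral>\<^sup>+k. emeasure lborel (R k) \<partial>count_space UNIV)"
  proof (rule nn_integral_cong)
    fix k
    have "{x. x + int_vec k \<in> P k} = R k"
      by (auto simp: A P_def R_def algebra_simps)
    then show "emeasure lborel (P k) = emeasure lborel (R k)"
      using emeasure_lborel_translate[OF meas(1)[of k], of "int_vec k"] by simp
  qed
  also have "\<dots> = emeasure lborel (\<Union>k. R k)"
    by (rule emeasure_UN_countable[OF _ _ disjR, symmetric]) (simp_all add: meas)
  also have "(\<Union>k. R k) = A \<inter> {x. x - z \<in> torus_cell}"
  proof (intro equalityI subsetI)
    fix x assume "x \<in> A \<inter> {x. x - z \<in> torus_cell}"
    moreover obtain k where "x + int_vec k \<in> torus_cell"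
      using frac_vec_cell[of x] unfolding frac_vec_eq by blast
    ultimately have "x \<in> R k" by (simp add: R_def)
    then show "x \<in> (\<Union>k. R k)" by blast
  qed (auto simp: R_def)
  finally show ?thesis by simp
qed

text \<open>Stated for push-forward measures, so that the invariance of integrals and that of
  integrability both follow by a change of variables. After reduction modulo the lattice,
  translating the argument amounts to changing the fundamental cell.\<close>

lemma distr_torus_translate:
  "distr torus borel (\<lambda>x. frac_vec (x + z)) = distr torus borel (frac_vec :: real ^ 'd \<Rightarrow> _)"
proof (rule measure_eqI)
  fix S :: "(real ^ 'd) set"
  assume "S \<in> sets (distr torus borel (\<lambda>x. frac_vec (x + z)))"
  then have [measurable]: "S \<in> sets borel" by simp
  let ?A = "{x. frac_vec x \<in> S}"
  have A: "?A \<in> sets borel"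
    using measurable_sets_borel[OF measurable_frac_vec, of S] by (simp add: vimage_def)
  have trans: "{x. x + z \<in> ?A} \<in> sets borel"
    using measurable_sets_borel[of "\<lambda>x. x + z" borel ?A] A by (simp add: vimage_def)
  have "emeasure (distr torus borel (\<lambda>x. frac_vec (x + z))) S = emeasure lborel ({x. x + z \<in> ?A} \<inter> torus_cell)"
    using trans by (simp add: emeasure_distr vimage_def emeasure_torus)
  also have "{x. x + z \<in> ?A} \<inter> torus_cell = {x. x + z \<in> ?A \<inter> {x. x - z \<in> torus_cell}}"
    by auto
  also have "emeasure lborel \<dots> = emeasure lborel (?A \<inter> {x. x - z \<in> torus_cell})"
  proof (rule emeasure_lborel_translate)
    have "{x. x - z \<in> torus_cell} \<in> sets borel"
      using measurable_sets_borel[of "\<lambda>x. x - z" borel torus_cell] by (simp add: vimage_def)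
    then show "?A \<inter> {x. x - z \<in> torus_cell} \<in> sets borel" using A by blast
  qed
  also have "\<dots> = emeasure lborel (?A \<inter> torus_cell)"
    using A by (intro emeasure_cell_translate) (simp_all add: frac_vec_int_vec)
  also have "\<dots> = emeasure (distr torus borel frac_vec) S"
    using A by (simp add: emeasure_distr vimage_def emeasure_torus)
  finally show "emeasure (distr torus borel (\<lambda>x. frac_vec (x + z))) S = emeasure (distr torus borel frac_vec) S" .
qed simp

lemma
  fixes f :: "real ^ 'd \<Rightarrow> 'b::{banach, second_countable_topology}"
  assumes [measurable]: "f \<in> borel_measurable borel" and f: "periodic f"
  shows integral_torus_translate: "(\<integral>x. f (x + z) \<partial>torus) = integral\<^sup>L torus f" (is ?I)
    and integrable_torus_translate: "integrable torus (\<lambda>x. f (x + z)) \<longleftrightarrow> integrable torus f" (is ?J)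
proof -
  have "(\<integral>x. f (x + z) \<partial>torus) = (\<integral>x. f (frac_vec (x + z)) \<partial>torus)"
    by (simp add: periodic_frac_vec[OF f])
  also have "\<dots> = integral\<^sup>L (distr torus borel (\<lambda>x. frac_vec (x + z))) f"
    by (rule integral_distr[symmetric]) auto
  also have "\<dots> = (\<integral>x. f (frac_vec x) \<partial>torus)"
    unfolding distr_torus_translate by (rule integral_distr) auto
  finally show ?I by (simp add: periodic_frac_vec[OF f])
  have "integrable torus (\<lambda>x. f (x + z)) \<longleftrightarrow> integrable torus (\<lambda>x. f (frac_vec (x + z)))"
    by (simp add: periodic_frac_vec[OF f])
  also have "\<dots> \<longleftrightarrow> integrable (distr torus borel (\<lambda>x. frac_vec (x + z))) f"
    by (rule integrable_distr_eq[symmetric]) auto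
  also have "\<dots> \<longleftrightarrow> integrable torus (\<lambda>x. f (frac_vec x))"
    unfolding distr_torus_translate by (rule integrable_distr_eq) auto
  finally show ?J by (simp add: periodic_frac_vec[OF f])
qed

lemma lborel_integrable_translate:
  fixes f :: "'a::euclidean_space \<Rightarrow> 'b::{banach, second_countable_topology}"
  assumes "integrable lborel f"
  shows "integrable lborel (\<lambda>x. f (x + c))"
  using integrable_distr[of "(+) c" lborel borel f] assms
  by (simp add: lborel_distr_plus add.commute)

lemma lborel_integral_translate:
  fixes f :: "'a::euclidean_space \<Rightarrow> 'b::{banach, second_countable_topology}"
  assumes [measurable]: "f \<in> borel_measurable borel"
  shows "(\<integral>x. f (x + c) \<partial>lborel) = integral\<^sup>L lborel f"
  using integral_distr[of "(+) c" lborel borel f]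
  by (simp add: lborel_distr_plus add.commute)

lemma lborel_distr_uminus': "distr lborel borel uminus = (lborel :: 'a::euclidean_space measure)"
  using lborel_affine[of "-1" "0::'a"] by (simp add: density_1)

lemma lborel_integral_reflect:
  fixes f :: "'a::euclidean_space \<Rightarrow> 'b::{banach, second_countable_topology}"
  assumes [measurable]: "f \<in> borel_measurable borel"
  shows "(\<integral>x. f (- x) \<partial>lborel) = integral\<^sup>L lborel f"
  using integral_distr[of uminus lborel borel f] by (simp add: lborel_distr_uminus')

lemma lborel_integrable_reflect:
  fixes f :: "'a::euclidean_space \<Rightarrow> 'b::{banach, second_countable_topology}"
  assumes "integrable lborel f"
  shows "integrable lborel (\<lambda>x. f (c - x))"
proof -
  have "integrable lborel (\<lambda>x. f (- x))"
    using integrable_distr[of uminus lborel borel f] assms by (simp add: lborel_distr_uminus')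
  from lborel_integrable_translate[OF this, of "- c"] show ?thesis by simp
qed

text \<open>A ball of radius at most 1/2 fits into a translate of the fundamental cell.\<close>

lemma
  fixes f :: "real ^ 'd \<Rightarrow> real"
  assumes [measurable]: "f \<in> borel_measurable borel" and f: "periodic f" "integrable torus f"
    and nn: "\<And>x. 0 \<le> f x" and r: "r \<le> 1/2"
  shows integrable_small_ball: "integrable lborel (\<lambda>y. indicator (ball c r) y *\<^sub>R f y)" (is ?I)
    and integral_small_ball: "(\<integral>y. indicator (ball c r) y *\<^sub>R f y \<partial>lborel) \<le> integral\<^sup>L torus f" (is ?J)
proof -
  \<comment> \<open>The lower corner of the unit cell centred at \<open>c\<close>.\<close>
  let ?z = "c - (\<chi> i. 1/2)"
  have "integrable torus (\<lambda>x. f (x + ?z))"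
    using f by (simp add: integrable_torus_translate)
  then have "integrable lborel (\<lambda>x. indicator torus_cell x *\<^sub>R f (x + ?z))"
    unfolding torus_def by (subst (asm) integrable_density) auto
  from lborel_integrable_translate[OF this, of "- ?z"]
  have int: "integrable lborel (\<lambda>x. indicator torus_cell (x - ?z) *\<^sub>R f x)"
    by (simp add: diff_conv_add_uminus del: add_uminus_conv_diff minus_diff_eq)
  have sub: "x - ?z \<in> torus_cell" if "x \<in> ball c r" for x
  proof -
    have "x $ i - c $ i < 1/2 \<and> c $ i - x $ i < 1/2" for i
      using component_le_norm_cart[of "x - c" i] that r by (auto simp: dist_norm norm_minus_commute)
    then have "0 \<le> (x - ?z) $ i \<and> (x - ?z) $ i < 1" for i
      by (simp add: field_simps) (smt (verit))
    then show ?thesis by (simp add: torus_cell_def)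
  qed
  have le: "norm (indicator (ball c r) x *\<^sub>R f x) \<le> norm (indicator torus_cell (x - ?z) *\<^sub>R f x)" for x
    using sub by (auto split: split_indicator)
  show ?I
    by (rule Bochner_Integration.integrable_bound[OF int])
      (use le in \<open>auto intro!: borel_measurable_times borel_measurable_indicator\<close>)
  have "(\<integral>y. indicator (ball c r) y *\<^sub>R f y \<partial>lborel) \<le> (\<integral>x. indicator torus_cell (x - ?z) *\<^sub>R f x \<partial>lborel)"
    by (rule integral_mono[OF \<open>?I\<close> int]) (use sub nn in \<open>auto split: split_indicator\<close>)
  also have "\<dots> = (\<integral>x. indicator torus_cell x *\<^sub>R f (x + ?z) \<partial>lborel)"
    using lborel_integral_translate[of "\<lambda>x. indicator torus_cell (x - ?z) *\<^sub>R f x" ?z] by simp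
  also have "\<dots> = (\<integral>x. f (x + ?z) \<partial>torus)"
    unfolding torus_def by (rule integral_density[symmetric]) auto
  also have "\<dots> = integral\<^sup>L torus f"
    by (rule integral_torus_translate) (use f in auto)
  finally show ?J .
qed

text \<open>Convolutions are integrals over the whole space, where periodic functions are in general
  not integrable. Against a compactly supported kernel local integrability is enough.\<close>

definition locally_integrable :: "('a::euclidean_space \<Rightarrow> 'b::{banach, second_countable_topology}) \<Rightarrow> bool" where
  "locally_integrable v \<longleftrightarrow> v \<in> borel_measurable borel \<and> (\<forall>S. compact S \<longrightarrow> set_integrable lborel S v)"

lemma locally_integrable_measurable: "locally_integrable v \<Longrightarrow> v \<in> borel_measurable borel"
  by (simp add: locally_integrable_def)

text \<open>A compact set is covered by finitely many balls of radius 1/2, and each of them fits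
  into a translated cell.\<close>

lemma periodic_locally_integrable:
  fixes v :: "real ^ 'd \<Rightarrow> 'b::{banach, second_countable_topology}"
  assumes [measurable]: "v \<in> borel_measurable borel" and v: "periodic v" "integrable torus v"
  shows "locally_integrable v"
  unfolding locally_integrable_def
proof (intro conjI allI impI)
  have nv: "periodic (\<lambda>x. norm (v x))" using v by (simp add: periodic_def)
  have ball: "set_integrable lborel (ball x (1/2)) v" for x
  proof -
    have "integrable lborel (\<lambda>y. indicator (ball x (1/2)) y *\<^sub>R norm (v y))"
      by (rule integrable_small_ball) (use nv v in auto)
    then show ?thesis unfolding set_integrable_def
      by (rule Bochner_Integration.integrable_bound)
        (auto intro!: borel_measurable_scaleR borel_measurable_indicator)
  qed
  fix S :: "(real ^ 'd) set" assume S: "compact S"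
  have "S \<subseteq> (\<Union>x\<in>S. ball x (1/2))" by auto
  then obtain X where X: "X \<subseteq> S" "finite X" "S \<subseteq> (\<Union>x\<in>X. ball x (1/2))"
    using compactE_image[OF S, of S "\<lambda>x. ball x (1/2)"] by auto
  have "set_integrable lborel (\<Union>x\<in>X. ball x (1/2)) v"
    by (rule set_integrable_UN) (use X ball in auto)
  then show "set_integrable lborel S v"
    by (rule set_integrable_subset) (use X S in \<open>auto intro: borel_compact\<close>)
qed simp

subsection \<open>Convolution with smooth kernels\<close>

definition convolve ::
  "('a::euclidean_space \<Rightarrow> real) \<Rightarrow> ('a \<Rightarrow> 'b::{banach, second_countable_topology}) \<Rightarrow> 'a \<Rightarrow> 'b" where
  "convolve K v x = (\<integral>y. K y *\<^sub>R v (x - y) \<partial>lborel)"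

text \<open>The strict bound makes a kernel vanish outside the open ball of radius 1/2, which fits
  into one translated cell of the lattice. Differentiation preserves the support bound, so
  derivatives of kernels are kernels.\<close>

definition kernel :: "('a::euclidean_space \<Rightarrow> real) \<Rightarrow> bool" where
  "kernel K \<longleftrightarrow> smooth K \<and> (\<exists>r<1/2. \<forall>y. r < norm y \<longrightarrow> K y = 0)"

lemma kernel_smooth: "kernel K \<Longrightarrow> smooth K"
  by (simp add: kernel_def)

lemma kernel_continuous: "kernel K \<Longrightarrow> continuous_on A K"
  by (simp add: kernel_def smooth_imp_continuous)

lemma kernel_measurable: "kernel K \<Longrightarrow> K \<in> borel_measurable borel"
  by (rule borel_measurable_continuous_onI[OF kernel_continuous])

lemma kernel_eq_0: "kernel K \<Longrightarrow> 1/2 \<le> norm y \<Longrightarrow> K y = 0"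
  unfolding kernel_def by (meson less_le_trans)

lemma kernel_dir_deriv:
  assumes "kernel K"
  shows "kernel (dir_deriv b K)"
proof -
  obtain r where r: "r < 1/2" "\<And>y. r < norm y \<Longrightarrow> K y = 0"
    using assms unfolding kernel_def by blast
  have "dir_deriv b K y = 0" if "r < norm y" for y
  proof -
    have "((\<lambda>_. 0) has_derivative (\<lambda>_. 0)) (at y)" by simp
    then have "(K has_derivative (\<lambda>_. 0)) (at y)"
      by (rule has_derivative_transform_within_open[where s="{y. r < norm y}"])
        (use that r in \<open>auto intro!: open_Collect_less continuous_intros\<close>)
    then show ?thesis by (rule dir_deriv_eq)
  qed
  then show ?thesis
    using assms r unfolding kernel_def by (auto intro: smooth_dir_deriv)
qed

lemma kernel_bound:
  assumes "kernel K"
  obtains B where "0 < B" "\<And>y. \<bar>K y\<bar> \<le> B * indicator (ball 0 (1/2)) y"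
proof -
  have "bounded (K ` cball 0 (1/2))"
    by (intro compact_imp_bounded compact_continuous_image kernel_continuous assms compact_cball)
  then obtain B where B: "0 < B" "\<And>y. y \<in> cball 0 (1/2) \<Longrightarrow> \<bar>K y\<bar> \<le> B"
    unfolding bounded_pos by auto
  have "\<bar>K y\<bar> \<le> B * indicator (ball 0 (1/2)) y" for y
    using B kernel_eq_0[OF assms, of y] by (auto split: split_indicator)
  then show ?thesis using B that by blast
qed

lemma lborel_integral_reflect':
  fixes f :: "'a::euclidean_space \<Rightarrow> 'b::{banach, second_countable_topology}"
  assumes [measurable]: "f \<in> borel_measurable borel"
  shows "(\<integral>y. f (x - y) \<partial>lborel) = integral\<^sup>L lborel f"
  using lborel_integral_reflect[of "\<lambda>y. f (x + y)"] lborel_integral_translate[of f x]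
  by (simp add: add.commute)

context
  fixes K :: "'a::euclidean_space \<Rightarrow> real" and v :: "'a \<Rightarrow> 'b::{banach, second_countable_topology}"
  assumes K: "kernel K" and v: "locally_integrable v"
begin

lemma convolve_integrable': "integrable lborel (\<lambda>y. K (x - y) *\<^sub>R v y)"
proof -
  note [measurable] = kernel_measurable[OF K] locally_integrable_measurable[OF v]
  obtain B where B: "0 < B" "\<And>y. \<bar>K y\<bar> \<le> B * indicator (ball 0 (1/2)) y"
    using kernel_bound[OF K] by blast
  have "set_integrable lborel (cball x (1/2)) v"
    using v unfolding locally_integrable_def by auto
  then have "integrable lborel (\<lambda>y. B *\<^sub>R (indicator (cball x (1/2)) y *\<^sub>R v y))"
    unfolding set_integrable_def by (rule integrable_scaleR_right)
  then show ?thesis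
  proof (rule Bochner_Integration.integrable_bound)
    have "norm (K (x - y) *\<^sub>R v y) \<le> norm (B *\<^sub>R (indicator (cball x (1/2)) y *\<^sub>R v y))" for y
      using B(1) B(2)[of "x - y"]
      by (auto simp: dist_norm norm_minus_commute intro!: mult_right_mono split: split_indicator_asm split_indicator)
    then show "AE y in lborel. norm (K (x - y) *\<^sub>R v y) \<le> norm (B *\<^sub>R (indicator (cball x (1/2)) y *\<^sub>R v y))"
      by simp
  qed simp
qed

lemma convolve_integrable: "integrable lborel (\<lambda>y. K y *\<^sub>R v (x - y))"
  using lborel_integrable_reflect[OF convolve_integrable'[of x], of x] by simp

lemma convolve_alt: "convolve K v x = (\<integral>y. K (x - y) *\<^sub>R v y \<partial>lborel)"
  using lborel_integral_reflect'[of "\<lambda>y. K (x - y) *\<^sub>R v y" x] borel_measurable_integrable[OF convolve_integrable'[of x]]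
  by (simp add: convolve_def)

end

text \<open>Supplies the dominating function for the difference quotients of a convolution. The
  constant is the sum of the bounds for the derivatives in the basis directions.\<close>

lemma kernel_lipschitz:
  fixes K :: "'a::euclidean_space \<Rightarrow> real"
  assumes K: "kernel K"
  obtains L where "0 < L" "\<And>z h. \<bar>K (z + h) - K z\<bar> \<le> L * norm h" "\<And>z h. \<bar>dir_deriv h K z\<bar> \<le> L * norm h"
proof -
  have "\<exists>B>0. \<forall>y. \<bar>dir_deriv i K y\<bar> \<le> B" for i
  proof -
    obtain B where B: "0 < B" "\<And>y. \<bar>dir_deriv i K y\<bar> \<le> B * indicator (ball 0 (1/2)) y"
      using kernel_bound[OF kernel_dir_deriv[OF K]] by blast
    have "\<bar>dir_deriv i K y\<bar> \<le> B" for y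
      using B(1) B(2)[of y] by (cases "y \<in> ball 0 (1/2)") auto
    then show ?thesis using B by blast
  qed
  then obtain B where B: "\<And>i. 0 < B i" "\<And>i y. \<bar>dir_deriv i K y\<bar> \<le> B i" by metis
  define L where "L = (\<Sum>i\<in>Basis. B i)"
  have L: "0 < L" unfolding L_def by (intro sum_pos B) auto
  have D: "\<bar>dir_deriv h K z\<bar> \<le> L * norm h" for h z
  proof -
    have "dir_deriv h K z = (\<Sum>i\<in>Basis. (h \<bullet> i) *\<^sub>R dir_deriv i K z)"
      by (rule dir_deriv_basis[OF smooth_imp_differentiable[OF kernel_smooth[OF K]]])
    also have "\<bar>\<dots>\<bar> \<le> (\<Sum>i\<in>Basis. B i * norm h)"
    proof (rule order_trans[OF sum_abs sum_mono])
      fix i :: 'a assume "i \<in> Basis"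
      then have "\<bar>h \<bullet> i\<bar> * \<bar>dir_deriv i K z\<bar> \<le> norm h * B i"
        by (intro mult_mono Basis_le_norm B) auto
      then show "\<bar>(h \<bullet> i) *\<^sub>R dir_deriv i K z\<bar> \<le> B i * norm h"
        by (simp add: abs_mult mult.commute)
    qed
    finally show ?thesis by (simp add: L_def sum_distrib_right)
  qed
  have "norm (K (z + h) - K z) \<le> L * norm (z + h - z)" for z h
  proof (rule differentiable_bound)
    show "(K has_derivative (\<lambda>b. dir_deriv b K x)) (at x within UNIV)" for x
      by (rule smooth_has_derivative[OF kernel_smooth[OF K]])
    show "onorm (\<lambda>b. dir_deriv b K x) \<le> L" for x
      using D by (intro onorm_le) auto
  qed auto
  then show ?thesis using that[OF L _ D] by auto
qed

text \<open>Only the kernel is differentiated, as \<open>v\<close> need not even be continuous.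
  Dominated convergence is applied to the remainder of the first-order expansion of
  \<open>K\<close>, divided by the length of the increment.\<close>

lemma convolve_has_derivative:
  fixes v :: "'a::euclidean_space \<Rightarrow> 'b::{banach, second_countable_topology}"
  assumes K: "kernel K" and v: "locally_integrable v"
  shows "(convolve K v has_derivative (\<lambda>h. convolve (dir_deriv h K) v x)) (at x)"
proof -
  note [measurable] = kernel_measurable[OF K] kernel_measurable[OF kernel_dir_deriv[OF K]]
    locally_integrable_measurable[OF v]
  note int = convolve_integrable'[OF K v] convolve_integrable'[OF kernel_dir_deriv[OF K] v]
  have der: "(K has_derivative (\<lambda>b. dir_deriv b K z)) (at z)" for z
    by (rule smooth_has_derivative[OF kernel_smooth[OF K]])
  then have lin: "linear (\<lambda>b. dir_deriv b K z)" for z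
    using has_derivative_linear by blast
  obtain L where L: "0 < L" "\<And>z h. \<bar>K (z + h) - K z\<bar> \<le> L * norm h" "\<And>z h. \<bar>dir_deriv h K z\<bar> \<le> L * norm h"
    using kernel_lipschitz[OF K] by blast
  have lin': "linear (\<lambda>h. convolve (dir_deriv h K) v x)"
    unfolding convolve_alt[OF kernel_dir_deriv[OF K] v]
    by (rule linearI)
      (simp_all add: linear_add[OF lin] linear_cmul[OF lin] scaleR_left_distrib int
        flip: scaleR_scaleR)
  have lim: "((\<lambda>y. norm ((convolve K v y - convolve K v x) - convolve (dir_deriv (y - x) K) v x) / norm (y - x)) \<longlongrightarrow> 0)
      (at x within ball x 1)"
    \<comment> \<open>Dominated convergence works along sequences, so the limit is expressed by
      sequences in the unit ball around \<open>x\<close>; this ball is open, which makes the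
      restriction immaterial.\<close>
    unfolding tendsto_at_iff_sequentially comp_def
  proof (intro allI impI)
    fix X assume X: "\<forall>i. X i \<in> ball x 1 - {x}" "X \<longlonglongrightarrow> x"
    define q where "q n y = ((K (X n - y) - K (x - y) - dir_deriv (X n - x) K (x - y)) / norm (X n - x)) *\<^sub>R v y" for n y
    have "(\<lambda>n. integral\<^sup>L lborel (q n)) \<longlonglongrightarrow> integral\<^sup>L lborel (\<lambda>y::'a. 0)"
    \<comment> \<open>The factor 2 * L bounds the increment of \<open>K\<close> and its linear part
      by \<open>L\<close> each. The radius 3/2 is 1 for the distance between \<open>X n\<close> and
      \<open>x\<close> plus 1/2 for the support of the kernel.\<close>
    proof (rule integral_dominated_convergence[where w="\<lambda>y. norm ((2 * L) *\<^sub>R (indicator (cball x (3/2)) y *\<^sub>R v y))"])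
      have "set_integrable lborel (cball x (3/2)) v"
        using v unfolding locally_integrable_def by auto
      then show "integrable lborel (\<lambda>y. norm ((2 * L) *\<^sub>R (indicator (cball x (3/2)) y *\<^sub>R v y)))"
        unfolding set_integrable_def by (intro integrable_norm integrable_scaleR_right)
      show "AE y in lborel. (\<lambda>n. q n y) \<longlonglongrightarrow> 0"
      proof (rule AE_I2)
        fix y
        have "((\<lambda>z. norm ((K z - K (x - y)) - dir_deriv (z - (x - y)) K (x - y)) / norm (z - (x - y))) \<longlongrightarrow> 0) (at (x - y))"
          using der[of "x - y"] unfolding has_derivative_iff_norm by blast
        moreover have "filterlim (\<lambda>n. X n - y) (at (x - y)) sequentially"
          unfolding filterlim_at using X by (auto intro!: tendsto_intros)
        ultimately have "(\<lambda>n. norm ((K (X n - y) - K (x - y)) - dir_deriv (X n - y - (x - y)) K (x - y)) / norm (X n - y - (x - y))) \<longlonglongrightarrow> 0"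
          by (rule filterlim_compose)
        then have "(\<lambda>n. (K (X n - y) - K (x - y) - dir_deriv (X n - x) K (x - y)) / norm (X n - x)) \<longlonglongrightarrow> 0"
          by (subst tendsto_norm_zero_iff[symmetric]) (simp add: abs_divide)
        then show "(\<lambda>n. q n y) \<longlonglongrightarrow> 0"
          unfolding q_def using tendsto_scaleR[OF _ tendsto_const] by fastforce
      qed
      fix n
      show "AE y in lborel. norm (q n y) \<le> norm ((2 * L) *\<^sub>R (indicator (cball x (3/2)) y *\<^sub>R v y))"
      proof (rule AE_I2)
        fix y
        have Xn: "norm (X n - x) > 0" "norm (X n - x) < 1" using X by (auto simp: dist_norm norm_minus_commute)
        show "norm (q n y) \<le> norm ((2 * L) *\<^sub>R (indicator (cball x (3/2)) y *\<^sub>R v y))"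
        proof (cases "y \<in> cball x (3/2)")
          case True
          have "\<bar>K (X n - y) - K (x - y) - dir_deriv (X n - x) K (x - y)\<bar> \<le> (2 * L) * norm (X n - x)"
            using L(2)[of "x - y" "X n - x"] L(3)[of "X n - x" "x - y"] by (auto simp: algebra_simps)
          then have "\<bar>(K (X n - y) - K (x - y) - dir_deriv (X n - x) K (x - y)) / norm (X n - x)\<bar> \<le> 2 * L"
            using Xn by (simp add: abs_divide pos_divide_le_eq)
          then have "norm (q n y) \<le> 2 * L * norm (v y)"
            unfolding q_def norm_scaleR by (rule mult_right_mono) simp
          then show ?thesis using True L(1) by simp
        next
          case False
          then have "3/2 < norm (x - y)" by (simp add: dist_norm)
          moreover have "norm (x - y) \<le> norm (X n - y) + norm (X n - x)"
            by (metis norm_minus_commute norm_diff_triangle_le order_refl add.commute)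
          ultimately have "1/2 \<le> norm (X n - y)" "1/2 \<le> norm (x - y)" using Xn by auto
          then have "q n y = 0"
            unfolding q_def using kernel_eq_0[OF K] kernel_eq_0[OF kernel_dir_deriv[OF K]] by simp
          then show ?thesis by simp
        qed
      qed
      show "q n \<in> borel_measurable lborel" unfolding q_def by measurable
    qed simp
    then have lim: "(\<lambda>n. norm (\<integral>y. q n y \<partial>lborel)) \<longlonglongrightarrow> 0"
      using tendsto_norm_zero by fastforce
    have "norm ((convolve K v (X n) - convolve K v x) - convolve (dir_deriv (X n - x) K) v x) / norm (X n - x)
        = norm (\<integral>y. q n y \<partial>lborel)" for n
    proof -
      have "q n y = inverse (norm (X n - x)) *\<^sub>R ((K (X n - y) *\<^sub>R v y - K (x - y) *\<^sub>R v y) - dir_deriv (X n - x) K (x - y) *\<^sub>R v y)" for y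
        unfolding q_def by (simp add: scaleR_left_diff_distrib[symmetric] divide_inverse mult.commute)
      then have "(\<integral>y. q n y \<partial>lborel) = inverse (norm (X n - x)) *\<^sub>R
          ((convolve K v (X n) - convolve K v x) - convolve (dir_deriv (X n - x) K) v x)"
        by (simp add: convolve_alt[OF K v] convolve_alt[OF kernel_dir_deriv[OF K] v] int)
      then show ?thesis by (simp add: divide_inverse mult.commute)
    qed
    then show "(\<lambda>n. norm ((convolve K v (X n) - convolve K v x) - convolve (dir_deriv (X n - x) K) v x) / norm (X n - x)) \<longlonglongrightarrow> 0"
      using lim by simp
  qed
  have "at x within ball x 1 = at x" by (rule at_within_open) auto
  note lim[unfolded this]
  then show ?thesis
    unfolding has_derivative_iff_norm using lin' linear_conv_bounded_linear by blast
qed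

lemma dir_deriv_convolve:
  assumes "kernel K" "locally_integrable v"
  shows "dir_deriv b (convolve K v) = convolve (dir_deriv b K) v"
  using dir_deriv_eq[OF convolve_has_derivative[OF assms]] by blast

lemma smooth_convolve:
  assumes K: "kernel K" and v: "locally_integrable v"
  shows "smooth (convolve K v)"
proof -
  have "C_upto n (convolve K v)" for n
    using K
  proof (induction n arbitrary: K)
    case 0
    then show ?case
      using has_derivative_continuous[OF convolve_has_derivative[OF _ v]]
      by (auto intro!: continuous_at_imp_continuous_on)
  next
    case (Suc n)
    then show ?case
      by (intro C_upto_SucI[OF convolve_has_derivative[OF _ v]]) (auto intro: kernel_dir_deriv)
  qed
  then show ?thesis by (simp add: smooth_def)
qed

lemma convolve_const: "convolve K (\<lambda>_. c) = (\<lambda>_. (\<integral>y. K y *\<^sub>R c \<partial>lborel))"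
  by (auto simp: convolve_def)

lemma locally_integrable_continuous:
  fixes v :: "'a::euclidean_space \<Rightarrow> 'b::{banach, second_countable_topology}"
  assumes "continuous_on UNIV v"
  shows "locally_integrable v"
  unfolding locally_integrable_def
proof (intro conjI allI impI)
  show "v \<in> borel_measurable borel" by (rule borel_measurable_continuous_onI[OF assms])
  fix S :: "'a set" assume "compact S"
  then show "set_integrable lborel S v"
    unfolding set_integrable_def
    by (intro borel_integrable_compact continuous_on_subset[OF assms]) auto
qed

text \<open>The convolution with a constant is constant, so its derivative vanishes.\<close>

lemma integral_dir_deriv_kernel:
  assumes "kernel K"
  shows "(\<integral>y. dir_deriv b K y \<partial>lborel) = 0"
proof -
  have "locally_integrable (\<lambda>_::'a. 1::real)"
    by (rule locally_integrable_continuous) simp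
  from dir_deriv_convolve[OF assms this, of b] show ?thesis
    by (simp add: convolve_const dir_deriv_def fun_eq_iff)
qed

lemma kernel_mult:
  assumes "kernel K" "smooth f"
  shows "kernel (\<lambda>y. K y * f y)"
  using assms unfolding kernel_def by (auto intro: smooth_mult)

text \<open>As a function of y, the product of K(y) and f(x - y) is itself a kernel, so its
  derivative has integral 0. The product rule turns this into an exchange of the derivative between
  the two factors.\<close>

lemma dir_deriv_convolve_right:
  fixes f :: "'a::euclidean_space \<Rightarrow> real"
  assumes K: "kernel K" and f: "smooth f"
  shows "dir_deriv b (convolve K f) = convolve K (dir_deriv b f)"
proof
  fix x
  have loc: "locally_integrable f" "locally_integrable (dir_deriv b f)"
    using f by (auto intro!: locally_integrable_continuous smooth_imp_continuous smooth_dir_deriv)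
  have sm: "smooth (\<lambda>y. f (x - y))"
    by (intro smooth_compose[OF f] smooth_diff smooth_const smooth_ident)
  have "((\<lambda>y. f (x - y)) has_derivative (\<lambda>h. dir_deriv (- h) f (x - y))) (at y)" for y
    by (rule has_derivative_compose[OF _ smooth_has_derivative[OF f]]) (auto intro!: derivative_eq_intros)
  moreover have "dir_deriv (- b) f (x - y) = - dir_deriv b f (x - y)" for y
    using linear_neg[OF has_derivative_linear[OF smooth_has_derivative[OF f]]] .
  ultimately have D: "dir_deriv b (\<lambda>y. f (x - y)) y = - dir_deriv b f (x - y)" for y
    using dir_deriv_eq by metis
  have "0 = (\<integral>y. dir_deriv b (\<lambda>y. K y * f (x - y)) y \<partial>lborel)"
    by (rule integral_dir_deriv_kernel[OF kernel_mult[OF K sm], symmetric])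
  also have "\<dots> = (\<integral>y. dir_deriv b K y *\<^sub>R f (x - y) - K y *\<^sub>R dir_deriv b f (x - y) \<partial>lborel)"
    by (intro Bochner_Integration.integral_cong refl)
      (simp add: dir_deriv_mult[OF kernel_smooth[OF K] sm] D)
  also have "\<dots> = convolve (dir_deriv b K) f x - convolve K (dir_deriv b f) x"
    unfolding convolve_def
    by (intro Bochner_Integration.integral_diff convolve_integrable K kernel_dir_deriv loc)
  finally show "dir_deriv b (convolve K f) x = convolve K (dir_deriv b f) x"
    by (simp add: dir_deriv_convolve[OF K loc(1)])
qed

lemma periodic_convolve:
  assumes "periodic v"
  shows "periodic (convolve K v)"
proof -
  have "v (x + axis i 1 - y) = v (x - y)" for x y i
    using assms[unfolded periodic_def, rule_format, of "x - y" i] by (simp add: algebra_simps)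
  then show ?thesis by (simp add: periodic_def convolve_def)
qed

lemma convolve_bounded_linear:
  assumes "bounded_linear L" "kernel K" "locally_integrable v"
  shows "convolve K (\<lambda>x. L (v x)) x = L (convolve K v x)"
proof -
  interpret bounded_linear L by fact
  show ?thesis
    unfolding convolve_def
    by (subst integral_bounded_linear[OF assms(1) convolve_integrable[OF assms(2,3)], symmetric])
      (simp add: scaleR)
qed

lemma convolve_vec_nth:
  "kernel K \<Longrightarrow> locally_integrable v \<Longrightarrow> convolve K (\<lambda>x. v x $ i) x = convolve K v x $ i"
  using convolve_bounded_linear[OF bounded_linear_vec_nth] .

text \<open>Measurability is kept joint in time and space because the estimates at fixed times are
  later integrated over time.\<close>

lemma measurable_convolve:
  fixes v :: "'t \<Rightarrow> 'a::euclidean_space \<Rightarrow> 'b::{banach, second_countable_topology}"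
  assumes K: "kernel K" and v: "(\<lambda>(t, x). v t x) \<in> borel_measurable (M \<Otimes>\<^sub>M borel)"
  shows "(\<lambda>(t, x). convolve K (v t) x) \<in> borel_measurable (M \<Otimes>\<^sub>M borel)"
proof -
  note [measurable] = kernel_measurable[OF K]
  have "(\<lambda>p. (fst (fst p), snd (fst p) - snd p)) \<in> measurable ((M \<Otimes>\<^sub>M borel) \<Otimes>\<^sub>M lborel) (M \<Otimes>\<^sub>M (borel :: 'a measure))"
    by measurable
  from measurable_compose[OF this v]
  have [measurable]: "(\<lambda>p. v (fst (fst p)) (snd (fst p) - snd p)) \<in> borel_measurable ((M \<Otimes>\<^sub>M borel) \<Otimes>\<^sub>M lborel)"
    by simp
  have "(\<lambda>p. \<integral>y. K y *\<^sub>R v (fst p) (snd p - y) \<partial>lborel) \<in> borel_measurable (M \<Otimes>\<^sub>M borel)"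
    by (rule lborel.borel_measurable_lebesgue_integral) (simp add: split_beta')
  then show ?thesis by (simp add: convolve_def split_beta')
qed

subsection \<open>Convolution of periodic functions\<close>

definition torus_L1 :: "(real ^ 'd \<Rightarrow> 'b::{banach, second_countable_topology}) \<Rightarrow> bool" where
  "torus_L1 v \<longleftrightarrow> v \<in> borel_measurable borel \<and> periodic v \<and> integrable torus v"

lemma torus_L1_locally_integrable: "torus_L1 v \<Longrightarrow> locally_integrable v"
  by (simp add: torus_L1_def periodic_locally_integrable)

lemma torus_L1_measurable: "torus_L1 v \<Longrightarrow> v \<in> borel_measurable borel"
  and torus_L1_periodic: "torus_L1 v \<Longrightarrow> periodic v"
  and torus_L1_integrable: "torus_L1 v \<Longrightarrow> integrable torus v"
  by (simp_all add: torus_L1_def)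

lemma borel_measurable_lborel_translate:
  fixes v :: "'a::euclidean_space \<Rightarrow> 'b::{banach, second_countable_topology}"
  assumes "v \<in> borel_measurable borel"
  shows "(\<lambda>y. v (x - y)) \<in> borel_measurable borel" "(\<lambda>y. v (y + x)) \<in> borel_measurable borel"
    "(\<lambda>y. v (y - x)) \<in> borel_measurable borel"
  by (rule measurable_compose[OF _ assms], simp)+

lemma integrable_torus_bounded:
  fixes f :: "real ^ 'd \<Rightarrow> 'b::{banach, second_countable_topology}"
  assumes "f \<in> borel_measurable borel" "\<And>x. norm (f x) \<le> B"
  shows "integrable torus f"
  by (rule torus.integrable_const_bound[of _ B]) (use assms in auto)

lemma periodic_bounded:
  fixes f :: "real ^ 'd \<Rightarrow> 'b::real_normed_vector"
  assumes f: "periodic f" "continuous_on UNIV f"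
  obtains B where "0 < B" "\<And>x. norm (f x) \<le> B"
proof -
  have "bounded (f ` cbox 0 (\<chi> i. 1))"
    by (intro compact_imp_bounded compact_continuous_image continuous_on_subset[OF f(2)]) auto
  then obtain B where B: "0 < B" "\<And>x. x \<in> cbox 0 (\<chi> i. 1) \<Longrightarrow> norm (f x) \<le> B"
    unfolding bounded_pos by auto
  have "norm (f x) \<le> B" for x
  proof -
    have "frac_vec x \<in> cbox 0 (\<chi> i. 1)"
      using frac_vec_cell[of x] by (auto simp: torus_cell_def mem_box_cart less_imp_le)
    from B(2)[OF this] show ?thesis by (simp add: periodic_frac_vec[OF f(1)])
  qed
  then show ?thesis using B(1) that by blast
qed

lemma torus_L1_continuous:
  fixes f :: "real ^ 'd \<Rightarrow> 'b::{banach, second_countable_topology}"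
  assumes f: "periodic f" "continuous_on UNIV f"
  shows "torus_L1 f"
proof -
  obtain B where "\<And>x. norm (f x) \<le> B" using periodic_bounded[OF f] by blast
  then show ?thesis
    using f borel_measurable_continuous_onI[OF f(2)] by (auto simp: torus_L1_def intro: integrable_torus_bounded)
qed

lemma torus_L1_smooth:
  fixes f :: "real ^ 'd \<Rightarrow> 'b::{banach, second_countable_topology}"
  shows "periodic f \<Longrightarrow> smooth f \<Longrightarrow> torus_L1 f"
  by (simp add: torus_L1_continuous smooth_imp_continuous)

text \<open>Young's inequality from L^1 to the sup norm. The support of the kernel, reflected and
  moved to \<open>x\<close>, stays inside one translated cell, so an integral over the whole space
  is bounded by one over the torus.\<close>

lemma integral_kernel_le:
  fixes v :: "real ^ 'd \<Rightarrow> 'b::{banach, second_countable_topology}"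
  assumes K: "kernel K" "\<And>y. \<bar>K y\<bar> \<le> B * indicator (ball 0 (1/2)) y" and v: "torus_L1 v"
  shows "(\<integral>y. norm (K y *\<^sub>R v (x - y)) \<partial>lborel) \<le> B * (\<integral>y. norm (v y) \<partial>torus)"
proof -
  note [measurable] = kernel_measurable[OF K(1)] torus_L1_measurable[OF v]
  have B: "0 \<le> B" using order_trans[OF abs_ge_zero K(2)[of 0]] by simp
  have nv: "(\<lambda>x. norm (v x)) \<in> borel_measurable borel" "periodic (\<lambda>x. norm (v x))" "integrable torus (\<lambda>x. norm (v x))"
    using v by (auto simp: torus_L1_def periodic_def)
  have "(\<integral>y. norm (K y *\<^sub>R v (x - y)) \<partial>lborel) = (\<integral>y. norm (K (x - y) *\<^sub>R v y) \<partial>lborel)"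
    using lborel_integral_reflect'[of "\<lambda>y. norm (K (x - y) *\<^sub>R v y)" x] by simp
  also have "\<dots> \<le> (\<integral>y. B * (indicator (ball x (1/2)) y *\<^sub>R norm (v y)) \<partial>lborel)"
  proof (rule integral_mono)
    show "integrable lborel (\<lambda>y. norm (K (x - y) *\<^sub>R v y))"
      by (intro integrable_norm convolve_integrable' K torus_L1_locally_integrable v)
    show "integrable lborel (\<lambda>y. B * (indicator (ball x (1/2)) y *\<^sub>R norm (v y)))"
      by (intro integrable_mult_right integrable_small_ball nv) auto
    fix y
    have "indicator (ball 0 (1/2)) (x - y) = (indicator (ball x (1/2)) y :: real)"
      by (simp add: indicator_def dist_norm norm_minus_commute)
    then have "\<bar>K (x - y)\<bar> * norm (v y) \<le> (B * indicator (ball x (1/2)) y) * norm (v y)"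
      using K(2)[of "x - y"] by (intro mult_right_mono) auto
    then show "norm (K (x - y) *\<^sub>R v y) \<le> B * (indicator (ball x (1/2)) y *\<^sub>R norm (v y))"
      by simp
  qed
  also have "\<dots> \<le> B * (\<integral>y. norm (v y) \<partial>torus)"
    using integral_small_ball[OF nv, of "1/2" x] B by (auto intro!: mult_left_mono)
  finally show ?thesis .
qed

lemma convolve_norm_le:
  fixes v :: "real ^ 'd \<Rightarrow> 'b::{banach, second_countable_topology}"
  assumes "kernel K" "\<And>y. \<bar>K y\<bar> \<le> B * indicator (ball 0 (1/2)) y" "torus_L1 v"
  shows "norm (convolve K v x) \<le> B * (\<integral>y. norm (v y) \<partial>torus)"
  using order_trans[OF integral_norm_bound integral_kernel_le[OF assms]] unfolding convolve_def .

lemma smooth_convolve_L1: "kernel K \<Longrightarrow> torus_L1 v \<Longrightarrow> smooth (convolve K v)"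
  by (simp add: smooth_convolve torus_L1_locally_integrable)

lemma torus_L1_convolve: "kernel K \<Longrightarrow> torus_L1 v \<Longrightarrow> torus_L1 (convolve K v)"
  by (rule torus_L1_smooth[OF periodic_convolve[OF torus_L1_periodic] smooth_convolve_L1])

lemma kernel_integrable: "kernel K \<Longrightarrow> integrable lborel K"
  using convolve_integrable[of K "\<lambda>_. 1::real"] by (simp add: locally_integrable_continuous)

lemma kernel_product_integrable:
  fixes F :: "'a::euclidean_space \<times> 'c \<Rightarrow> 'b::{banach, second_countable_topology}"
  assumes M: "sigma_finite_measure M" and F: "F \<in> borel_measurable (lborel \<Otimes>\<^sub>M M)"
    and K: "kernel K" and int: "\<And>y. integrable M (\<lambda>x. F (y, x))"
    and le: "\<And>y. (\<integral>x. norm (F (y, x)) \<partial>M) \<le> c * \<bar>K y\<bar>"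
  shows "integrable (lborel \<Otimes>\<^sub>M M) F"
proof -
  interpret M: sigma_finite_measure M by fact
  interpret pair_sigma_finite lborel M ..
  note [measurable] = F
  show ?thesis
  proof (rule Fubini_integrable[OF F])
    have "integrable lborel (\<lambda>y. c * \<bar>K y\<bar>)"
      by (intro integrable_mult_right integrable_abs kernel_integrable K)
    then show "integrable lborel (\<lambda>y. \<integral>x. norm (F (y, x)) \<partial>M)"
      by (rule Bochner_Integration.integrable_bound) (auto intro: order_trans[OF le abs_ge_self])
  qed (use int in simp)
qed

text \<open>Fubini, and for each fixed \<open>y\<close> a translation of the torus variable by
  \<open>y\<close>, which moves the shift from \<open>g\<close> to \<open>f\<close>. Collecting the
  shifts again gives a convolution with the reflected kernel.\<close>

lemma convolve_adjoint:
  fixes f g :: "real ^ 'd \<Rightarrow> real"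
  assumes K: "kernel K" and f: "torus_L1 f"
    and g: "g \<in> borel_measurable borel" "periodic g" "\<And>x. \<bar>g x\<bar> \<le> G"
  shows "(\<integral>x. f x * convolve K g x \<partial>torus) = (\<integral>x. convolve (\<lambda>y. K (- y)) f x * g x \<partial>torus)"
proof -
  note [measurable] = kernel_measurable[OF K] torus_L1_measurable[OF f] g(1)
  have fn: "integrable torus (\<lambda>x. \<bar>f x\<bar>)" "periodic (\<lambda>x. \<bar>f x\<bar>)"
    using f by (auto simp: torus_L1_def periodic_def)
  have fi: "integrable torus (\<lambda>x. f (x + y))" for y
    using integrable_torus_translate[of f y] f by (simp add: torus_L1_def)
  have gb: "\<bar>u * g x\<bar> \<le> G * \<bar>u\<bar>" for u x
    using mult_left_mono[OF g(3)[of x] abs_ge_zero[of u]] by (simp add: abs_mult mult.commute)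
  have int1: "integrable torus (\<lambda>x. f x * g (x - y))" for y
    by (rule Bochner_Integration.integrable_bound[OF integrable_mult_right[OF fn(1), of G]])
      (auto intro!: AE_I2 order_trans[OF gb abs_ge_self])
  have int2: "integrable torus (\<lambda>x. f (x + y) * g x)" for y
    by (rule Bochner_Integration.integrable_bound[OF integrable_mult_right[OF integrable_abs[OF fi], of G]])
      (auto intro!: AE_I2 order_trans[OF gb abs_ge_self])
  have le1: "(\<integral>x. \<bar>f x * g (x - y)\<bar> \<partial>torus) \<le> G * (\<integral>x. \<bar>f x\<bar> \<partial>torus)" for y
    using integral_mono[OF integrable_abs[OF int1] integrable_mult_right[OF fn(1), of G]] gb by simp
  have le2: "(\<integral>x. \<bar>f (x + y) * g x\<bar> \<partial>torus) \<le> G * (\<integral>x. \<bar>f x\<bar> \<partial>torus)" for y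
    using integral_mono[OF integrable_abs[OF int2] integrable_mult_right[OF integrable_abs[OF fi[of y]], of G]] gb
      integral_torus_translate[OF _ fn(2), of y] by simp
  have I1: "integrable (lborel \<Otimes>\<^sub>M torus) (\<lambda>(y, x). K y * (f x * g (x - y)))"
    by (rule kernel_product_integrable[OF torus.sigma_finite_measure_axioms _ K, where c="G * (\<integral>x. \<bar>f x\<bar> \<partial>torus)"])
      (use int1 mult_left_mono[OF le1 abs_ge_zero] in \<open>auto simp: abs_mult mult.commute mult.left_commute\<close>)
  have I2: "integrable (lborel \<Otimes>\<^sub>M torus) (\<lambda>(y, x). K y * (f (x + y) * g x))"
    by (rule kernel_product_integrable[OF torus.sigma_finite_measure_axioms _ K, where c="G * (\<integral>x. \<bar>f x\<bar> \<partial>torus)"])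
      (use int2 mult_left_mono[OF le2 abs_ge_zero] in \<open>auto simp: abs_mult mult.commute mult.left_commute\<close>)
  have "(\<integral>x. f x * convolve K g x \<partial>torus) = (\<integral>x. (\<integral>y. K y * (f x * g (x - y)) \<partial>lborel) \<partial>torus)"
    unfolding convolve_def
    by (intro Bochner_Integration.integral_cong refl)
      (simp add: mult.left_commute integral_mult_right_zero[symmetric] del: integral_mult_right_zero)
  also have "\<dots> = (\<integral>y. K y * (\<integral>x. f x * g (x - y) \<partial>torus) \<partial>lborel)"
    by (subst lborel_torus.Fubini_integral[OF I1]) simp
  also have "(\<lambda>y. \<integral>x. f x * g (x - y) \<partial>torus) = (\<lambda>y. \<integral>x. f (x + y) * g x \<partial>torus)"
  proof
    fix y
    have "periodic (\<lambda>x. f x * g (x - y))"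
      unfolding periodic_def
    proof (intro allI)
      fix x i
      show "f (x + axis i 1) * g (x + axis i 1 - y) = f x * g (x - y)"
        using torus_L1_periodic[OF f, unfolded periodic_def, rule_format, of x i]
          g(2)[unfolded periodic_def, rule_format, of "x - y" i] by (simp add: algebra_simps)
    qed
    from integral_torus_translate[OF _ this, of y]
    show "(\<integral>x. f x * g (x - y) \<partial>torus) = (\<integral>x. f (x + y) * g x \<partial>torus)" by simp
  qed
  also have "(\<integral>y. K y * (\<integral>x. f (x + y) * g x \<partial>torus) \<partial>lborel) = (\<integral>x. (\<integral>y. K y * (f (x + y) * g x) \<partial>lborel) \<partial>torus)"
    by (subst lborel_torus.Fubini_integral[OF I2]) simp
  also have "\<dots> = (\<integral>x. convolve (\<lambda>y. K (- y)) f x * g x \<partial>torus)"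
  proof (intro Bochner_Integration.integral_cong refl)
    fix x
    have "(\<integral>y. K y * (f (x + y) * g x) \<partial>lborel) = (\<integral>y. K y * f (x + y) \<partial>lborel) * g x"
      by (simp flip: mult.assoc)
    also have "(\<integral>y. K y * f (x + y) \<partial>lborel) = convolve (\<lambda>y. K (- y)) f x"
      using lborel_integral_reflect[of "\<lambda>y. K y * f (x + y)"] by (simp add: convolve_def)
    finally show "(\<integral>y. K y * (f (x + y) * g x) \<partial>lborel) = convolve (\<lambda>y. K (- y)) f x * g x" .
  qed
  finally show ?thesis .
qed

subsection \<open>Mollifiers\<close>

text \<open>Every bound is a multiple of the uniform density on the ball of radius \<epsilon>, so
  that integrals against the mollifier and its derivatives compare with the ball averages in the
  Besov-VMO norm. Second derivatives are included for the Hall term, which differentiates a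
  curl.\<close>

definition mollifier :: "('d::finite \<Rightarrow> 3) \<Rightarrow> real \<Rightarrow> real \<Rightarrow> (real ^ 'd \<Rightarrow> real) \<Rightarrow> bool" where
  "mollifier \<iota> C \<epsilon> \<eta> \<longleftrightarrow> kernel \<eta> \<and> (\<forall>y. \<eta> (- y) = \<eta> y) \<and> (\<integral>y. \<eta> y \<partial>lborel) = 1 \<and>
    (\<forall>y. \<bar>\<eta> y\<bar> \<le> C / measure lborel (ball (0 :: real ^ 'd) \<epsilon>) * indicator (ball 0 \<epsilon>) y) \<and>
    (\<forall>k y. \<bar>dir_deriv (direction \<iota> k) \<eta> y\<bar>
       \<le> C / \<epsilon> / measure lborel (ball (0 :: real ^ 'd) \<epsilon>) * indicator (ball 0 \<epsilon>) y) \<and>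
    (\<forall>j k y. \<bar>dir_deriv (direction \<iota> k) (dir_deriv (direction \<iota> j) \<eta>) y\<bar>
       \<le> C / \<epsilon>\<^sup>2 / measure lborel (ball (0 :: real ^ 'd) \<epsilon>) * indicator (ball 0 \<epsilon>) y)"

lemma dir_deriv_scale:
  fixes f :: "'a::euclidean_space \<Rightarrow> real"
  assumes "smooth f"
  shows "dir_deriv b (\<lambda>y. a * f (s *\<^sub>R y)) = (\<lambda>y. (a * s) * dir_deriv b f (s *\<^sub>R y))"
proof
  fix y
  have "((\<lambda>y. f (s *\<^sub>R y)) has_derivative (\<lambda>h. dir_deriv (s *\<^sub>R h) f (s *\<^sub>R y))) (at y)"
    by (rule has_derivative_compose[OF _ smooth_has_derivative[OF assms]]) (auto intro!: derivative_eq_intros)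
  then have "((\<lambda>y. a * f (s *\<^sub>R y)) has_derivative (\<lambda>h. a * dir_deriv (s *\<^sub>R h) f (s *\<^sub>R y))) (at y)"
    by (rule has_derivative_mult_right)
  then have "dir_deriv b (\<lambda>y. a * f (s *\<^sub>R y)) y = a * dir_deriv (s *\<^sub>R b) f (s *\<^sub>R y)"
    by (rule dir_deriv_eq)
  also have "dir_deriv (s *\<^sub>R b) f (s *\<^sub>R y) = s *\<^sub>R dir_deriv b f (s *\<^sub>R y)"
    using linear_cmul[OF has_derivative_linear[OF smooth_has_derivative[OF assms]]] .
  finally show "dir_deriv b (\<lambda>y. a * f (s *\<^sub>R y)) y = (a * s) * dir_deriv b f (s *\<^sub>R y)" by simp
qed

lemma lborel_integral_scale:
  fixes f :: "'a::euclidean_space \<Rightarrow> real"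
  assumes [measurable]: "f \<in> borel_measurable borel" and c: "c > 0"
  shows "integral\<^sup>L lborel f = c ^ DIM('a) * (\<integral>y. f (c *\<^sub>R y) \<partial>lborel)"
proof -
  have "integral\<^sup>L lborel f = integral\<^sup>L (density (distr lborel borel (\<lambda>x. 0 + c *\<^sub>R x)) (\<lambda>_. \<bar>c\<bar> ^ DIM('a))) f"
    using lborel_affine[of c "0::'a"] c by simp
  also have "\<dots> = (\<integral>y. \<bar>c\<bar> ^ DIM('a) *\<^sub>R f y \<partial>distr lborel borel (\<lambda>x. 0 + c *\<^sub>R x))"
    by (rule integral_density) auto
  also have "\<dots> = (\<integral>y. \<bar>c\<bar> ^ DIM('a) *\<^sub>R f (c *\<^sub>R y) \<partial>lborel)"
    by (subst integral_distr) auto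
  finally show ?thesis using c by simp
qed

lemma bump_exists:
  obtains \<rho> :: "'a::euclidean_space \<Rightarrow> real"
  where "smooth \<rho>" "\<And>y. 1/4 < norm y \<Longrightarrow> \<rho> y = 0" "\<And>y. \<rho> (- y) = \<rho> y" "0 < integral\<^sup>L lborel \<rho>"
proof
  \<comment> \<open>The squared norm is used because it is smooth at the origin as well; the
    function is positive exactly in the ball of radius 1/4.\<close>
  let ?\<rho> = "\<lambda>y::'a. exp_flat 0 (1/16 - y \<bullet> y)"
  show sm: "smooth ?\<rho>"
    by (intro smooth_compose[OF smooth_exp_flat] smooth_diff smooth_const smooth_inner smooth_ident)
  show 0: "?\<rho> y = 0" if "1/4 < norm y" for y
  proof -
    have "(1/4)\<^sup>2 < (norm y)\<^sup>2" using that by (intro power_strict_mono) auto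
    then show ?thesis by (simp add: exp_flat_def dot_square_norm power_divide)
  qed
  show "?\<rho> (- y) = ?\<rho> y" for y by simp
  have ker: "kernel ?\<rho>"
    unfolding kernel_def using sm 0 by (auto intro!: exI[of _ "1/4"])
  \<comment> \<open>A nonnegative function with integral 0 vanishes almost everywhere, but this one
    is positive on a ball of positive volume.\<close>
  have "0 \<noteq> integral\<^sup>L lborel ?\<rho>"
  proof
    assume "0 = integral\<^sup>L lborel ?\<rho>"
    then have "AE y in lborel. ?\<rho> y = 0"
      using integral_nonneg_eq_0_iff_AE[OF kernel_integrable[OF ker]] by (simp add: exp_flat_def)
    then have "AE y in lborel. y \<notin> ball (0::'a) (1/4)"
    proof eventually_elim
      case (elim y)
      show ?case
      proof
        assume "y \<in> ball 0 (1/4)"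
        then have "(norm y)\<^sup>2 < (1/4)\<^sup>2" by (intro power_strict_mono) auto
        then show False using elim by (simp add: exp_flat_def dot_square_norm power_divide)
      qed
    qed
    then have "emeasure lborel (ball (0::'a) (1/4)) = 0"
      by (subst (asm) AE_iff_measurable[of "ball 0 (1/4)"]) auto
    then show False
      using content_ball_gt_0_iff[of "0::'a" "1/4"] by (simp add: measure_def)
  qed
  moreover have "0 \<le> integral\<^sup>L lborel ?\<rho>"
    by (intro Bochner_Integration.integral_nonneg) (simp add: exp_flat_def)
  ultimately show "0 < integral\<^sup>L lborel ?\<rho>" by simp
qed

text \<open>The constant must not depend on \<epsilon>. All mollifiers are rescalings of one bump,
  and each derivative costs exactly one factor 1/\<epsilon>.\<close>

lemma mollifier_exists:
  fixes \<iota> :: "'d::finite \<Rightarrow> 3"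
  obtains C where "1 \<le> C" "\<And>\<epsilon>. 0 < \<epsilon> \<Longrightarrow> \<epsilon> < 1/2 \<Longrightarrow> \<exists>\<eta>. mollifier \<iota> C \<epsilon> \<eta>"
proof -
  obtain \<rho> :: "real ^ 'd \<Rightarrow> real" where \<rho>: "smooth \<rho>" "\<And>y. 1/4 < norm y \<Longrightarrow> \<rho> y = 0"
      "\<And>y. \<rho> (- y) = \<rho> y" "0 < integral\<^sup>L lborel \<rho>"
    using bump_exists by blast
  have ker: "kernel \<rho>"
    unfolding kernel_def using \<rho> by (auto intro!: exI[of _ "1/4"])
  define I where "I = integral\<^sup>L lborel \<rho>"
  define V where "V = unit_ball_vol (real CARD('d))"
  have I: "0 < I" and V: "0 < V" using \<rho>(4) by (simp_all add: I_def V_def)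
  have bound: "\<exists>B>0. \<forall>y. \<bar>K y\<bar> \<le> B * indicator (ball 0 (1/2)) y" if "kernel K" for K :: "real ^ 'd \<Rightarrow> real"
    using kernel_bound[OF that] by blast
  let ?D = "\<lambda>k. dir_deriv (direction \<iota> k)"
  obtain B0 where B0: "0 < B0" "\<And>y. \<bar>\<rho> y\<bar> \<le> B0 * indicator (ball 0 (1/2)) y"
    using bound[OF ker] by blast
  have "\<forall>k. \<exists>B>0. \<forall>y. \<bar>?D k \<rho> y\<bar> \<le> B * indicator (ball 0 (1/2)) y"
    using bound[OF kernel_dir_deriv[OF ker]] by blast
  from choice[OF this] obtain B1 where
    B1: "\<And>k. 0 < B1 k" "\<And>k y. \<bar>?D k \<rho> y\<bar> \<le> B1 k * indicator (ball 0 (1/2)) y"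
    by blast
  have "\<forall>p. \<exists>B>0. \<forall>y. \<bar>?D (fst p) (?D (snd p) \<rho>) y\<bar> \<le> B * indicator (ball 0 (1/2)) y"
    using bound[OF kernel_dir_deriv[OF kernel_dir_deriv[OF ker]]] by blast
  from choice[OF this] obtain b2 where
    b2: "\<And>p. 0 < b2 p" "\<And>p y. \<bar>?D (fst p) (?D (snd p) \<rho>) y\<bar> \<le> b2 p * indicator (ball 0 (1/2)) y"
    by blast
  define B2 where "B2 k j = b2 (k, j)" for k j
  have B2: "\<And>k j. 0 < B2 k j" "\<And>k j y. \<bar>?D k (?D j \<rho>) y\<bar> \<le> B2 k j * indicator (ball 0 (1/2)) y"
    using b2(1) b2(2)[of "(_, _)"] by (simp_all add: B2_def)
  define B where "B = B0 + (\<Sum>k\<in>UNIV. B1 k) + (\<Sum>k\<in>UNIV. \<Sum>j\<in>UNIV. B2 k j)"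
  have nn: "0 \<le> (\<Sum>k\<in>UNIV. B1 k)" "0 \<le> (\<Sum>k\<in>UNIV. \<Sum>j\<in>UNIV. B2 k j)"
    by (intro sum_nonneg less_imp_le B1 B2)+
  have le1: "B1 k \<le> (\<Sum>k\<in>UNIV. B1 k)" for k
    by (intro member_le_sum) (auto intro: less_imp_le B1)
  have "B2 k j \<le> (\<Sum>j\<in>UNIV. B2 k j)" for k j
    by (intro member_le_sum) (auto intro: less_imp_le B2)
  also have "(\<Sum>j\<in>UNIV. B2 k j) \<le> (\<Sum>k\<in>UNIV. \<Sum>j\<in>UNIV. B2 k j)" for k
    by (rule member_le_sum[of k UNIV "\<lambda>k. \<Sum>j\<in>UNIV. B2 k j"]) (simp_all add: sum_nonneg less_imp_le[OF B2(1)])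
  finally have le2: "B2 k j \<le> (\<Sum>k\<in>UNIV. \<Sum>j\<in>UNIV. B2 k j)" for k j .
  have Bs: "B0 \<le> B" "B1 k \<le> B" "B2 k j \<le> B" for k j
    using nn le1[of k] le2[of k j] B0(1) unfolding B_def by auto
  have ind: "b * indicator (ball 0 (1/2)) y \<le> B * (indicator (ball 0 (1/2)) y :: real)" if "b \<le> B" for b and y :: "real ^ 'd"
    using that by (intro mult_right_mono) auto
  \<comment> \<open>\<open>B\<close> bounds the bump and its first and second derivatives in the
    coordinate directions; \<open>V / I\<close> converts the normalising factor of the rescaled bump
    into the inverse volume of the ball. The maximum with 1 lets powers of \<open>C\<close> be
    compared later.\<close>
  define C where "C = max 1 (B * V / I)"
  show ?thesis
  proof (rule that[of C])
    show "1 \<le> C" by (simp add: C_def)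
    fix \<epsilon> :: real assume \<epsilon>: "0 < \<epsilon>" "\<epsilon> < 1/2"
    define s where "s = 1 / \<epsilon>"
    define a where "a = s ^ CARD('d) / I"
    have s: "0 < s" "s * \<epsilon> = 1" using \<epsilon> by (auto simp: s_def)
    have a: "0 < a" using I s by (simp add: a_def)
    let ?\<eta> = "\<lambda>y. a * \<rho> (s *\<^sub>R y)"
    have D1: "?D k ?\<eta> = (\<lambda>y. (a * s) * ?D k \<rho> (s *\<^sub>R y))" for k
      by (rule dir_deriv_scale[OF \<rho>(1)])
    have D2: "?D k (?D j ?\<eta>) = (\<lambda>y. (a * s * s) * ?D k (?D j \<rho>) (s *\<^sub>R y))" for k j
      unfolding D1 by (rule dir_deriv_scale[OF smooth_dir_deriv[OF \<rho>(1)]])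
    have vol: "measure lborel (ball (0 :: real ^ 'd) \<epsilon>) = V * \<epsilon> ^ CARD('d)"
      using \<epsilon> by (simp add: content_ball V_def)
    have "a * B \<le> C / measure lborel (ball (0 :: real ^ 'd) \<epsilon>)"
    proof -
      have "a * B = (B * V / I) / (V * \<epsilon> ^ CARD('d))"
        using V I \<epsilon> by (simp add: a_def s_def power_divide field_simps)
      also have "\<dots> \<le> C / (V * \<epsilon> ^ CARD('d))"
        using V \<epsilon> by (intro divide_right_mono) (auto simp: C_def)
      finally show ?thesis by (simp add: vol)
    qed
    then have aB: "a * (B * indicator (ball 0 (1/2)) (s *\<^sub>R y))
        \<le> C / measure lborel (ball (0 :: real ^ 'd) \<epsilon>) * indicator (ball 0 \<epsilon>) y" for y :: "real ^ 'd"
    proof -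
      have "norm y < \<epsilon>" if "norm (s *\<^sub>R y) < 1/2"
      proof -
        have "norm y = \<epsilon> * norm (s *\<^sub>R y)" using \<epsilon> by (simp add: s_def)
        also have "\<dots> < \<epsilon> * 1" using \<epsilon> that by (intro mult_strict_left_mono) auto
        finally show ?thesis by simp
      qed
      moreover have "0 \<le> C / measure lborel (ball (0 :: real ^ 'd) \<epsilon>)" by (simp add: C_def)
      ultimately show ?thesis
        using \<open>a * B \<le> _\<close> by (auto simp: indicator_def)
    qed
    have gen: "\<bar>a * c * f (s *\<^sub>R z)\<bar> \<le> C * c / measure lborel (ball (0 :: real ^ 'd) \<epsilon>) * indicator (ball 0 \<epsilon>) z"
      if f: "\<And>y. \<bar>f y\<bar> \<le> b * indicator (ball 0 (1/2)) y" "b \<le> B" and c: "0 < c" for f b c and z :: "real ^ 'd"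
    proof -
      have "\<bar>a * c * f (s *\<^sub>R z)\<bar> = c * (a * \<bar>f (s *\<^sub>R z)\<bar>)"
        using a c by (simp add: abs_mult)
      also have "\<dots> \<le> c * (a * (B * indicator (ball 0 (1/2)) (s *\<^sub>R z)))"
        using a c order_trans[OF f(1) ind[OF f(2)]] by (intro mult_left_mono) auto
      also have "\<dots> \<le> c * (C / measure lborel (ball (0 :: real ^ 'd) \<epsilon>) * indicator (ball 0 \<epsilon>) z)"
        using c aB by (intro mult_left_mono) auto
      finally show ?thesis by (simp add: mult_ac)
    qed
    have "mollifier \<iota> C \<epsilon> ?\<eta>"
      unfolding mollifier_def
    proof (intro conjI allI)
      have "smooth ?\<eta>"
        by (intro smooth_mult smooth_const smooth_compose[OF \<rho>(1)] smooth_bounded_linear[OF bounded_linear_scaleR_right] smooth_ident)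
      moreover have "\<rho> (s *\<^sub>R y) = 0" if "\<epsilon>/2 < norm y" for y
      proof -
        have "1/2 < s * norm y" using that s(1) \<epsilon> by (simp add: s_def field_simps)
        then show ?thesis using s(1) by (simp add: \<rho>(2))
      qed
      ultimately show "kernel ?\<eta>"
        unfolding kernel_def using \<epsilon> by (auto intro!: exI[of _ "\<epsilon>/2"])
      show "a * \<rho> (s *\<^sub>R - y) = a * \<rho> (s *\<^sub>R y)" for y
        by (simp add: \<rho>(3))
      have "(\<integral>y. \<rho> (s *\<^sub>R y) \<partial>lborel) = I / s ^ CARD('d)"
        using lborel_integral_scale[OF kernel_measurable[OF ker] s(1)] s(1) by (simp add: I_def)
      then show "(\<integral>y. a * \<rho> (s *\<^sub>R y) \<partial>lborel) = 1"
        using I s(1) by (simp add: a_def)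
      show "\<bar>a * \<rho> (s *\<^sub>R y)\<bar> \<le> C / measure lborel (ball (0 :: real ^ 'd) \<epsilon>) * indicator (ball 0 \<epsilon>) y" for y
      proof -
        have "\<bar>a * 1 * \<rho> (s *\<^sub>R y)\<bar> \<le> C * 1 / measure lborel (ball (0 :: real ^ 'd) \<epsilon>) * indicator (ball 0 \<epsilon>) y"
          by (rule gen[OF B0(2) Bs(1)]) simp
        then show ?thesis by simp
      qed
      show "\<bar>?D k ?\<eta> y\<bar> \<le> C / \<epsilon> / measure lborel (ball (0 :: real ^ 'd) \<epsilon>) * indicator (ball 0 \<epsilon>) y" for k y
      proof -
        have "\<bar>a * s * ?D k \<rho> (s *\<^sub>R y)\<bar> \<le> C * s / measure lborel (ball (0 :: real ^ 'd) \<epsilon>) * indicator (ball 0 \<epsilon>) y"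
          by (rule gen[OF B1(2) Bs(2) s(1)])
        then show ?thesis unfolding D1 by (simp add: s_def)
      qed
      show "\<bar>?D k (?D j ?\<eta>) y\<bar> \<le> C / \<epsilon>\<^sup>2 / measure lborel (ball (0 :: real ^ 'd) \<epsilon>) * indicator (ball 0 \<epsilon>) y" for j k y
      proof -
        have "\<bar>a * (s * s) * ?D k (?D j \<rho>) (s *\<^sub>R y)\<bar> \<le> C * (s * s) / measure lborel (ball (0 :: real ^ 'd) \<epsilon>) * indicator (ball 0 \<epsilon>) y"
          by (rule gen[OF B2(2) Bs(3)]) (use s(1) in simp)
        then show ?thesis unfolding D2 by (simp add: s_def power2_eq_square mult.assoc)
      qed
    qed
    then show "\<exists>\<eta>. mollifier \<iota> C \<epsilon> \<eta>" by blast
  qed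
qed

subsection \<open>Integration by parts on the torus\<close>

lemma periodic_dir_deriv:
  assumes F: "smooth F" "periodic F"
  shows "periodic (dir_deriv a F)"
  unfolding periodic_def
proof (intro allI)
  fix x i
  have "((\<lambda>y. F (y + axis i 1)) has_derivative (\<lambda>h. dir_deriv h F (x + axis i 1))) (at x)"
    by (rule has_derivative_compose[OF _ smooth_has_derivative[OF F(1)]]) (auto intro!: derivative_eq_intros)
  moreover have "(\<lambda>y. F (y + axis i 1)) = F" using F(2) by (auto simp: periodic_def)
  ultimately show "dir_deriv a F (x + axis i 1) = dir_deriv a F x"
    using dir_deriv_eq by metis
qed

text \<open>Null sequences of either sign are allowed, because moving a shift from one factor to the
  other reverses its sign. The mean value theorem gives a constant dominating function, integrable
  on the torus.\<close>

lemma diff_quotient_tendsto: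
  fixes F g :: "real ^ 'd \<Rightarrow> real"
  assumes F: "smooth F" "periodic F" and g: "continuous_on UNIV g" "periodic g"
    and s: "s \<longlonglongrightarrow> 0" "\<And>n. s n \<noteq> 0"
  shows "(\<lambda>n. \<integral>x. (F (x + s n *\<^sub>R a) - F x) / s n * g x \<partial>torus) \<longlonglongrightarrow> (\<integral>x. dir_deriv a F x * g x \<partial>torus)"
proof -
  obtain B where B: "0 < B" "\<And>x. \<bar>dir_deriv a F x\<bar> \<le> B"
    using periodic_bounded[OF periodic_dir_deriv[OF F] smooth_imp_continuous[OF smooth_dir_deriv[OF F(1)]]] by auto
  obtain G where G: "0 < G" "\<And>x. \<bar>g x\<bar> \<le> G"
    using periodic_bounded[OF g(2,1)] by auto
  have lin: "linear (\<lambda>h. dir_deriv h F x)" for x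
    using has_derivative_linear[OF smooth_has_derivative[OF F(1)]] .
  have der: "((\<lambda>r. F (x + r *\<^sub>R a)) has_real_derivative dir_deriv a F (x + r *\<^sub>R a)) (at r)" for x r
  proof -
    have "((\<lambda>r. F (x + r *\<^sub>R a)) has_derivative (\<lambda>h. dir_deriv (h *\<^sub>R a) F (x + r *\<^sub>R a))) (at r)"
      by (rule has_derivative_compose[OF _ smooth_has_derivative[OF F(1)]]) (auto intro!: derivative_eq_intros)
    then show ?thesis
      by (simp add: has_field_derivative_def linear_cmul[OF lin] mult_commute_abs)
  qed
  note [measurable] = borel_measurable_continuous_onI[OF smooth_imp_continuous[OF F(1)]]
    borel_measurable_continuous_onI[OF g(1)]
    borel_measurable_continuous_onI[OF smooth_imp_continuous[OF smooth_dir_deriv[OF F(1)]]]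
  show ?thesis
  proof (rule integral_dominated_convergence[where w="\<lambda>_. B * G"])
    show "AE x in torus. (\<lambda>n. (F (x + s n *\<^sub>R a) - F x) / s n * g x) \<longlonglongrightarrow> dir_deriv a F x * g x"
    proof (intro AE_I2 tendsto_mult_right)
      fix x
      have "((\<lambda>h. (F (x + (0 + h) *\<^sub>R a) - F (x + 0 *\<^sub>R a)) / h) \<longlongrightarrow> dir_deriv a F (x + 0 *\<^sub>R a)) (at 0)"
        using der[of x 0] unfolding DERIV_def .
      moreover have "filterlim s (at 0) sequentially"
        unfolding filterlim_at using s by auto
      ultimately show "(\<lambda>n. (F (x + s n *\<^sub>R a) - F x) / s n) \<longlonglongrightarrow> dir_deriv a F x"
        using filterlim_compose by fastforce
    qed
    fix n
    show "AE x in torus. norm ((F (x + s n *\<^sub>R a) - F x) / s n * g x) \<le> B * G"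
    proof (intro AE_I2)
      fix x
      have "norm (F (x + s n *\<^sub>R a) - F (x + 0 *\<^sub>R a)) \<le> B * norm (s n - 0)"
        by (rule field_differentiable_bound[of UNIV "\<lambda>r. F (x + r *\<^sub>R a)"]) (use der B in auto)
      then have "\<bar>(F (x + s n *\<^sub>R a) - F x) / s n\<bar> \<le> B"
        using s(2)[of n] by (simp add: abs_divide divide_le_eq)
      then show "norm ((F (x + s n *\<^sub>R a) - F x) / s n * g x) \<le> B * G"
        unfolding real_norm_def abs_mult by (intro mult_mono G) (use B in auto)
    qed
  qed auto
qed

lemma periodic_translate: "periodic f \<Longrightarrow> periodic (\<lambda>x. f (x + z))"
  unfolding periodic_def by (metis add.assoc add.commute)

lemma periodic_mult: "periodic f \<Longrightarrow> periodic g \<Longrightarrow> periodic (\<lambda>x. f x * g x)"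
  by (simp add: periodic_def)

lemma seq_inverse_Suc: "(\<lambda>n. 1 / real (Suc n)) \<longlonglongrightarrow> 0" "1 / real (Suc n) \<noteq> 0"
  using LIMSEQ_inverse_real_of_nat by (simp_all add: inverse_eq_divide)

text \<open>By translation invariance every difference quotient has integral 0.\<close>

lemma integral_dir_deriv_torus:
  fixes F :: "real ^ 'd \<Rightarrow> real"
  assumes F: "smooth F" "periodic F"
  shows "(\<integral>x. dir_deriv a F x \<partial>torus) = 0"
proof -
  have F1: "torus_L1 F" using F by (simp add: torus_L1_smooth)
  have "(\<integral>x. (F (x + s *\<^sub>R a) - F x) / s * 1 \<partial>torus) = 0" for s
    using F1 integral_torus_translate[of F "s *\<^sub>R a"] integrable_torus_translate[of F "s *\<^sub>R a"]
    by (simp add: torus_L1_def)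
  moreover have "(\<lambda>n. \<integral>x. (F (x + (1 / real (Suc n)) *\<^sub>R a) - F x) / (1 / real (Suc n)) * 1 \<partial>torus)
      \<longlonglongrightarrow> (\<integral>x. dir_deriv a F x * 1 \<partial>torus)"
    by (rule diff_quotient_tendsto[OF F]) (use seq_inverse_Suc in \<open>auto simp: periodic_def\<close>)
  ultimately show ?thesis
    by (simp only: LIMSEQ_const_iff mult_1_right)
qed

lemma integral_by_parts_torus:
  fixes F g :: "real ^ 'd \<Rightarrow> real"
  assumes F: "smooth F" "periodic F" and g: "smooth g" "periodic g"
  shows "(\<integral>x. F x * dir_deriv a g x \<partial>torus) = - (\<integral>x. dir_deriv a F x * g x \<partial>torus)"
proof -
  have "integrable torus (\<lambda>x. F x * dir_deriv a g x)" "integrable torus (\<lambda>x. dir_deriv a F x * g x)"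
    by (intro torus_L1_integrable torus_L1_smooth periodic_mult periodic_dir_deriv smooth_mult smooth_dir_deriv F g)+
  then have "(\<integral>x. F x * dir_deriv a g x \<partial>torus) + (\<integral>x. dir_deriv a F x * g x \<partial>torus)
      = (\<integral>x. dir_deriv a (\<lambda>x. F x * g x) x \<partial>torus)"
    by (simp add: dir_deriv_mult[OF F(1) g(1)])
  also have "\<dots> = 0"
    by (intro integral_dir_deriv_torus smooth_mult periodic_mult F g)
  finally show ?thesis by simp
qed

text \<open>Moving the difference quotient in direction \<open>a\<close> to the other factor commutes with \<open>\<partial>\<^sub>b\<close>, which
  avoids the symmetry of second derivatives.\<close>

lemma integral_dir_deriv_swap:
  fixes F q :: "real ^ 'd \<Rightarrow> real"
  assumes F: "smooth F" "periodic F" and q: "smooth q" "periodic q"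
  shows "(\<integral>x. dir_deriv a F x * dir_deriv b q x \<partial>torus) = (\<integral>x. dir_deriv b F x * dir_deriv a q x \<partial>torus)"
proof -
  let ?D = "dir_deriv b"
  have L1: "integrable torus (\<lambda>x. f (x + z) * g x)" if "smooth f" "periodic f" "smooth g" "periodic g"
    for f g :: "real ^ 'd \<Rightarrow> real" and z
    by (intro torus_L1_integrable torus_L1_smooth periodic_mult periodic_translate smooth_mult that
        smooth_compose[OF that(1)] smooth_add smooth_ident smooth_const)
  have shift: "(\<integral>x. (F (x + s *\<^sub>R a) - F x) / s * ?D q x \<partial>torus)
      = (\<integral>x. (q (x + (- s) *\<^sub>R a) - q x) / (- s) * ?D F x \<partial>torus)" if s: "s \<noteq> 0" for s
  proof -
    define qs where "qs x = q (x + - (s *\<^sub>R a)) - q x" for x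
    have qs: "smooth qs" "periodic qs"
      using q unfolding qs_def
      by (auto intro!: smooth_diff smooth_compose[OF q(1)] smooth_ident smooth_const)
        (use periodic_translate[OF q(2), of "- (s *\<^sub>R a)"] q(2) in \<open>auto simp: periodic_def\<close>)
    have "((\<lambda>y. q (y + - (s *\<^sub>R a))) has_derivative (\<lambda>h. dir_deriv h q (x + - (s *\<^sub>R a)))) (at x)" for x
      by (rule has_derivative_compose[OF _ smooth_has_derivative[OF q(1)]]) (auto intro!: derivative_eq_intros)
    then have "(qs has_derivative (\<lambda>h. dir_deriv h q (x + - (s *\<^sub>R a)) - dir_deriv h q x)) (at x)" for x
      unfolding qs_def by (intro has_derivative_diff smooth_has_derivative[OF q(1)])
    then have Dqs: "?D qs x = ?D q (x + - (s *\<^sub>R a)) - ?D q x" for x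
      by (rule dir_deriv_eq)
    have "(\<integral>x. F (x + s *\<^sub>R a) * ?D q x \<partial>torus) = (\<integral>x. F x * ?D q (x + - (s *\<^sub>R a)) \<partial>torus)"
    proof -
      have "periodic (\<lambda>x. F x * ?D q (x + - (s *\<^sub>R a)))"
        by (intro periodic_mult periodic_translate F periodic_dir_deriv q)
      moreover have "(\<lambda>x. F x * ?D q (x + - (s *\<^sub>R a))) \<in> borel_measurable borel"
        by (intro borel_measurable_continuous_onI smooth_imp_continuous smooth_mult F
            smooth_compose[OF smooth_dir_deriv[OF q(1)]] smooth_add smooth_ident smooth_const)
      ultimately show ?thesis
        using integral_torus_translate[of "\<lambda>x. F x * ?D q (x + - (s *\<^sub>R a))" "s *\<^sub>R a"] by simp
    qed
    moreover have i1: "integrable torus (\<lambda>x. F (x + s *\<^sub>R a) * ?D q x)"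
      by (intro L1 F smooth_dir_deriv periodic_dir_deriv q)
    moreover have i2: "integrable torus (\<lambda>x. F x * ?D q x)"
      using L1[OF F smooth_dir_deriv[OF q(1), of b] periodic_dir_deriv[OF q], of 0] by simp
    moreover have i3: "integrable torus (\<lambda>x. F x * ?D q (x + - (s *\<^sub>R a)))"
      using L1[OF smooth_dir_deriv[OF q(1), of b] periodic_dir_deriv[OF q] F, of "- (s *\<^sub>R a)"]
      by (simp add: mult.commute)
    ultimately have "(\<integral>x. (F (x + s *\<^sub>R a) - F x) * ?D q x \<partial>torus) = (\<integral>x. F x * ?D qs x \<partial>torus)"
      using i1 i2 i3
      by (simp add: Dqs left_diff_distrib right_diff_distrib mult.commute)
    also have "\<dots> = - (\<integral>x. ?D F x * qs x \<partial>torus)"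
      by (rule integral_by_parts_torus[OF F qs])
    finally have "(\<integral>x. (F (x + s *\<^sub>R a) - F x) * ?D q x \<partial>torus) / s = (\<integral>x. qs x * ?D F x \<partial>torus) / (- s)"
      by (simp add: mult.commute)
    then show ?thesis
      by (simp add: qs_def flip: integral_divide_zero)
  qed
  have "(\<lambda>n. \<integral>x. (F (x + (1 / real (Suc n)) *\<^sub>R a) - F x) / (1 / real (Suc n)) * ?D q x \<partial>torus)
      \<longlonglongrightarrow> (\<integral>x. dir_deriv a F x * ?D q x \<partial>torus)"
    by (rule diff_quotient_tendsto)
      (intro F smooth_imp_continuous smooth_dir_deriv periodic_dir_deriv q seq_inverse_Suc)+
  moreover have "(\<lambda>n. \<integral>x. (q (x + (- (1 / real (Suc n))) *\<^sub>R a) - q x) / (- (1 / real (Suc n))) * ?D F x \<partial>torus)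
      \<longlonglongrightarrow> (\<integral>x. dir_deriv a q x * ?D F x \<partial>torus)"
    using tendsto_minus[OF seq_inverse_Suc(1)] seq_inverse_Suc(2)
    by (intro diff_quotient_tendsto F smooth_imp_continuous smooth_dir_deriv periodic_dir_deriv q) auto
  ultimately show ?thesis
    using shift[OF seq_inverse_Suc(2)] LIMSEQ_unique by (simp add: mult.commute)
qed

subsection \<open>The nonlinear terms vanish for smooth fields\<close>

lemma smooth_vec_components:
  fixes f :: "'a::euclidean_space \<Rightarrow> real ^ 'n"
  assumes "\<And>i. smooth (\<lambda>x. f x $ i)"
  shows "smooth f"
proof -
  have "f = (\<lambda>x. \<Sum>i\<in>UNIV. f x $ i *\<^sub>R axis i 1)"
    by (simp add: fun_eq_iff vec_eq_iff axis_def if_distrib[of "\<lambda>x. _ * x"] cong: if_cong)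
  moreover have "smooth (\<lambda>x. \<Sum>i\<in>UNIV. f x $ i *\<^sub>R axis i 1)"
    by (intro smooth_sum smooth_scaleR assms smooth_const)
  ultimately show ?thesis by (rule ssubst[where P=smooth])
qed

lemma curl_components:
  "curl \<iota> f x $ 1 = partial \<iota> 2 f x $ 3 - partial \<iota> 3 f x $ 2"
  "curl \<iota> f x $ 2 = partial \<iota> 3 f x $ 1 - partial \<iota> 1 f x $ 3"
  "curl \<iota> f x $ 3 = partial \<iota> 1 f x $ 2 - partial \<iota> 2 f x $ 1"
  by (simp_all add: curl_def)

lemma smooth_partial: "smooth f \<Longrightarrow> smooth (partial \<iota> k f)"
  by (simp add: partial_smooth smooth_dir_deriv)

lemma periodic_partial:
  fixes f :: "real ^ 'd \<Rightarrow> 'b::real_normed_vector"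
  shows "smooth f \<Longrightarrow> periodic f \<Longrightarrow> periodic (partial \<iota> k f)"
  by (simp add: partial_smooth periodic_dir_deriv)

lemma smooth_curl:
  assumes "smooth f"
  shows "smooth (curl \<iota> f)"
proof (rule smooth_vec_components)
  fix i :: 3
  show "smooth (\<lambda>x. curl \<iota> f x $ i)"
    using exhaust_3[of i]
    by (elim disjE) (simp_all add: curl_components smooth_diff smooth_vec_nth smooth_partial assms)
qed

lemma periodic_curl: "smooth f \<Longrightarrow> periodic f \<Longrightarrow> periodic (curl \<iota> f)"
  using periodic_partial[of f \<iota>] by (simp add: periodic_def curl_def)

lemma periodic_vec_nth: "periodic f \<Longrightarrow> periodic (\<lambda>x. f x $ i)"
  by (simp add: periodic_def)

lemma periodic_inner: "periodic f \<Longrightarrow> periodic g \<Longrightarrow> periodic (\<lambda>x. f x \<bullet> g x)"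
  by (simp add: periodic_def)

lemma partial_vec_nth: "smooth f \<Longrightarrow> partial \<iota> k (\<lambda>x. f x $ i) x = partial \<iota> k f x $ i"
  by (simp add: partial_smooth smooth_vec_nth dir_deriv_vec_nth)

text \<open>The weak form of div curl = 0: the six terms cancel in pairs once the two derivatives
  are exchanged under the integral.\<close>

lemma integral_curl_gradient:
  fixes H :: "real ^ 'd \<Rightarrow> real ^ 3" and q :: "real ^ 'd \<Rightarrow> real"
  assumes H: "smooth H" "periodic H" and q: "smooth q" "periodic q"
  shows "(\<integral>x. (\<Sum>i\<in>UNIV. curl \<iota> H x $ i * partial \<iota> i q x) \<partial>torus) = 0"
proof -
  have int: "integrable torus (\<lambda>x. partial \<iota> j H x $ l * partial \<iota> i q x)" for i j l
    by (intro torus_L1_integrable torus_L1_smooth periodic_mult periodic_vec_nth periodic_partial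
        smooth_mult smooth_vec_nth smooth_partial H q)
  have swap: "(\<integral>x. partial \<iota> j H x $ l * partial \<iota> i q x \<partial>torus) = (\<integral>x. partial \<iota> i H x $ l * partial \<iota> j q x \<partial>torus)" for i j l
    using integral_dir_deriv_swap[OF smooth_vec_nth[OF H(1), of l] periodic_vec_nth[OF H(2)] q,
        of "direction \<iota> j" "direction \<iota> i"]
    by (simp add: partial_smooth H q dir_deriv_vec_nth)
  have "(\<integral>x. (\<Sum>i\<in>UNIV. curl \<iota> H x $ i * partial \<iota> i q x) \<partial>torus) =
      (\<integral>x. (partial \<iota> 2 H x $ 3 * partial \<iota> 1 q x - partial \<iota> 1 H x $ 3 * partial \<iota> 2 q x)
        + (partial \<iota> 3 H x $ 1 * partial \<iota> 2 q x - partial \<iota> 2 H x $ 1 * partial \<iota> 3 q x)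
        + (partial \<iota> 1 H x $ 2 * partial \<iota> 3 q x - partial \<iota> 3 H x $ 2 * partial \<iota> 1 q x) \<partial>torus)"
    by (intro Bochner_Integration.integral_cong refl) (simp add: sum_3 curl_components algebra_simps)
  also have "\<dots> = 0"
    using swap[of 2 3 1] swap[of 3 1 2] swap[of 1 2 3] by (simp add: int)
  finally show ?thesis .
qed

lemma integrable_torus_smooth_periodic:
  fixes f :: "real ^ 'd \<Rightarrow> real"
  shows "smooth f \<Longrightarrow> periodic f \<Longrightarrow> integrable torus f"
  by (intro torus_L1_integrable torus_L1_smooth)

text \<open>The Lorentz force \<open>J \<times> H\<close> is orthogonal to \<open>J = curl H\<close>, so \<open>J \<bullet> (H \<bullet> \<nabla>)H = J \<bullet> \<nabla>(|H|\<^sup>2/2)\<close>.\<close>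

lemma smooth_flux_vanishes:
  fixes U H :: "real ^ 'd \<Rightarrow> real ^ 3"
  assumes U: "smooth U" "periodic U" "weakly_div_free \<iota> U"
    and H: "smooth H" "periodic H" "weakly_div_free \<iota> H"
  shows "(\<integral>x. (\<Sum>i\<in>UNIV. \<Sum>k\<in>UNIV.
      partial \<iota> k U x $ i * (U x $ i * U x $ k - H x $ i * H x $ k)
      + partial \<iota> k H x $ i * (H x $ i * U x $ k - U x $ i * H x $ k)
      + H x $ i * H x $ k * partial \<iota> k (curl \<iota> H) x $ i) \<partial>torus) = 0"
proof -
  define J where "J = curl \<iota> H"
  have J: "smooth J" "periodic J" unfolding J_def by (intro smooth_curl periodic_curl H)+
  \<comment> \<open>The integrand will be half of U . grad \<open>p1\<close>, minus H . grad
    \<open>p2\<close>, minus half of J . grad \<open>p3\<close>. The first two have integral 0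
    because \<open>U\<close> and \<open>H\<close> are weakly divergence free, the third because
    \<open>J\<close> is a curl.\<close>
  define p1 where "p1 x = (U x \<bullet> U x + H x \<bullet> H x)" for x
  define p2 where "p2 x = U x \<bullet> H x - H x \<bullet> J x" for x
  define p3 where "p3 x = H x \<bullet> H x" for x
  have sm: "smooth p1" "smooth p2" "smooth p3" "periodic p1" "periodic p2" "periodic p3"
    unfolding p1_def p2_def p3_def
    by (intro smooth_add smooth_diff smooth_inner U H J)+
      (use U(2) H(2) J(2) in \<open>simp_all add: periodic_def\<close>)
  have D: "partial \<iota> k p1 x = 2 * (U x \<bullet> partial \<iota> k U x + H x \<bullet> partial \<iota> k H x)"
    "partial \<iota> k p2 x = U x \<bullet> partial \<iota> k H x + partial \<iota> k U x \<bullet> H x - (H x \<bullet> partial \<iota> k J x + partial \<iota> k H x \<bullet> J x)"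
    "partial \<iota> k p3 x = 2 * (H x \<bullet> partial \<iota> k H x)" for k x
  proof -
    have in': "((\<lambda>x. f x \<bullet> g x) has_derivative (\<lambda>b. f x \<bullet> dir_deriv b g x + dir_deriv b f x \<bullet> g x)) (at x)"
      if "smooth f" "smooth g" for f g :: "real ^ 'd \<Rightarrow> real ^ 3"
      by (rule has_derivative_inner[OF smooth_has_derivative[OF that(1)] smooth_has_derivative[OF that(2)]])
    show "partial \<iota> k p1 x = 2 * (U x \<bullet> partial \<iota> k U x + H x \<bullet> partial \<iota> k H x)"
      using dir_deriv_eq[OF has_derivative_add[OF in'[OF U(1) U(1)] in'[OF H(1) H(1)]], of "direction \<iota> k"]
      by (simp add: partial_smooth sm U H flip: p1_def) (simp add: inner_commute)
    show "partial \<iota> k p3 x = 2 * (H x \<bullet> partial \<iota> k H x)"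
      using dir_deriv_eq[OF in'[OF H(1) H(1)], of "direction \<iota> k"]
      by (simp add: partial_smooth sm H flip: p3_def) (simp add: inner_commute)
    show "partial \<iota> k p2 x = U x \<bullet> partial \<iota> k H x + partial \<iota> k U x \<bullet> H x - (H x \<bullet> partial \<iota> k J x + partial \<iota> k H x \<bullet> J x)"
      using dir_deriv_eq[OF has_derivative_diff[OF in'[OF U(1) H(1)] in'[OF H(1) J(1)]], of "direction \<iota> k"]
      by (simp add: partial_smooth sm U H J flip: p2_def)
  qed
  have int: "integrable torus (\<lambda>x. \<Sum>k\<in>UNIV. V x $ k * partial \<iota> k p x)"
    if "smooth V" "periodic V" "smooth p" "periodic p" for V :: "real ^ 'd \<Rightarrow> real ^ 3" and p :: "real ^ 'd \<Rightarrow> real"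
    by (intro Bochner_Integration.integrable_sum integrable_torus_smooth_periodic smooth_mult periodic_mult
        smooth_vec_nth periodic_vec_nth smooth_partial periodic_partial that)
  have div: "(\<integral>x. (\<Sum>k\<in>UNIV. V x $ k * partial \<iota> k p x) \<partial>torus) = 0"
    if "smooth V" "periodic V" "smooth p" "periodic p" "weakly_div_free \<iota> V"
    for V :: "real ^ 'd \<Rightarrow> real ^ 3" and p :: "real ^ 'd \<Rightarrow> real"
  proof -
    have "torus_integral (\<lambda>x. \<Sum>k\<in>UNIV. V x $ k * partial \<iota> k p x) = 0"
      using that unfolding weakly_div_free_def by blast
    moreover have "(\<lambda>x. \<Sum>k\<in>UNIV. V x $ k * partial \<iota> k p x) \<in> borel_measurable borel"
      by (intro borel_measurable_continuous_onI smooth_imp_continuous smooth_sum smooth_mult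
          smooth_vec_nth smooth_partial that)
    ultimately show ?thesis by (simp add: torus_integral_eq)
  qed
  have Jc: "J x $ 1 = partial \<iota> 2 H x $ 3 - partial \<iota> 3 H x $ 2"
    "J x $ 2 = partial \<iota> 3 H x $ 1 - partial \<iota> 1 H x $ 3"
    "J x $ 3 = partial \<iota> 1 H x $ 2 - partial \<iota> 2 H x $ 1" for x
    by (simp_all add: J_def curl_components)
  have pointwise: "(\<Sum>i\<in>UNIV. \<Sum>k\<in>UNIV.
      partial \<iota> k U x $ i * (U x $ i * U x $ k - H x $ i * H x $ k)
      + partial \<iota> k H x $ i * (H x $ i * U x $ k - U x $ i * H x $ k)
      + H x $ i * H x $ k * partial \<iota> k J x $ i) =
      1/2 * (\<Sum>k\<in>UNIV. U x $ k * partial \<iota> k p1 x) - (\<Sum>k\<in>UNIV. H x $ k * partial \<iota> k p2 x)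
      - 1/2 * (\<Sum>k\<in>UNIV. J x $ k * partial \<iota> k p3 x)" for x
    \<comment> \<open>With \<open>J\<close> written out this is a polynomial identity in the
      components of the fields and their derivatives; the orthogonality of the Lorentz force is
      contained in it.\<close>
    unfolding D inner_vec_def sum_3 inner_real_def Jc by algebra
  show ?thesis
    unfolding J_def[symmetric] pointwise
    using div[OF U(1,2) sm(1,4) U(3)] div[OF H(1,2) sm(2,5) H(3)]
      integral_curl_gradient[OF H(1,2) sm(3,6), of \<iota>, folded J_def]
    by (simp add: int U H J sm)
qed

lemma partial_curl_components:
  assumes f: "smooth f"
  shows "partial \<iota> k (curl \<iota> f) x $ 1 = partial \<iota> k (partial \<iota> 2 f) x $ 3 - partial \<iota> k (partial \<iota> 3 f) x $ 2"
    and "partial \<iota> k (curl \<iota> f) x $ 2 = partial \<iota> k (partial \<iota> 3 f) x $ 1 - partial \<iota> k (partial \<iota> 1 f) x $ 3"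
    and "partial \<iota> k (curl \<iota> f) x $ 3 = partial \<iota> k (partial \<iota> 1 f) x $ 2 - partial \<iota> k (partial \<iota> 2 f) x $ 1"
proof -
  have D: "partial \<iota> k (\<lambda>x. partial \<iota> j f x $ l - partial \<iota> j' f x $ l') x
      = partial \<iota> k (partial \<iota> j f) x $ l - partial \<iota> k (partial \<iota> j' f) x $ l'" for j l j' l'
  proof -
    have "((\<lambda>x. partial \<iota> j f x $ l - partial \<iota> j' f x $ l') has_derivative
        (\<lambda>h. dir_deriv h (partial \<iota> j f) x $ l - dir_deriv h (partial \<iota> j' f) x $ l')) (at x)"
      by (intro has_derivative_diff bounded_linear.has_derivative[OF bounded_linear_vec_nth]
          smooth_has_derivative smooth_partial f)
    from dir_deriv_eq[OF this, of "direction \<iota> k"] show ?thesis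
      by (subst partial_smooth) (auto intro!: smooth_diff smooth_vec_nth smooth_partial f
          simp: partial_smooth[OF smooth_partial[OF f]])
  qed
  have "partial \<iota> k (curl \<iota> f) x $ i = partial \<iota> k (\<lambda>x. curl \<iota> f x $ i) x" for i
    by (rule partial_vec_nth[symmetric, OF smooth_curl[OF f]])
  then show "partial \<iota> k (curl \<iota> f) x $ 1 = partial \<iota> k (partial \<iota> 2 f) x $ 3 - partial \<iota> k (partial \<iota> 3 f) x $ 2"
    "partial \<iota> k (curl \<iota> f) x $ 2 = partial \<iota> k (partial \<iota> 3 f) x $ 1 - partial \<iota> k (partial \<iota> 1 f) x $ 3"
    "partial \<iota> k (curl \<iota> f) x $ 3 = partial \<iota> k (partial \<iota> 1 f) x $ 2 - partial \<iota> k (partial \<iota> 2 f) x $ 1"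
    by (simp_all add: curl_components D)
qed

lemma partial_curl_le:
  assumes f: "smooth f" and le: "\<And>j l. \<bar>partial \<iota> k (partial \<iota> j f) x $ l\<bar> \<le> B"
  shows "\<bar>partial \<iota> k (curl \<iota> f) x $ i\<bar> \<le> 2 * B"
proof -
  have "\<bar>partial \<iota> k (partial \<iota> j f) x $ l - partial \<iota> k (partial \<iota> j' f) x $ l'\<bar> \<le> 2 * B" for j l j' l'
    using le[of j l] le[of j' l'] by simp
  then show ?thesis
    using exhaust_3[of i] by (elim disjE) (simp_all add: partial_curl_components[OF f])
qed

subsection \<open>Divergence-free mollified fields\<close>

lemma torus_L1_vec_nth:
  fixes v :: "real ^ 'd \<Rightarrow> real ^ 'n"
  assumes "torus_L1 v"
  shows "torus_L1 (\<lambda>x. v x $ i)"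
  using assms integrable_bounded_linear[OF bounded_linear_vec_nth, of torus v i]
    borel_measurable_continuous_on[OF linear_continuous_on[OF bounded_linear_vec_nth], of v borel i]
  by (auto simp: torus_L1_def periodic_def)

lemma partial_convolve:
  fixes v :: "real ^ 'd \<Rightarrow> 'b::{banach, second_countable_topology}"
  assumes "kernel K" "torus_L1 v"
  shows "partial \<iota> k (convolve K v) = convolve (dir_deriv (direction \<iota> k) K) v"
  using assms by (simp add: partial_smooth smooth_convolve_L1 dir_deriv_convolve torus_L1_locally_integrable)

lemma convolve_even_adjoint:
  fixes f g :: "real ^ 'd \<Rightarrow> real"
  assumes "kernel K" "\<And>y. K (- y) = K y" "torus_L1 f" "smooth g" "periodic g"
  shows "(\<integral>x. f x * convolve K g x \<partial>torus) = (\<integral>x. convolve K f x * g x \<partial>torus)"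
proof -
  have c: "continuous_on UNIV g" by (rule smooth_imp_continuous[OF assms(4)])
  obtain G where G: "\<And>x. norm (g x) \<le> G"
    using periodic_bounded[OF assms(5) c] by blast
  show ?thesis
    using convolve_adjoint[OF assms(1,3) borel_measurable_continuous_onI[OF c] assms(5), of G] G
    by (simp add: assms(2))
qed

lemma integrable_mult_smooth_periodic:
  fixes f g :: "real ^ 'd \<Rightarrow> real"
  assumes f: "torus_L1 f" and g: "smooth g" "periodic g"
  shows "integrable torus (\<lambda>x. f x * g x)"
proof -
  have c: "continuous_on UNIV g" by (rule smooth_imp_continuous[OF g(1)])
  obtain G where G: "\<And>x. norm (g x) \<le> G"
    using periodic_bounded[OF g(2) c] by blast
  note [measurable] = borel_measurable_continuous_onI[OF c] torus_L1_measurable[OF f]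
  show ?thesis
  proof (rule Bochner_Integration.integrable_bound[OF integrable_mult_right[OF integrable_norm[OF torus_L1_integrable[OF f]], of G]])
    have "norm (f x * g x) \<le> G * norm (f x)" for x
      using mult_left_mono[OF G[of x] norm_ge_zero[of "f x"]] by (simp add: abs_mult mult.commute)
    then show "AE x in torus. norm (f x * g x) \<le> norm (G * norm (f x))"
      by (intro AE_I2) (metis abs_ge_self order_trans real_norm_def)
  qed simp
qed

lemma weakly_div_free_eq:
  fixes v :: "real ^ 'd \<Rightarrow> real ^ 3"
  assumes "torus_L1 v" "smooth \<psi>"
  shows "torus_integral (\<lambda>x. \<Sum>k\<in>UNIV. v x $ k * partial \<iota> k \<psi> x)
    = (\<integral>x. (\<Sum>k\<in>UNIV. v x $ k * partial \<iota> k \<psi> x) \<partial>torus)"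
  using torus_L1_measurable[OF torus_L1_vec_nth[OF assms(1)]]
    borel_measurable_continuous_onI[OF smooth_imp_continuous[OF smooth_partial[OF assms(2)]]]
  by (intro torus_integral_eq borel_measurable_sum borel_measurable_times) auto

text \<open>An even kernel makes convolution self-adjoint, so it can be moved to the test function,
  where it commutes with derivatives.\<close>

lemma weakly_div_free_convolve:
  fixes v :: "real ^ 'd \<Rightarrow> real ^ 3"
  assumes K: "kernel K" "\<And>y. K (- y) = K y" and v: "torus_L1 v" "weakly_div_free \<iota> v"
  shows "weakly_div_free \<iota> (convolve K v)"
  unfolding weakly_div_free_def
proof (intro allI impI)
  fix \<psi> :: "real ^ 'd \<Rightarrow> real" assume "smooth \<psi> \<and> periodic \<psi>"
  then have \<psi>: "smooth \<psi>" "periodic \<psi>" by auto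
  have \<psi>1: "torus_L1 \<psi>" using \<psi> by (simp add: torus_L1_smooth)
  have K\<psi>: "smooth (convolve K \<psi>)" "periodic (convolve K \<psi>)"
    using K \<psi> \<psi>1 by (auto intro: smooth_convolve_L1 periodic_convolve)
  have "torus_integral (\<lambda>x. \<Sum>k\<in>UNIV. convolve K v x $ k * partial \<iota> k \<psi> x)
      = (\<integral>x. (\<Sum>k\<in>UNIV. convolve K v x $ k * partial \<iota> k \<psi> x) \<partial>torus)"
    by (rule weakly_div_free_eq[OF torus_L1_convolve[OF K(1) v(1)] \<psi>(1)])
  also have "\<dots> = (\<Sum>k\<in>UNIV. \<integral>x. convolve K (\<lambda>x. v x $ k) x * partial \<iota> k \<psi> x \<partial>torus)"
    by (simp add: convolve_vec_nth[OF K(1) torus_L1_locally_integrable[OF v(1)]]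
        integrable_mult_smooth_periodic torus_L1_vec_nth torus_L1_convolve K v smooth_partial periodic_partial \<psi>)
  also have "\<dots> = (\<Sum>k\<in>UNIV. \<integral>x. v x $ k * convolve K (partial \<iota> k \<psi>) x \<partial>torus)"
    by (intro sum.cong refl convolve_even_adjoint[symmetric] K torus_L1_vec_nth v smooth_partial periodic_partial \<psi>)
  also have "\<dots> = (\<Sum>k\<in>UNIV. \<integral>x. v x $ k * partial \<iota> k (convolve K \<psi>) x \<partial>torus)"
    by (simp add: partial_smooth \<psi> K\<psi> dir_deriv_convolve_right[OF K(1)])
  also have "\<dots> = (\<integral>x. (\<Sum>k\<in>UNIV. v x $ k * partial \<iota> k (convolve K \<psi>) x) \<partial>torus)"
    by (simp add: integrable_mult_smooth_periodic torus_L1_vec_nth v smooth_partial periodic_partial K\<psi>)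
  also have "\<dots> = 0"
    using v(2) K\<psi> unfolding weakly_div_free_def by (simp flip: weakly_div_free_eq[OF v(1) K\<psi>(1)])
  finally show "torus_integral (\<lambda>x. \<Sum>k\<in>UNIV. convolve K v x $ k * partial \<iota> k \<psi> x) = 0" .
qed

text \<open>A continuous nonnegative function with integral 0 over the closed cell vanishes at each
  of its points, and periodicity carries this to the whole space.\<close>

lemma continuous_integral_square_eq_0:
  fixes g :: "real ^ 'd \<Rightarrow> real"
  assumes g: "continuous_on UNIV g" "periodic g" and 0: "(\<integral>x. g x * g x \<partial>torus) = 0"
  shows "g x = 0"
proof -
  let ?C = "cbox 0 (\<chi> i. 1) :: (real ^ 'd) set"
  have c: "continuous_on S (\<lambda>x. g x * g x)" for S
    by (intro continuous_on_mult continuous_on_subset[OF g(1)]) auto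
  note [measurable] = borel_measurable_continuous_onI[OF c]
  have "set_integrable lborel ?C (\<lambda>x. g x * g x)"
    unfolding set_integrable_def by (rule borel_integrable_compact) (auto intro: c)
  then have "integral ?C (\<lambda>x. g x * g x) = (LBINT x:?C. g x * g x)"
    by (simp add: set_borel_integral_eq_integral)
  also have "\<dots> = 0" using 0 by (simp add: integral_torus)
  finally have "\<forall>x\<in>?C. g x * g x = 0"
    by (subst (asm) integral_cbox_eq_0_iff) (auto intro: c simp: box_ne_empty Basis_vec_def inner_axis)
  moreover have "frac_vec x \<in> ?C"
    using frac_vec_cell[of x] by (auto simp: torus_cell_def mem_box_cart less_imp_le)
  ultimately have "g (frac_vec x) = 0" by auto
  then show ?thesis by (simp add: periodic_frac_vec[OF g(2)])
qed

text \<open>Test fields must have divergence 0 at every point, not only weakly. Testing the weak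
  condition with the divergence itself and integrating by parts gives that its square has integral
  0.\<close>

lemma divergence_convolve:
  fixes v :: "real ^ 'd \<Rightarrow> real ^ 3"
  assumes K: "kernel K" "\<And>y. K (- y) = K y" and v: "torus_L1 v" "weakly_div_free \<iota> v"
  shows "divergence \<iota> (convolve K v) x = 0"
proof -
  let ?V = "convolve K v"
  have V: "smooth ?V" "periodic ?V"
    using K v by (auto intro: smooth_convolve_L1 periodic_convolve torus_L1_periodic)
  define g where "g x = (\<Sum>k\<in>UNIV. partial \<iota> k ?V x $ k)" for x
  have g: "smooth g" "periodic g"
    unfolding g_def using periodic_partial[OF V, of \<iota>]
    by (auto intro!: smooth_sum smooth_vec_nth smooth_partial V simp: periodic_def)
  have "(\<integral>x. g x * g x \<partial>torus) = (\<integral>x. (\<Sum>k\<in>UNIV. partial \<iota> k ?V x $ k * g x) \<partial>torus)"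
    by (simp add: g_def sum_distrib_right)
  also have "\<dots> = (\<Sum>k\<in>UNIV. \<integral>x. partial \<iota> k ?V x $ k * g x \<partial>torus)"
    by (intro Bochner_Integration.integral_sum integrable_torus_smooth_periodic smooth_mult periodic_mult
        smooth_vec_nth smooth_partial periodic_vec_nth periodic_partial V g)
  also have "\<dots> = (\<Sum>k\<in>UNIV. - (\<integral>x. ?V x $ k * partial \<iota> k g x \<partial>torus))"
    using integral_by_parts_torus[OF smooth_vec_nth[OF V(1)] periodic_vec_nth[OF V(2)] g]
    by (simp add: partial_smooth V g dir_deriv_vec_nth)
  also have "\<dots> = - (\<integral>x. (\<Sum>k\<in>UNIV. ?V x $ k * partial \<iota> k g x) \<partial>torus)"
    by (subst Bochner_Integration.integral_sum)
      (auto intro!: integrable_torus_smooth_periodic smooth_mult periodic_mult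
        smooth_vec_nth smooth_partial periodic_vec_nth periodic_partial V g simp: sum_negf)
  also have "\<dots> = 0"
    using weakly_div_free_convolve[OF K v] g unfolding weakly_div_free_def
    by (simp flip: weakly_div_free_eq[OF torus_L1_convolve[OF K(1) v(1)] g(1)])
  finally have "g x = 0"
    by (rule continuous_integral_square_eq_0[OF smooth_imp_continuous[OF g(1)] g(2)])
  then show ?thesis by (simp add: g_def divergence_def)
qed

subsection \<open>Averages over small balls\<close>

text \<open>The uniform distribution on the ball as a measure, so that Jensen-type inequalities
  apply without volume factors.\<close>

definition ball_measure :: "real \<Rightarrow> (real ^ 'd) measure" where
  "ball_measure \<epsilon> = density lborel (\<lambda>y. indicator (ball 0 \<epsilon>) y / measure lborel (ball (0 :: real ^ 'd) \<epsilon>))"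

lemma ball_density_measurable [measurable]:
  "(\<lambda>y. indicator (ball 0 \<epsilon>) y / measure lborel (ball (0 :: real ^ 'd) \<epsilon>)) \<in> borel_measurable borel"
  by (intro borel_measurable_divide borel_measurable_indicator) auto

lemma sets_ball_measure [measurable_cong, simp]: "sets (ball_measure \<epsilon>) = sets borel"
  and space_ball_measure [simp]: "space (ball_measure \<epsilon>) = UNIV"
  by (simp_all add: ball_measure_def)

lemma integral_ball_measure:
  fixes g :: "real ^ 'd \<Rightarrow> 'b::{banach, second_countable_topology}"
  assumes "g \<in> borel_measurable borel"
  shows "(\<integral>y. g y \<partial>ball_measure \<epsilon>)
    = (\<integral>y. (indicator (ball 0 \<epsilon>) y / measure lborel (ball (0 :: real ^ 'd) \<epsilon>)) *\<^sub>R g y \<partial>lborel)"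
  unfolding ball_measure_def by (rule integral_density) (use assms ball_density_measurable in auto)

lemma integrable_ball_measure:
  fixes g :: "real ^ 'd \<Rightarrow> 'b::{banach, second_countable_topology}"
  assumes [measurable]: "g \<in> borel_measurable borel" and int: "integrable lborel (\<lambda>y. indicator (ball 0 \<epsilon>) y *\<^sub>R g y)"
  shows "integrable (ball_measure \<epsilon>) g"
proof -
  have "integrable lborel (\<lambda>y. (1 / measure lborel (ball (0 :: real ^ 'd) \<epsilon>)) *\<^sub>R (indicator (ball 0 \<epsilon>) y *\<^sub>R g y))"
    by (rule integrable_scaleR_right[OF int])
  then have "integrable lborel (\<lambda>y. (indicator (ball 0 \<epsilon>) y / measure lborel (ball (0 :: real ^ 'd) \<epsilon>)) *\<^sub>R g y)"
    by (simp add: mult.commute)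
  then show ?thesis
    unfolding ball_measure_def by (subst integrable_density) (use ball_density_measurable in auto)
qed

lemma
  assumes \<epsilon>: "0 < \<epsilon>"
  shows finite_ball_measure: "finite_measure (ball_measure \<epsilon> :: (real ^ 'd) measure)"
    and measure_ball_measure: "measure (ball_measure \<epsilon> :: (real ^ 'd) measure) UNIV = 1"
proof -
  let ?V = "measure lborel (ball (0 :: real ^ 'd) \<epsilon>)"
  have V: "0 < ?V" using \<epsilon> by simp
  have fin: "emeasure lborel (ball (0 :: real ^ 'd) \<epsilon>) = ennreal ?V"
    using emeasure_lborel_ball_finite[of "0 :: real ^ 'd" \<epsilon>] by (simp add: emeasure_eq_ennreal_measure less_top)
  have "emeasure (ball_measure \<epsilon> :: (real ^ 'd) measure) UNIV
      = (\<integral>\<^sup>+y. ennreal (1 / ?V) * indicator (ball (0 :: real ^ 'd) \<epsilon>) y \<partial>lborel)"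
  proof -
    have "emeasure (ball_measure \<epsilon> :: (real ^ 'd) measure) UNIV
        = (\<integral>\<^sup>+y. ennreal (indicator (ball (0 :: real ^ 'd) \<epsilon>) y / ?V) * indicator UNIV y \<partial>lborel)"
      unfolding ball_measure_def by (rule emeasure_density) (use ball_density_measurable in auto)
    also have "\<dots> = (\<integral>\<^sup>+y. ennreal (1 / ?V) * indicator (ball (0 :: real ^ 'd) \<epsilon>) y \<partial>lborel)"
      by (intro nn_integral_cong) (simp split: split_indicator)
    finally show ?thesis .
  qed
  also have "\<dots> = ennreal (1 / ?V) * ennreal ?V"
    by (simp add: nn_integral_cmult_indicator fin)
  also have "\<dots> = 1" using V by (simp flip: ennreal_mult)
  finally have 1: "emeasure (ball_measure \<epsilon> :: (real ^ 'd) measure) UNIV = 1" .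
  show "finite_measure (ball_measure \<epsilon> :: (real ^ 'd) measure)"
    by standard (simp add: 1)
  show "measure (ball_measure \<epsilon> :: (real ^ 'd) measure) UNIV = 1"
    by (simp add: measure_def 1)
qed

text \<open>After this step a kernel is represented by the single constant \<open>c\<close>, which
  will be C, C/\<epsilon> or C/\<epsilon>^2 according to the number of derivatives on the
  mollifier.\<close>

lemma kernel_ball_measure_bound:
  fixes g :: "real ^ 'd \<Rightarrow> 'b::{banach, second_countable_topology}"
  assumes K: "\<And>y. \<bar>K y\<bar> \<le> c / measure lborel (ball (0 :: real ^ 'd) \<epsilon>) * indicator (ball 0 \<epsilon>) y"
    and g: "g \<in> borel_measurable borel" "integrable (ball_measure \<epsilon>) g"
  shows "norm (\<integral>y. K y *\<^sub>R g y \<partial>lborel) \<le> c * (\<integral>y. norm (g y) \<partial>ball_measure \<epsilon>)"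
proof -
  let ?V = "measure lborel (ball (0 :: real ^ 'd) \<epsilon>)"
  note [measurable] = g(1)
  have int: "integrable lborel (\<lambda>y. (indicator (ball 0 \<epsilon>) y / ?V) *\<^sub>R norm (g y))"
    using integrable_norm[OF g(2)] unfolding ball_measure_def
    by (subst (asm) integrable_density) (use ball_density_measurable in auto)
  have "norm (\<integral>y. K y *\<^sub>R g y \<partial>lborel) \<le> (\<integral>y. norm (K y *\<^sub>R g y) \<partial>lborel)"
    by (rule integral_norm_bound)
  also have "\<dots> \<le> (\<integral>y. c * ((indicator (ball 0 \<epsilon>) y / ?V) *\<^sub>R norm (g y)) \<partial>lborel)"
  proof (rule integral_mono')
    fix y
    show "norm (K y *\<^sub>R g y) \<le> c * ((indicator (ball 0 \<epsilon>) y / ?V) *\<^sub>R norm (g y))"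
      using mult_right_mono[OF K[of y] norm_ge_zero[of "g y"]] by (simp add: mult_ac)
    then show "0 \<le> c * ((indicator (ball 0 \<epsilon>) y / ?V) *\<^sub>R norm (g y))"
      using order_trans[OF norm_ge_zero] by blast
  qed (rule integrable_mult_right[OF int])
  also have "\<dots> = c * (\<integral>y. norm (g y) \<partial>ball_measure \<epsilon>)"
    by (simp add: integral_ball_measure)
  finally show ?thesis .
qed

section \<open>Cubes: elementary inequalities and averages\<close>

text \<open>Stands in for Hoelder's inequality with three exponents 3. The largest of the numbers
  bounds every factor, and its cube is one of the summands.\<close>

lemma triple_le_cubes:
  fixes s t r :: real
  assumes "0 \<le> s" "0 \<le> t" "0 \<le> r"
  shows "s * t * r \<le> s ^ 3 + t ^ 3 + r ^ 3"
proof -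
  define m where "m = max s (max t r)"
  have m: "s \<le> m" "t \<le> m" "r \<le> m" "m = s \<or> m = t \<or> m = r" by (auto simp: m_def)
  have "s * t * r \<le> m * m * m" using assms m by (intro mult_mono) auto
  also have "\<dots> = m ^ 3" by (simp add: power3_eq_cube)
  also have "\<dots> \<le> s ^ 3 + t ^ 3 + r ^ 3" using m(4) assms by auto
  finally show ?thesis .
qed

lemma cube_add_le:
  fixes s t :: real
  assumes "0 \<le> s" "0 \<le> t"
  shows "(s + t) ^ 3 \<le> 4 * (s ^ 3 + t ^ 3)"
proof -
  \<comment> \<open>This product is the right-hand side of the claim minus the left-hand
    side.\<close>
  have "0 \<le> 3 * (s + t) * (s - t)\<^sup>2" using assms by simp
  then show ?thesis by (simp add: power3_eq_cube power2_eq_square algebra_simps)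
qed

lemma le_add_cube:
  fixes s :: real
  assumes "0 \<le> s"
  shows "s \<le> 1 + s ^ 3"
proof (cases "s \<le> 1")
  case True
  then show ?thesis using zero_le_power[OF assms, of 3] by linarith
next
  case False
  then show ?thesis using self_le_power[of s 3] by simp
qed

locale averaging = finite_measure M for M :: "'a measure" +
  assumes total: "measure M (space M) = 1"
begin

definition cubic :: "('a \<Rightarrow> real) \<Rightarrow> bool" where
  "cubic \<alpha> \<longleftrightarrow> \<alpha> \<in> borel_measurable M \<and> (\<forall>y. 0 \<le> \<alpha> y) \<and> integrable M (\<lambda>y. \<alpha> y ^ 3)"

lemma cubic_integrable:
  assumes "cubic \<alpha>"
  shows "integrable M \<alpha>"
proof (rule Bochner_Integration.integrable_bound)
  show "integrable M (\<lambda>y. 1 + \<alpha> y ^ 3)" using assms by (simp add: cubic_def)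
  show "AE y in M. norm (\<alpha> y) \<le> norm (1 + \<alpha> y ^ 3)"
    using assms le_add_cube by (auto simp: cubic_def)
qed (use assms in \<open>simp add: cubic_def\<close>)

lemma cubic_mult_integrable:
  assumes "cubic \<alpha>" "cubic \<beta>"
  shows "integrable M (\<lambda>y. \<alpha> y * \<beta> y)"
proof (rule Bochner_Integration.integrable_bound)
  show "integrable M (\<lambda>y. \<alpha> y ^ 3 + \<beta> y ^ 3 + 1)" using assms by (simp add: cubic_def)
  show "AE y in M. norm (\<alpha> y * \<beta> y) \<le> norm (\<alpha> y ^ 3 + \<beta> y ^ 3 + 1)"
    using assms triple_le_cubes[of "\<alpha> _" "\<beta> _" 1] by (auto simp: cubic_def abs_mult)
qed (use assms in \<open>auto simp: cubic_def intro: borel_measurable_times\<close>)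

text \<open>The cube lies above its tangent at the mean \<open>p\<close>, and the linear part of the
  tangent averages to 0.\<close>

lemma jensen_cube:
  assumes "cubic \<alpha>"
  shows "(\<integral>y. \<alpha> y \<partial>M) ^ 3 \<le> (\<integral>y. \<alpha> y ^ 3 \<partial>M)"
proof -
  define p where "p = (\<integral>y. \<alpha> y \<partial>M)"
  have p: "0 \<le> p" using assms by (auto simp: p_def cubic_def intro: Bochner_Integration.integral_nonneg)
  have tangent: "p ^ 3 + 3 * p\<^sup>2 * (s - p) \<le> s ^ 3" if "0 \<le> s" for s
  proof -
    \<comment> \<open>The factorised difference between the cube and its tangent.\<close>
    have "0 \<le> (s + 2 * p) * (s - p)\<^sup>2" using p that by simp
    then show ?thesis by (simp add: power3_eq_cube power2_eq_square algebra_simps)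
  qed
  have "(\<integral>y. p ^ 3 + 3 * p\<^sup>2 * (\<alpha> y - p) \<partial>M) \<le> (\<integral>y. \<alpha> y ^ 3 \<partial>M)"
    using assms cubic_integrable[OF assms] tangent by (intro integral_mono) (auto simp: cubic_def)
  also have "(\<integral>y. p ^ 3 + 3 * p\<^sup>2 * (\<alpha> y - p) \<partial>M) = p ^ 3"
    using cubic_integrable[OF assms] total by (simp add: p_def[symmetric])
  finally show ?thesis by (simp add: p_def)
qed

text \<open>Serves the part of the commutator that is an average of a product: the third factor is a
  constant under the integral, is absorbed pointwise, and only then estimated by Jensen.
  \<open>averages_le\<close> serves the part that is a product of averages.\<close>

lemma average_mult_average_le:
  assumes \<alpha>: "cubic \<alpha>" and \<beta>: "cubic \<beta>" and \<gamma>: "cubic \<gamma>"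
  shows "(\<integral>y. \<alpha> y * \<beta> y \<partial>M) * (\<integral>y. \<gamma> y \<partial>M) \<le> (\<integral>y. \<alpha> y ^ 3 \<partial>M) + (\<integral>y. \<beta> y ^ 3 \<partial>M) + (\<integral>y. \<gamma> y ^ 3 \<partial>M)"
proof -
  define r where "r = (\<integral>y. \<gamma> y \<partial>M)"
  have r: "0 \<le> r" using \<gamma> by (auto simp: r_def cubic_def intro: Bochner_Integration.integral_nonneg)
  have "(\<integral>y. \<alpha> y * \<beta> y \<partial>M) * r = (\<integral>y. \<alpha> y * \<beta> y * r \<partial>M)" by simp
  also have "\<dots> \<le> (\<integral>y. \<alpha> y ^ 3 + \<beta> y ^ 3 + r ^ 3 \<partial>M)"
    using \<alpha> \<beta> r by (intro integral_mono integrable_mult_left cubic_mult_integrable triple_le_cubes) (auto simp: cubic_def)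
  also have "\<dots> = (\<integral>y. \<alpha> y ^ 3 \<partial>M) + (\<integral>y. \<beta> y ^ 3 \<partial>M) + r ^ 3"
    using \<alpha> \<beta> total by (simp add: cubic_def)
  finally show ?thesis using jensen_cube[OF \<gamma>] by (simp add: r_def)
qed

lemma averages_le:
  assumes \<alpha>: "cubic \<alpha>" and \<beta>: "cubic \<beta>" and \<gamma>: "cubic \<gamma>"
  shows "(\<integral>y. \<alpha> y \<partial>M) * (\<integral>y. \<beta> y \<partial>M) * (\<integral>y. \<gamma> y \<partial>M) \<le> (\<integral>y. \<alpha> y ^ 3 \<partial>M) + (\<integral>y. \<beta> y ^ 3 \<partial>M) + (\<integral>y. \<gamma> y ^ 3 \<partial>M)"
proof -
  have "0 \<le> (\<integral>y. \<alpha> y \<partial>M)" "0 \<le> (\<integral>y. \<beta> y \<partial>M)" "0 \<le> (\<integral>y. \<gamma> y \<partial>M)"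
    using assms by (auto simp: cubic_def intro: Bochner_Integration.integral_nonneg)
  from triple_le_cubes[OF this] show ?thesis
    using jensen_cube[OF \<alpha>] jensen_cube[OF \<beta>] jensen_cube[OF \<gamma>] by simp
qed

end

lemma averaging_ball_measure: "0 < \<epsilon> \<Longrightarrow> averaging (ball_measure \<epsilon> :: (real ^ 'd) measure)"
  by (simp add: averaging_def averaging_axioms_def finite_ball_measure measure_ball_measure)

subsection \<open>Increments of periodic fields\<close>

definition torus_L3 :: "(real ^ 'd \<Rightarrow> real ^ 3) \<Rightarrow> bool" where
  "torus_L3 f \<longleftrightarrow> f \<in> borel_measurable borel \<and> periodic f \<and> integrable torus (\<lambda>x. norm (f x) ^ 3)"

text \<open>The inner average of the Besov-VMO norm for q = 3. As also r = 3, the outer exponent r /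
  q is 1, so only the plain integral of this function over space and time is needed.\<close>

definition increment_avg :: "real \<Rightarrow> (real ^ 'd \<Rightarrow> real ^ 3) \<Rightarrow> real ^ 'd \<Rightarrow> real" where
  "increment_avg \<epsilon> f x = (\<integral>y. norm (f x - f (x - y)) ^ 3 \<partial>ball_measure \<epsilon>)"

text \<open>The bound degenerates as \<epsilon> tends to 0. It only yields integrability at a fixed
  \<epsilon>; smallness comes from the Besov-VMO hypotheses.\<close>

lemma
  fixes f :: "real ^ 'd \<Rightarrow> real ^ 3"
  assumes f: "torus_L3 f" and \<epsilon>: "0 < \<epsilon>" "\<epsilon> \<le> 1/2"
  shows increment_cubic: "averaging.cubic (ball_measure \<epsilon>) (\<lambda>y. norm (f x - f (x - y)))" (is ?cubic)
    and increment_avg_le: "increment_avg \<epsilon> f x \<le> 4 * norm (f x) ^ 3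
      + 4 / measure lborel (ball (0 :: real ^ 'd) \<epsilon>) * (\<integral>x. norm (f x) ^ 3 \<partial>torus)" (is ?le)
proof -
  interpret averaging "ball_measure \<epsilon> :: (real ^ 'd) measure" by (rule averaging_ball_measure[OF \<epsilon>(1)])
  let ?V = "measure lborel (ball (0 :: real ^ 'd) \<epsilon>)"
  have V: "0 < ?V" using \<epsilon> by simp
  have f3: "(\<lambda>x. norm (f x) ^ 3) \<in> borel_measurable borel" "periodic (\<lambda>x. norm (f x) ^ 3)"
      "integrable torus (\<lambda>x. norm (f x) ^ 3)"
    using f by (auto simp: torus_L3_def periodic_def)
  have [measurable]: "f \<in> borel_measurable borel" using f by (simp add: torus_L3_def)
  have [measurable]: "(\<lambda>y. f (x - y)) \<in> borel_measurable borel"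
    by (rule borel_measurable_lborel_translate) simp
  have ind: "indicator (ball x \<epsilon>) (x - y) = (indicator (ball 0 \<epsilon>) y :: real)" for y
    by (simp add: indicator_def dist_norm)
  have small: "integrable lborel (\<lambda>y. indicator (ball 0 \<epsilon>) y *\<^sub>R norm (f (x - y)) ^ 3)"
    using lborel_integrable_reflect[OF integrable_small_ball[OF f3 _ \<epsilon>(2), of x], of x] by (simp add: ind)
  have fi: "integrable (ball_measure \<epsilon>) (\<lambda>y. norm (f (x - y)) ^ 3)"
    by (rule integrable_ball_measure[OF _ small]) simp
  have bi: "integrable (ball_measure \<epsilon>) (\<lambda>y. 4 * (norm (f x) ^ 3 + norm (f (x - y)) ^ 3))"
    using fi by simp
  have le: "norm (f x - f (x - y)) ^ 3 \<le> 4 * (norm (f x) ^ 3 + norm (f (x - y)) ^ 3)" for y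
    using order_trans[OF power_mono[OF norm_triangle_ineq4 norm_ge_zero] cube_add_le] by auto
  have int: "integrable (ball_measure \<epsilon>) (\<lambda>y. norm (f x - f (x - y)) ^ 3)"
    by (rule Bochner_Integration.integrable_bound[OF bi]) (use le in \<open>auto intro!: AE_I2 order_trans[OF le abs_ge_self]\<close>)
  then show ?cubic by (simp add: cubic_def)
  have "increment_avg \<epsilon> f x \<le> (\<integral>y. 4 * (norm (f x) ^ 3 + norm (f (x - y)) ^ 3) \<partial>ball_measure \<epsilon>)"
    unfolding increment_avg_def by (rule integral_mono[OF int bi le])
  also have "\<dots> = 4 * norm (f x) ^ 3 + 4 * (\<integral>y. norm (f (x - y)) ^ 3 \<partial>ball_measure \<epsilon>)"
    using fi total by simp
  also have "(\<integral>y. norm (f (x - y)) ^ 3 \<partial>ball_measure \<epsilon>)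
      = (\<integral>y. indicator (ball 0 \<epsilon>) y *\<^sub>R norm (f (x - y)) ^ 3 \<partial>lborel) / ?V"
    by (subst integral_ball_measure) (simp_all flip: integral_divide_zero)
  also have "(\<integral>y. indicator (ball 0 \<epsilon>) y *\<^sub>R norm (f (x - y)) ^ 3 \<partial>lborel)
      = (\<integral>y. indicator (ball x \<epsilon>) y *\<^sub>R norm (f y) ^ 3 \<partial>lborel)"
  proof -
    have "(\<lambda>y. indicator (ball x \<epsilon>) y *\<^sub>R norm (f y) ^ 3) \<in> borel_measurable borel"
      using f3(1) by (intro borel_measurable_scaleR borel_measurable_indicator) auto
    from lborel_integral_reflect'[OF this, of x] show ?thesis by (simp add: ind)
  qed
  finally have "increment_avg \<epsilon> f x \<le> 4 * norm (f x) ^ 3 + 4 * ((\<integral>y. indicator (ball x \<epsilon>) y *\<^sub>R norm (f y) ^ 3 \<partial>lborel) / ?V)" .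
  also have "\<dots> \<le> 4 * norm (f x) ^ 3 + 4 * ((\<integral>x. norm (f x) ^ 3 \<partial>torus) / ?V)"
    using integral_small_ball[OF f3 _ \<epsilon>(2), of x] V by (intro add_left_mono mult_left_mono divide_right_mono) auto
  finally show ?le by simp
qed

lemma increment_avg_nonneg: "0 \<le> increment_avg \<epsilon> f x"
  unfolding increment_avg_def by (rule Bochner_Integration.integral_nonneg) simp

lemma measurable_increment_avg:
  assumes \<epsilon>: "0 < \<epsilon>" and v: "(\<lambda>(t, x). v t x) \<in> borel_measurable (M \<Otimes>\<^sub>M borel)"
  shows "(\<lambda>(t, x). increment_avg \<epsilon> (v t) x) \<in> borel_measurable (M \<Otimes>\<^sub>M (borel :: (real ^ 'd) measure))"
proof -
  interpret finite_measure "ball_measure \<epsilon> :: (real ^ 'd) measure" by (rule finite_ball_measure[OF \<epsilon>])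
  note [measurable] = v
  have "(\<lambda>p. (fst (fst p), snd (fst p) - snd p)) \<in> measurable ((M \<Otimes>\<^sub>M borel) \<Otimes>\<^sub>M ball_measure \<epsilon>) (M \<Otimes>\<^sub>M (borel :: (real ^ 'd) measure))"
    by measurable
  from measurable_compose[OF this v]
  have [measurable]: "(\<lambda>p. v (fst (fst p)) (snd (fst p) - snd p)) \<in> borel_measurable ((M \<Otimes>\<^sub>M borel) \<Otimes>\<^sub>M ball_measure \<epsilon>)"
    by simp
  have "(\<lambda>p. fst p) \<in> measurable ((M \<Otimes>\<^sub>M borel) \<Otimes>\<^sub>M ball_measure \<epsilon>) (M \<Otimes>\<^sub>M (borel :: (real ^ 'd) measure))"
    by measurable
  from measurable_compose[OF this v]
  have [measurable]: "(\<lambda>p. v (fst (fst p)) (snd (fst p))) \<in> borel_measurable ((M \<Otimes>\<^sub>M borel) \<Otimes>\<^sub>M ball_measure \<epsilon>)"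
    by (simp add: split_beta')
  have "(\<lambda>p. \<integral>y. norm (v (fst p) (snd p) - v (fst p) (snd p - y)) ^ 3 \<partial>ball_measure \<epsilon>) \<in> borel_measurable (M \<Otimes>\<^sub>M borel)"
    by (rule borel_measurable_lebesgue_integral) (simp add: split_beta')
  then show ?thesis by (simp add: increment_avg_def split_beta')
qed

lemma integrable_increment_avg:
  fixes f :: "real ^ 'd \<Rightarrow> real ^ 3"
  assumes f: "torus_L3 f" and \<epsilon>: "0 < \<epsilon>" "\<epsilon> \<le> 1/2"
  shows "integrable torus (increment_avg \<epsilon> f)"
proof (rule Bochner_Integration.integrable_bound)
  show "integrable torus (\<lambda>x. 4 * norm (f x) ^ 3
      + 4 / measure lborel (ball (0 :: real ^ 'd) \<epsilon>) * (\<integral>x. norm (f x) ^ 3 \<partial>torus))"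
    using f by (intro Bochner_Integration.integrable_add integrable_mult_right torus.integrable_const) (auto simp: torus_L3_def)
  have [measurable]: "f \<in> borel_measurable borel" using f by (simp add: torus_L3_def)
  \<comment> \<open>A dummy time variable of type \<open>unit\<close> makes the joint measurability
    lemma applicable to a single field.\<close>
  have f': "(\<lambda>(t::unit, x). f x) \<in> borel_measurable (count_space UNIV \<Otimes>\<^sub>M borel)"
    by measurable
  have "Pair () \<in> measurable borel (count_space UNIV \<Otimes>\<^sub>M (borel :: (real ^ 'd) measure))" by simp
  from measurable_compose[OF this measurable_increment_avg[OF \<epsilon>(1) f']]
  show "increment_avg \<epsilon> f \<in> borel_measurable torus" by simp
  show "AE x in torus. norm (increment_avg \<epsilon> f x) \<le> norm (4 * norm (f x) ^ 3
      + 4 / measure lborel (ball (0 :: real ^ 'd) \<epsilon>) * (\<integral>x. norm (f x) ^ 3 \<partial>torus))"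
    using increment_avg_le[OF f \<epsilon>] increment_avg_nonneg[of \<epsilon> f]
    by (intro AE_I2) (simp add: order_trans[OF _ abs_ge_self])
qed

subsection \<open>The commutator of convolution and multiplication\<close>

definition commutator :: "('a::euclidean_space \<Rightarrow> real) \<Rightarrow> ('a \<Rightarrow> real) \<Rightarrow> ('a \<Rightarrow> real) \<Rightarrow> 'a \<Rightarrow> real" where
  "commutator K a b x = convolve K (\<lambda>x. a x * b x) x - convolve K a x * convolve K b x"

text \<open>The mass of the kernel is left general. It is 1 for a mollifier and 0 for its
  derivatives, so one formula expresses both the approximation error and the derivatives of a
  mollified field by increments.\<close>

lemma convolve_minus_eq:
  fixes v :: "'a::euclidean_space \<Rightarrow> 'b::{banach, second_countable_topology}"
  assumes K: "kernel K" and v: "locally_integrable v"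
  shows "convolve K v x - (\<integral>y. K y \<partial>lborel) *\<^sub>R v x = - (\<integral>y. K y *\<^sub>R (v x - v (x - y)) \<partial>lborel)"
proof -
  have "(\<integral>y. K y *\<^sub>R (v x - v (x - y)) \<partial>lborel) = (\<integral>y. K y *\<^sub>R v x - K y *\<^sub>R v (x - y) \<partial>lborel)"
    by (simp add: scaleR_right_diff_distrib)
  also have "\<dots> = (\<integral>y. K y \<partial>lborel) *\<^sub>R v x - convolve K v x"
    unfolding convolve_def
    using kernel_integrable[OF K]
    by (subst Bochner_Integration.integral_diff) (auto intro: convolve_integrable K v)
  finally show ?thesis by simp
qed

text \<open>Expanding the product of increments produces the mollified product, and the remaining
  terms complete to the product of the two approximation errors. These errors are averaged
  increments themselves, so both terms on the right are quadratic in increments.\<close>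

lemma commutator_eq:
  fixes a b :: "'a::euclidean_space \<Rightarrow> real"
  assumes K: "kernel K" "(\<integral>y. K y \<partial>lborel) = 1"
    and loc: "locally_integrable a" "locally_integrable b" "locally_integrable (\<lambda>x. a x * b x)"
  shows "commutator K a b x = (\<integral>y. K y *\<^sub>R ((a x - a (x - y)) * (b x - b (x - y))) \<partial>lborel)
    - (convolve K a x - a x) * (convolve K b x - b x)"
proof -
  note int = convolve_integrable[OF K(1) loc(1), of x] convolve_integrable[OF K(1) loc(2), of x]
    convolve_integrable[OF K(1) loc(3), of x] kernel_integrable[OF K(1)]
  have "(\<integral>y. K y *\<^sub>R ((a x - a (x - y)) * (b x - b (x - y))) \<partial>lborel)
      = (\<integral>y. (K y * (a x * b x) - a x * (K y *\<^sub>R b (x - y)))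
        - (b x * (K y *\<^sub>R a (x - y)) - K y *\<^sub>R (a (x - y) * b (x - y))) \<partial>lborel)"
    by (intro Bochner_Integration.integral_cong refl) (simp add: algebra_simps)
  also have "\<dots> = (a x * b x - a x * convolve K b x) - (b x * convolve K a x - convolve K (\<lambda>x. a x * b x) x)"
    unfolding convolve_def using int K(2)
    by (simp add: Bochner_Integration.integral_diff Bochner_Integration.integrable_diff)
  finally show ?thesis by (simp add: commutator_def algebra_simps)
qed

lemma torus_L3_L1:
  assumes "torus_L3 f"
  shows "torus_L1 f"
proof -
  have "integrable torus f"
    using assms le_add_cube by (intro Bochner_Integration.integrable_bound[of torus "\<lambda>x. 1 + norm (f x) ^ 3" f])
      (auto simp: torus_L3_def)
  then show ?thesis using assms by (simp add: torus_L1_def torus_L3_def)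
qed

lemma torus_L3_mult:
  assumes f: "torus_L3 f" and g: "torus_L3 g"
  shows "torus_L1 (\<lambda>x. f x $ i * g x $ j)"
proof -
  have [measurable]: "(\<lambda>x. f x $ i) \<in> borel_measurable borel" "(\<lambda>x. g x $ j) \<in> borel_measurable borel"
    using torus_L1_measurable[OF torus_L1_vec_nth[OF torus_L3_L1[OF f]]]
      torus_L1_measurable[OF torus_L1_vec_nth[OF torus_L3_L1[OF g]]] by auto
  have le: "norm (f x $ i * g x $ j) \<le> norm (norm (f x) ^ 3 + norm (g x) ^ 3 + 1)" for x
  proof -
    have "norm (f x $ i * g x $ j) \<le> norm (f x) * norm (g x)"
      unfolding norm_mult by (intro mult_mono) (use component_le_norm_cart in auto)
    also have "\<dots> \<le> norm (f x) ^ 3 + norm (g x) ^ 3 + 1"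
      using triple_le_cubes[of "norm (f x)" "norm (g x)" 1] by simp
    finally show ?thesis by simp
  qed
  have "integrable torus (\<lambda>x. f x $ i * g x $ j)"
    by (rule Bochner_Integration.integrable_bound[of torus "\<lambda>x. norm (f x) ^ 3 + norm (g x) ^ 3 + 1"])
      (use f g le in \<open>auto simp: torus_L3_def\<close>)
  then show ?thesis using f g by (auto simp: torus_L1_def torus_L3_def periodic_def)
qed

text \<open>Bounds a single linear factor of the flux; by Jensen its cube is at most
  \<open>increment_avg\<close>.\<close>

definition increment_mean :: "real \<Rightarrow> (real ^ 'd \<Rightarrow> real ^ 3) \<Rightarrow> real ^ 'd \<Rightarrow> real" where
  "increment_mean \<epsilon> f x = (\<integral>y. norm (f x - f (x - y)) \<partial>ball_measure \<epsilon>)"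

lemma increment_mean_nonneg: "0 \<le> increment_mean \<epsilon> f x"
  unfolding increment_mean_def by (rule Bochner_Integration.integral_nonneg) simp

lemma norm_convolve_minus_le:
  fixes f :: "real ^ 'd \<Rightarrow> real ^ 3"
  assumes K: "kernel K" "\<And>y. \<bar>K y\<bar> \<le> c / measure lborel (ball (0 :: real ^ 'd) \<epsilon>) * indicator (ball 0 \<epsilon>) y"
    and f: "torus_L3 f" and \<epsilon>: "0 < \<epsilon>" "\<epsilon> \<le> 1/2"
  shows "norm (convolve K f x - (\<integral>y. K y \<partial>lborel) *\<^sub>R f x) \<le> c * increment_mean \<epsilon> f x"
proof -
  interpret averaging "ball_measure \<epsilon> :: (real ^ 'd) measure" by (rule averaging_ball_measure[OF \<epsilon>(1)])
  have [measurable]: "f \<in> borel_measurable borel" using f by (simp add: torus_L3_def)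
  have [measurable]: "(\<lambda>y. f (x - y)) \<in> borel_measurable borel"
    by (rule borel_measurable_lborel_translate) simp
  have int: "integrable (ball_measure \<epsilon>) (\<lambda>y. f x - f (x - y))"
    using cubic_integrable[OF increment_cubic[OF f \<epsilon>, of x]] by (subst integrable_norm_iff[symmetric]) auto
  have "norm (convolve K f x - (\<integral>y. K y \<partial>lborel) *\<^sub>R f x) = norm (\<integral>y. K y *\<^sub>R (f x - f (x - y)) \<partial>lborel)"
    using convolve_minus_eq[OF K(1) torus_L1_locally_integrable[OF torus_L3_L1[OF f]]] by simp
  also have "\<dots> \<le> c * increment_mean \<epsilon> f x"
    unfolding increment_mean_def by (rule kernel_ball_measure_bound[OF K(2) _ int]) auto
  finally show ?thesis .
qed

section \<open>Fluxes of the weak formulation and their commutator estimates\<close>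

definition momentum_flux ::
  "('d::finite \<Rightarrow> 3) \<Rightarrow> (real ^ 'd \<Rightarrow> real ^ 3) \<Rightarrow> (real ^ 'd \<Rightarrow> real ^ 3) \<Rightarrow> (real ^ 'd \<Rightarrow> real ^ 3) \<Rightarrow> real" where
  "momentum_flux \<iota> u h \<phi> = (\<integral>x. (\<Sum>i\<in>UNIV. \<Sum>k\<in>UNIV.
     partial \<iota> k \<phi> x $ i * (u x $ i * u x $ k - h x $ i * h x $ k)) \<partial>torus)"

definition induction_flux ::
  "('d::finite \<Rightarrow> 3) \<Rightarrow> (real ^ 'd \<Rightarrow> real ^ 3) \<Rightarrow> (real ^ 'd \<Rightarrow> real ^ 3) \<Rightarrow> (real ^ 'd \<Rightarrow> real ^ 3) \<Rightarrow> real" where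
  "induction_flux \<iota> u h \<phi> = (\<integral>x. (\<Sum>i\<in>UNIV. \<Sum>k\<in>UNIV.
     partial \<iota> k \<phi> x $ i * (h x $ i * u x $ k - u x $ i * h x $ k))
     + (\<Sum>i\<in>UNIV. \<Sum>k\<in>UNIV. h x $ i * h x $ k * partial \<iota> k (curl \<iota> \<phi>) x $ i) \<partial>torus)"

text \<open>In contrast to \<open>partial_convolve\<close> the derivative falls on the smooth field,
  so the outer convolution stays in front and can be moved to the quadratic terms of the
  flux.\<close>

lemma partial_convolve_nth:
  fixes V :: "real ^ 'd \<Rightarrow> real ^ 3"
  assumes K: "kernel K" and V: "smooth V" "periodic V"
  shows "partial \<iota> k (convolve K V) x $ i = convolve K (\<lambda>x. partial \<iota> k V x $ i) x"
proof -
  have loc: "torus_L1 V" using V by (simp add: torus_L1_smooth)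
  have "partial \<iota> k (convolve K V) x $ i = partial \<iota> k (\<lambda>x. convolve K V x $ i) x"
    by (rule partial_vec_nth[symmetric, OF smooth_convolve_L1[OF K loc]])
  also have "(\<lambda>x. convolve K V x $ i) = convolve K (\<lambda>x. V x $ i)"
    using convolve_vec_nth[OF K torus_L1_locally_integrable[OF loc]] by auto
  also have "partial \<iota> k \<dots> = convolve K (partial \<iota> k (\<lambda>x. V x $ i))"
    using dir_deriv_convolve_right[OF K smooth_vec_nth[OF V(1)]]
    by (simp add: partial_smooth smooth_vec_nth V smooth_convolve_L1 K torus_L1_vec_nth loc)
  also have "partial \<iota> k (\<lambda>x. V x $ i) = (\<lambda>x. partial \<iota> k V x $ i)"
    using partial_vec_nth[OF V(1)] by blast
  finally show ?thesis .
qed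

lemma curl_convolve:
  fixes V :: "real ^ 'd \<Rightarrow> real ^ 3"
  assumes K: "kernel K" and V: "smooth V" "periodic V"
  shows "curl \<iota> (convolve K V) = convolve K (curl \<iota> V)"
proof
  fix x
  have L1: "torus_L1 (\<lambda>x. partial \<iota> k V x $ i)" for k i
    by (intro torus_L1_smooth periodic_vec_nth smooth_vec_nth smooth_partial periodic_partial V)
  have sub: "convolve K (\<lambda>x. partial \<iota> k V x $ i) x - convolve K (\<lambda>x. partial \<iota> l V x $ j) x
      = convolve K (\<lambda>x. partial \<iota> k V x $ i - partial \<iota> l V x $ j) x" for k i l j
    unfolding convolve_def
    by (simp add: right_diff_distrib Bochner_Integration.integral_diff
        convolve_integrable[OF K torus_L1_locally_integrable[OF L1], unfolded real_scaleR_def])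
  have J: "torus_L1 (curl \<iota> V)" by (intro torus_L1_smooth smooth_curl periodic_curl V)
  show "curl \<iota> (convolve K V) x = convolve K (curl \<iota> V) x"
    unfolding vec_eq_iff
  proof
    fix i :: 3
    have "convolve K (curl \<iota> V) x $ i = convolve K (\<lambda>x. curl \<iota> V x $ i) x"
      by (rule convolve_vec_nth[symmetric, OF K torus_L1_locally_integrable[OF J]])
    then show "curl \<iota> (convolve K V) x $ i = convolve K (curl \<iota> V) x $ i"
      using exhaust_3[of i]
      by (elim disjE) (simp_all add: curl_components partial_convolve_nth[OF K V] sub)
  qed
qed

locale mollified =
  fixes \<iota> :: "'d::finite \<Rightarrow> 3" and C \<epsilon> :: real and \<eta> :: "real ^ 'd \<Rightarrow> real"
  assumes moll: "mollifier \<iota> C \<epsilon> \<eta>" and C: "1 \<le> C" and \<epsilon>: "0 < \<epsilon>" "\<epsilon> \<le> 1/2"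
begin

sublocale averaging "ball_measure \<epsilon> :: (real ^ 'd) measure"
  by (rule averaging_ball_measure[OF \<epsilon>(1)])

lemma kernel: "kernel \<eta>"
  and even: "\<eta> (- y) = \<eta> y"
  and integral_1: "(\<integral>y. \<eta> y \<partial>lborel) = 1"
  and bound: "\<bar>\<eta> y\<bar> \<le> C / measure lborel (ball (0 :: real ^ 'd) \<epsilon>) * indicator (ball 0 \<epsilon>) y"
  and bound1: "\<bar>dir_deriv (direction \<iota> k) \<eta> y\<bar>
       \<le> C / \<epsilon> / measure lborel (ball (0 :: real ^ 'd) \<epsilon>) * indicator (ball 0 \<epsilon>) y"
  and bound2: "\<bar>dir_deriv (direction \<iota> k) (dir_deriv (direction \<iota> j) \<eta>) y\<bar>
       \<le> C / \<epsilon>\<^sup>2 / measure lborel (ball (0 :: real ^ 'd) \<epsilon>) * indicator (ball 0 \<epsilon>) y"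
  using moll by (simp_all add: mollifier_def)

lemma mollify_minus_le:
  "torus_L3 f \<Longrightarrow> norm (convolve \<eta> f x - f x) \<le> C * increment_mean \<epsilon> f x"
  using norm_convolve_minus_le[OF kernel bound _ \<epsilon>] by (simp add: integral_1)

text \<open>The derivative of the mollifier has integral 0, so the value \<open>f x\<close> may be
  subtracted from the field. The derivative costs 1/\<epsilon> but still contains a full
  increment.\<close>

lemma partial_mollify_le:
  assumes f: "torus_L3 f"
  shows "\<bar>partial \<iota> k (convolve \<eta> f) x $ i\<bar> \<le> C / \<epsilon> * increment_mean \<epsilon> f x"
proof -
  have "norm (convolve (dir_deriv (direction \<iota> k) \<eta>) f x) \<le> C / \<epsilon> * increment_mean \<epsilon> f x"
    using norm_convolve_minus_le[OF kernel_dir_deriv[OF kernel] bound1 f \<epsilon>]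
    by (simp add: integral_dir_deriv_kernel[OF kernel])
  then show ?thesis
    unfolding partial_convolve[OF kernel torus_L3_L1[OF f]]
    by (rule order_trans[OF component_le_norm_cart])
qed

lemma partial_partial_mollify_le:
  assumes f: "torus_L3 f"
  shows "\<bar>partial \<iota> k (partial \<iota> j (convolve \<eta> f)) x $ i\<bar> \<le> C / \<epsilon>\<^sup>2 * increment_mean \<epsilon> f x"
proof -
  have "norm (convolve (dir_deriv (direction \<iota> k) (dir_deriv (direction \<iota> j) \<eta>)) f x) \<le> C / \<epsilon>\<^sup>2 * increment_mean \<epsilon> f x"
    using norm_convolve_minus_le[OF kernel_dir_deriv[OF kernel_dir_deriv[OF kernel]] bound2 f \<epsilon>]
    by (simp add: integral_dir_deriv_kernel[OF kernel_dir_deriv[OF kernel]])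
  then show ?thesis
    unfolding partial_convolve[OF kernel torus_L3_L1[OF f]]
      partial_convolve[OF kernel_dir_deriv[OF kernel] torus_L3_L1[OF f]]
    by (rule order_trans[OF component_le_norm_cart])
qed

lemma partial_curl_mollify_le:
  assumes f: "torus_L3 f"
  shows "\<bar>partial \<iota> k (curl \<iota> (convolve \<eta> f)) x $ i\<bar> \<le> 2 * C / \<epsilon>\<^sup>2 * increment_mean \<epsilon> f x"
  using partial_curl_le[OF smooth_convolve_L1[OF kernel torus_L3_L1[OF f]] partial_partial_mollify_le[OF f, of k _ x]]
  by (simp add: mult.assoc)

text \<open>\<open>X\<close> stands for the derivative of a mollified field that multiplies the
  commutator in the flux. The product contains three increments, which is where the cubes come
  from.\<close>

lemma commutator_le:
  assumes f: "torus_L3 f" and g: "torus_L3 g" and w: "torus_L3 w"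
    and c: "0 \<le> c" and X: "\<bar>X\<bar> \<le> c * increment_mean \<epsilon> w x"
  shows "\<bar>commutator \<eta> (\<lambda>x. f x $ i) (\<lambda>x. g x $ j) x * X\<bar>
    \<le> 2 * C\<^sup>2 * c * (increment_avg \<epsilon> f x + increment_avg \<epsilon> g x + increment_avg \<epsilon> w x)"
proof -
  let ?a = "\<lambda>x. f x $ i" and ?b = "\<lambda>x. g x $ j"
  define \<alpha> where "\<alpha> y = norm (f x - f (x - y))" for y
  define \<beta> where "\<beta> y = norm (g x - g (x - y))" for y
  define \<gamma> where "\<gamma> y = norm (w x - w (x - y))" for y
  have cubic: "cubic \<alpha>" "cubic \<beta>" "cubic \<gamma>"
    unfolding \<alpha>_def \<beta>_def \<gamma>_def by (intro increment_cubic f g w \<epsilon>)+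
  define S where "S = increment_avg \<epsilon> f x + increment_avg \<epsilon> g x + increment_avg \<epsilon> w x"
  have S: "0 \<le> S" by (simp add: S_def increment_avg_nonneg)
  have m: "increment_mean \<epsilon> f x = (\<integral>y. \<alpha> y \<partial>ball_measure \<epsilon>)" "increment_mean \<epsilon> g x = (\<integral>y. \<beta> y \<partial>ball_measure \<epsilon>)"
    "increment_mean \<epsilon> w x = (\<integral>y. \<gamma> y \<partial>ball_measure \<epsilon>)"
    by (simp_all add: increment_mean_def \<alpha>_def \<beta>_def \<gamma>_def)
  have S1: "(\<integral>y. \<alpha> y * \<beta> y \<partial>ball_measure \<epsilon>) * increment_mean \<epsilon> w x \<le> S"
    using average_mult_average_le[OF cubic] by (simp add: S_def m increment_avg_def \<alpha>_def \<beta>_def \<gamma>_def)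
  have S2: "increment_mean \<epsilon> f x * increment_mean \<epsilon> g x * increment_mean \<epsilon> w x \<le> S"
    using averages_le[OF cubic] by (simp add: S_def m increment_avg_def \<alpha>_def \<beta>_def \<gamma>_def)
  have L1: "torus_L1 ?a" "torus_L1 ?b" "torus_L1 (\<lambda>x. ?a x * ?b x)"
    by (intro torus_L1_vec_nth torus_L3_L1 torus_L3_mult f g)+
  note loc = this[THEN torus_L1_locally_integrable]
  have [measurable]: "?a \<in> borel_measurable borel" "?b \<in> borel_measurable borel"
    using L1 by (simp_all add: torus_L1_measurable)
  have [measurable]: "(\<lambda>y. ?a (x - y)) \<in> borel_measurable borel" "(\<lambda>y. ?b (x - y)) \<in> borel_measurable borel"
    using borel_measurable_lborel_translate(1)[of ?a x] borel_measurable_lborel_translate(1)[of ?b x] by simp_all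
  have le: "\<bar>(?a x - ?a (x - y)) * (?b x - ?b (x - y))\<bar> \<le> \<alpha> y * \<beta> y" for y
    unfolding abs_mult \<alpha>_def \<beta>_def
    using component_le_norm_cart[of "f x - f (x - y)" i] component_le_norm_cart[of "g x - g (x - y)" j]
    by (intro mult_mono) auto
  have int: "integrable (ball_measure \<epsilon>) (\<lambda>y. (?a x - ?a (x - y)) * (?b x - ?b (x - y)))"
    by (rule Bochner_Integration.integrable_bound[OF cubic_mult_integrable[OF cubic(1,2)]])
      (auto intro!: AE_I2 order_trans[OF le abs_ge_self])
  have "norm (\<integral>y. \<eta> y *\<^sub>R ((?a x - ?a (x - y)) * (?b x - ?b (x - y))) \<partial>lborel)
      \<le> C * (\<integral>y. norm ((?a x - ?a (x - y)) * (?b x - ?b (x - y))) \<partial>ball_measure \<epsilon>)"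
    by (rule kernel_ball_measure_bound[OF bound _ int]) measurable
  also have "\<dots> \<le> C * (\<integral>y. \<alpha> y * \<beta> y \<partial>ball_measure \<epsilon>)"
    using C le integrable_norm[OF int] cubic_mult_integrable[OF cubic(1,2)]
    by (intro mult_left_mono integral_mono) auto
  finally have I: "\<bar>\<integral>y. \<eta> y *\<^sub>R ((?a x - ?a (x - y)) * (?b x - ?b (x - y))) \<partial>lborel\<bar>
      \<le> C * (\<integral>y. \<alpha> y * \<beta> y \<partial>ball_measure \<epsilon>)" by simp
  have A: "\<bar>convolve \<eta> (\<lambda>x. v x $ l) x - v x $ l\<bar> \<le> C * increment_mean \<epsilon> v x" if "torus_L3 v" for v l
    using order_trans[OF component_le_norm_cart mollify_minus_le[OF that], of x l]
    by (simp add: convolve_vec_nth[OF kernel torus_L1_locally_integrable[OF torus_L3_L1[OF that]]])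
  have AB: "\<bar>(convolve \<eta> ?a x - ?a x) * (convolve \<eta> ?b x - ?b x)\<bar>
      \<le> (C * increment_mean \<epsilon> f x) * (C * increment_mean \<epsilon> g x)"
    unfolding abs_mult using C by (intro mult_mono A f g) (auto intro!: mult_nonneg_nonneg increment_mean_nonneg)
  have "\<bar>commutator \<eta> ?a ?b x * X\<bar>
      \<le> (C * (\<integral>y. \<alpha> y * \<beta> y \<partial>ball_measure \<epsilon>) + (C * increment_mean \<epsilon> f x) * (C * increment_mean \<epsilon> g x))
        * (c * increment_mean \<epsilon> w x)"
    unfolding abs_mult commutator_eq[OF kernel integral_1 loc]
    using order_trans[OF abs_triangle_ineq4 add_mono[OF I AB]] X c
    by (intro mult_mono) (auto intro: order_trans[OF abs_ge_zero])
  also have "\<dots> = C * c * ((\<integral>y. \<alpha> y * \<beta> y \<partial>ball_measure \<epsilon>) * increment_mean \<epsilon> w x)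
      + C\<^sup>2 * c * (increment_mean \<epsilon> f x * increment_mean \<epsilon> g x * increment_mean \<epsilon> w x)"
    by (simp add: algebra_simps power2_eq_square)
  also have "\<dots> \<le> C * c * S + C\<^sup>2 * c * S"
    using C c by (intro add_mono mult_left_mono S1 S2) auto
  \<comment> \<open>As 1 \<le> C, the term linear in \<open>C\<close> is absorbed by the quadratic
    one; this gives the factor 2.\<close>
  also have "\<dots> \<le> C\<^sup>2 * c * S + C\<^sup>2 * c * S"
    using C c S by (intro add_right_mono mult_right_mono self_le_power) auto
  finally show ?thesis by (simp add: S_def algebra_simps)
qed

text \<open>Self-adjointness moves the outer mollifier of the test field to the product of the rough
  fields. The product of mollified fields is the part that cancels in the total flux, the commutator
  is what remains.\<close>

lemma convolve_product_eq:
  fixes g :: "real ^ 'd \<Rightarrow> real"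
  assumes f: "torus_L3 f" and f': "torus_L3 f'" and g: "smooth g" "periodic g"
  shows "integrable torus (\<lambda>x. f x $ i * f' x $ j * convolve \<eta> g x)" (is ?I1)
    and "integrable torus (\<lambda>x. convolve \<eta> f x $ i * convolve \<eta> f' x $ j * g x)" (is ?I2)
    and "integrable torus (\<lambda>x. commutator \<eta> (\<lambda>x. f x $ i) (\<lambda>x. f' x $ j) x * g x)" (is ?I3)
    and "(\<integral>x. f x $ i * f' x $ j * convolve \<eta> g x \<partial>torus)
      = (\<integral>x. convolve \<eta> f x $ i * convolve \<eta> f' x $ j * g x \<partial>torus)
        + (\<integral>x. commutator \<eta> (\<lambda>x. f x $ i) (\<lambda>x. f' x $ j) x * g x \<partial>torus)" (is ?E)
proof -
  let ?p = "\<lambda>x. f x $ i * f' x $ j"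
  have p: "torus_L1 ?p" by (rule torus_L3_mult[OF f f'])
  have g1: "torus_L1 g" using g by (simp add: torus_L1_smooth)
  have nth: "convolve \<eta> (\<lambda>x. v x $ l) x = convolve \<eta> v x $ l" if "torus_L3 v" for v :: "real ^ 'd \<Rightarrow> real ^ 3" and l x
    by (rule convolve_vec_nth[OF kernel torus_L1_locally_integrable[OF torus_L3_L1[OF that]]])
  have sm: "smooth (\<lambda>x. convolve \<eta> f x $ i * convolve \<eta> f' x $ j)" "periodic (\<lambda>x. convolve \<eta> f x $ i * convolve \<eta> f' x $ j)"
    by (intro smooth_mult smooth_vec_nth smooth_convolve_L1 kernel torus_L3_L1 f f'
        periodic_mult periodic_vec_nth periodic_convolve torus_L1_periodic)+
  have cp: "smooth (convolve \<eta> ?p)" "periodic (convolve \<eta> ?p)"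
    by (intro smooth_convolve_L1 periodic_convolve torus_L1_periodic kernel p)+
  have eq: "convolve \<eta> ?p x * g x = convolve \<eta> f x $ i * convolve \<eta> f' x $ j * g x
      + commutator \<eta> (\<lambda>x. f x $ i) (\<lambda>x. f' x $ j) x * g x" for x
    by (simp add: commutator_def nth f f' algebra_simps)
  have Ip: "integrable torus (\<lambda>x. convolve \<eta> ?p x * g x)"
    by (intro integrable_torus_smooth_periodic smooth_mult periodic_mult cp g)
  show ?I1
    by (intro integrable_mult_smooth_periodic p smooth_convolve_L1 periodic_convolve kernel g1 g)
  show I2: ?I2
    by (intro integrable_torus_smooth_periodic smooth_mult[OF sm(1)] periodic_mult[OF sm(2)] g)
  show I3: ?I3
    using Bochner_Integration.integrable_diff[OF Ip I2] by (simp add: eq)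
  show ?E
    using convolve_even_adjoint[OF kernel even p g] I2 I3 by (simp add: eq)
qed

text \<open>One function \<open>S\<close> above all three averages turns the factor 2 of
  \<open>commutator_le\<close> into 6.\<close>

lemma integral_commutator_le:
  assumes f: "torus_L3 f" "torus_L3 f'" "torus_L3 w" and g: "smooth g" "periodic g"
    and c: "0 \<le> c" and gw: "\<And>x. \<bar>g x\<bar> \<le> c * increment_mean \<epsilon> w x"
    and S: "integrable torus S" "\<And>x. increment_avg \<epsilon> f x \<le> S x" "\<And>x. increment_avg \<epsilon> f' x \<le> S x"
      "\<And>x. increment_avg \<epsilon> w x \<le> S x"
  shows "\<bar>\<integral>x. commutator \<eta> (\<lambda>x. f x $ i) (\<lambda>x. f' x $ j) x * g x \<partial>torus\<bar> \<le> 6 * C\<^sup>2 * c * (\<integral>x. S x \<partial>torus)"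
proof -
  have le: "\<bar>commutator \<eta> (\<lambda>x. f x $ i) (\<lambda>x. f' x $ j) x * g x\<bar> \<le> 6 * C\<^sup>2 * c * S x" for x
  proof -
    have "2 * C\<^sup>2 * c * (increment_avg \<epsilon> f x + increment_avg \<epsilon> f' x + increment_avg \<epsilon> w x) \<le> 2 * C\<^sup>2 * c * (3 * S x)"
      using S(2-4)[of x] c by (intro mult_left_mono) auto
    then show ?thesis using order_trans[OF commutator_le[OF f c gw]] by simp
  qed
  have "\<bar>\<integral>x. commutator \<eta> (\<lambda>x. f x $ i) (\<lambda>x. f' x $ j) x * g x \<partial>torus\<bar>
      \<le> (\<integral>x. \<bar>commutator \<eta> (\<lambda>x. f x $ i) (\<lambda>x. f' x $ j) x * g x\<bar> \<partial>torus)"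
    by (rule integral_abs_bound)
  also have "\<dots> \<le> (\<integral>x. 6 * C\<^sup>2 * c * S x \<partial>torus)"
    by (rule integral_mono[OF integrable_abs[OF convolve_product_eq(3)[OF f(1,2) g]] integrable_mult_right[OF S(1)] le])
  finally show ?thesis by simp
qed

lemma flux_bound:
  assumes u: "torus_L3 u" "weakly_div_free \<iota> u" and h: "torus_L3 h" "weakly_div_free \<iota> h"
  shows "\<bar>momentum_flux \<iota> u h (convolve \<eta> (convolve \<eta> u)) + induction_flux \<iota> u h (convolve \<eta> (convolve \<eta> h))\<bar>
    \<le> 216 * C ^ 3 * (1 / \<epsilon> * (\<integral>x. increment_avg \<epsilon> u x + increment_avg \<epsilon> h x \<partial>torus)
        + 1 / \<epsilon>\<^sup>2 * (\<integral>x. increment_avg \<epsilon> h x \<partial>torus))"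
proof -
  define U where "U = convolve \<eta> u"
  define H where "H = convolve \<eta> h"
  define J where "J = curl \<iota> H"
  have U: "smooth U" "periodic U" "weakly_div_free \<iota> U" and H: "smooth H" "periodic H" "weakly_div_free \<iota> H"
    unfolding U_def H_def
    by (intro smooth_convolve_L1 periodic_convolve weakly_div_free_convolve torus_L3_L1 torus_L1_periodic kernel even u h)+
  have J: "smooth J" "periodic J" unfolding J_def by (intro smooth_curl periodic_curl H)+
  define a where "a i k x = partial \<iota> k U x $ i" for i k x
  define b where "b i k x = partial \<iota> k H x $ i" for i k x
  define c where "c i k x = partial \<iota> k J x $ i" for i k x
  have sm: "smooth (a i k)" "periodic (a i k)" "smooth (b i k)" "periodic (b i k)" "smooth (c i k)" "periodic (c i k)" for i k
    unfolding a_def b_def c_def by (intro smooth_vec_nth periodic_vec_nth smooth_partial periodic_partial U H J)+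
  \<comment> \<open>\<open>A\<close> is the flux density of the smooth pair \<open>U\<close>,
    \<open>H\<close>, whose sum over all indices has integral 0; \<open>B\<close> is the commutator
    remainder.\<close>
  define A where "A i k x = U x $ i * U x $ k * a i k x - H x $ i * H x $ k * a i k x
    + (H x $ i * U x $ k * b i k x - U x $ i * H x $ k * b i k x) + H x $ i * H x $ k * c i k x" for i k x
  define B where "B i k x = commutator \<eta> (\<lambda>x. u x $ i) (\<lambda>x. u x $ k) x * a i k x
    - commutator \<eta> (\<lambda>x. h x $ i) (\<lambda>x. h x $ k) x * a i k x
    + (commutator \<eta> (\<lambda>x. h x $ i) (\<lambda>x. u x $ k) x * b i k x
    - commutator \<eta> (\<lambda>x. u x $ i) (\<lambda>x. h x $ k) x * b i k x)
    + commutator \<eta> (\<lambda>x. h x $ i) (\<lambda>x. h x $ k) x * c i k x" for i k x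
  note eqs = convolve_product_eq[OF u(1) u(1), folded U_def] convolve_product_eq[OF h(1) h(1), folded H_def]
    convolve_product_eq[OF h(1) u(1), folded U_def H_def] convolve_product_eq[OF u(1) h(1), folded U_def H_def]
  have intA: "integrable torus (A i k)" and intB: "integrable torus (B i k)" for i k
    unfolding A_def B_def by (intro Bochner_Integration.integrable_add Bochner_Integration.integrable_diff eqs sm)+
  have mom: "momentum_flux \<iota> u h (convolve \<eta> U) = (\<Sum>i\<in>UNIV. \<Sum>k\<in>UNIV.
      (\<integral>x. u x $ i * u x $ k * convolve \<eta> (a i k) x \<partial>torus) - (\<integral>x. h x $ i * h x $ k * convolve \<eta> (a i k) x \<partial>torus))"
    unfolding momentum_flux_def partial_convolve_nth[OF kernel U(1,2)]
    by (simp add: a_def[symmetric] right_diff_distrib eqs sm mult.commute[of "convolve \<eta> _ _"])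
  have ind: "induction_flux \<iota> u h (convolve \<eta> H) = (\<Sum>i\<in>UNIV. \<Sum>k\<in>UNIV.
      ((\<integral>x. h x $ i * u x $ k * convolve \<eta> (b i k) x \<partial>torus) - (\<integral>x. u x $ i * h x $ k * convolve \<eta> (b i k) x \<partial>torus))
      + (\<integral>x. h x $ i * h x $ k * convolve \<eta> (c i k) x \<partial>torus))"
    unfolding induction_flux_def curl_convolve[OF kernel H(1,2)] J_def[symmetric]
      partial_convolve_nth[OF kernel H(1,2)] partial_convolve_nth[OF kernel J]
    by (simp add: b_def[symmetric] c_def[symmetric] right_diff_distrib eqs sm sum.distrib mult.commute[of "convolve \<eta> _ _"])
  have "momentum_flux \<iota> u h (convolve \<eta> U) + induction_flux \<iota> u h (convolve \<eta> H)
      = (\<Sum>i\<in>UNIV. \<Sum>k\<in>UNIV. (\<integral>x. A i k x \<partial>torus) + (\<integral>x. B i k x \<partial>torus))"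
    unfolding mom ind A_def B_def by (simp add: eqs sm sum.distrib sum_subtractf)
  also have "\<dots> = (\<integral>x. (\<Sum>i\<in>UNIV. \<Sum>k\<in>UNIV. A i k x) \<partial>torus) + (\<Sum>i\<in>UNIV. \<Sum>k\<in>UNIV. \<integral>x. B i k x \<partial>torus)"
    by (simp add: intA sum.distrib)
  also have "(\<integral>x. (\<Sum>i\<in>UNIV. \<Sum>k\<in>UNIV. A i k x) \<partial>torus) = 0"
    using smooth_flux_vanishes[OF U H]
    by (simp add: A_def a_def b_def c_def J_def algebra_simps)
  finally have flux: "momentum_flux \<iota> u h (convolve \<eta> U) + induction_flux \<iota> u h (convolve \<eta> H)
      = (\<Sum>i\<in>UNIV. \<Sum>k\<in>UNIV. \<integral>x. B i k x \<partial>torus)" by simp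
  define S where "S x = increment_avg \<epsilon> u x + increment_avg \<epsilon> h x" for x
  have Sint: "integrable torus S" "integrable torus (increment_avg \<epsilon> h)"
    unfolding S_def by (intro Bochner_Integration.integrable_add integrable_increment_avg u h \<epsilon>)+
  have S: "increment_avg \<epsilon> u x \<le> S x" "increment_avg \<epsilon> h x \<le> S x" for x
    by (simp_all add: S_def increment_avg_nonneg)
  have ce: "0 \<le> C / \<epsilon>" "0 \<le> 2 * C / \<epsilon>\<^sup>2" using C \<epsilon> by auto
  have au: "\<bar>a i k x\<bar> \<le> C / \<epsilon> * increment_mean \<epsilon> u x" and bh: "\<bar>b i k x\<bar> \<le> C / \<epsilon> * increment_mean \<epsilon> h x"
    and ch: "\<bar>c i k x\<bar> \<le> 2 * C / \<epsilon>\<^sup>2 * increment_mean \<epsilon> h x" for i k x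
    unfolding a_def b_def c_def J_def U_def H_def
    by (intro partial_mollify_le partial_curl_mollify_le u h)+
  define X where "X = 6 * C\<^sup>2 * (C / \<epsilon>) * (\<integral>x. S x \<partial>torus)"
  \<comment> \<open>Only increments of \<open>h\<close> enter, since all three factors of the Hall
    term stem from \<open>h\<close>. This keeps the lower regularity of \<open>u\<close> away from
    the factor 1/\<epsilon>^2.\<close>
  define Y where "Y = 6 * C\<^sup>2 * (2 * C / \<epsilon>\<^sup>2) * (\<integral>x. increment_avg \<epsilon> h x \<partial>torus)"
  have Bb: "\<bar>\<integral>x. B i k x \<partial>torus\<bar> \<le> 4 * X + Y" for i k
  proof -
    have "(\<integral>x. B i k x \<partial>torus) = (\<integral>x. commutator \<eta> (\<lambda>x. u x $ i) (\<lambda>x. u x $ k) x * a i k x \<partial>torus)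
      - (\<integral>x. commutator \<eta> (\<lambda>x. h x $ i) (\<lambda>x. h x $ k) x * a i k x \<partial>torus)
      + ((\<integral>x. commutator \<eta> (\<lambda>x. h x $ i) (\<lambda>x. u x $ k) x * b i k x \<partial>torus)
      - (\<integral>x. commutator \<eta> (\<lambda>x. u x $ i) (\<lambda>x. h x $ k) x * b i k x \<partial>torus))
      + (\<integral>x. commutator \<eta> (\<lambda>x. h x $ i) (\<lambda>x. h x $ k) x * c i k x \<partial>torus)"
      unfolding B_def by (simp add: eqs sm)
    moreover note integral_commutator_le[OF u(1) u(1) u(1) sm(1,2) ce(1) au Sint(1) S(1) S(1) S(1), of i k i k, folded X_def]
      integral_commutator_le[OF h(1) h(1) u(1) sm(1,2) ce(1) au Sint(1) S(2) S(2) S(1), of i k i k, folded X_def]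
      integral_commutator_le[OF h(1) u(1) h(1) sm(3,4) ce(1) bh Sint(1) S(2) S(1) S(2), of i k i k, folded X_def]
      integral_commutator_le[OF u(1) h(1) h(1) sm(3,4) ce(1) bh Sint(1) S(1) S(2) S(2), of i k i k, folded X_def]
      integral_commutator_le[OF h(1) h(1) h(1) sm(5,6) ce(2) ch Sint(2) order_refl order_refl order_refl, of i k i k, folded Y_def]
    ultimately show ?thesis by linarith
  qed
  have "\<bar>\<Sum>i\<in>UNIV. \<Sum>k\<in>UNIV. \<integral>x. B i k x \<partial>torus\<bar> \<le> (\<Sum>i\<in>(UNIV :: 3 set). \<Sum>k\<in>(UNIV :: 3 set). 4 * X + Y)"
    by (rule order_trans[OF sum_abs sum_mono], rule order_trans[OF sum_abs sum_mono], rule Bb)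
  \<comment> \<open>There are nine index pairs, each with four first-order terms of constant 6 and
    one Hall term of constant 12. This gives 9 * 24 = 216 and 9 * 12 = 108, the latter rounded
    up.\<close>
  also have "\<dots> = 9 * (4 * X + Y)" by simp
  also have "\<dots> \<le> 216 * C ^ 3 * (1 / \<epsilon> * (\<integral>x. S x \<partial>torus) + 1 / \<epsilon>\<^sup>2 * (\<integral>x. increment_avg \<epsilon> h x \<partial>torus))"
  proof -
    have "0 \<le> (\<integral>x. increment_avg \<epsilon> h x \<partial>torus)"
      by (rule Bochner_Integration.integral_nonneg) (rule increment_avg_nonneg)
    then have Z: "0 \<le> C ^ 3 * (1 / \<epsilon>\<^sup>2 * (\<integral>x. increment_avg \<epsilon> h x \<partial>torus))" (is "0 \<le> ?Z")
      using C by (intro mult_nonneg_nonneg) auto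
    have "9 * (4 * X + Y) = 216 * (C ^ 3 * (1 / \<epsilon> * (\<integral>x. S x \<partial>torus))) + 108 * ?Z"
      unfolding X_def Y_def by (simp add: power2_eq_square power3_eq_cube algebra_simps)
    then show ?thesis using Z unfolding distrib_left by linarith
  qed
  finally show ?thesis
    using flux unfolding U_def H_def S_def by simp
qed

end

subsection \<open>From the weak formulation to increments in time\<close>

lemma has_real_derivative_smooth:
  fixes f :: "real \<Rightarrow> real"
  assumes "smooth f"
  shows "(f has_real_derivative dir_deriv 1 f t) (at t)"
proof -
  have "linear (\<lambda>h. dir_deriv h f t)"
    using has_derivative_linear[OF smooth_has_derivative[OF assms]] .
  then have "dir_deriv h f t = dir_deriv 1 f t * h" for h
    using linear_cmul[of "\<lambda>h. dir_deriv h f t" h 1] by (simp add: mult.commute)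
  then have "(\<lambda>h. dir_deriv h f t) = (\<lambda>h. dir_deriv 1 f t * h)" by (rule ext)
  then show ?thesis
    using smooth_has_derivative[OF assms, of t] by (simp add: has_field_derivative_def)
qed

lemma smooth_step_deriv_eq_0:
  assumes "t < 0 \<or> 1 < t"
  shows "dir_deriv 1 smooth_step t = 0"
proof -
  let ?c = "if t < 0 then 0 else 1 :: real" and ?S = "if t < 0 then {..<0} else {1<..} :: real set"
  have "((\<lambda>_. ?c) has_derivative (\<lambda>_. 0)) (at t)" by simp
  then have "(smooth_step has_derivative (\<lambda>_. 0)) (at t)"
    by (rule has_derivative_transform_within_open[where s="?S"])
      (use assms in \<open>auto simp: smooth_step_0 smooth_step_1\<close>)
  then show ?thesis by (rule dir_deriv_eq)
qed

text \<open>The rescaled derivatives of \<open>smooth_step\<close> form an approximate identity at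
  \<open>c\<close>, supported to its right. The offset \<open>R\<close> keeps the support in [0, T]
  for every n, including n = 0.\<close>

lemma smooth_step_deriv_tendsto:
  fixes W :: "real \<Rightarrow> real"
  assumes W: "continuous_on {0..T} W" and c: "0 < c" "c < T" and R: "0 < R" "1 / R < T - c"
  shows "(\<lambda>n. LBINT t:{0..T}. (real n + R) * dir_deriv 1 smooth_step ((real n + R) * (t - c)) * W t) \<longlonglongrightarrow> W c"
proof -
  define p where "p = dir_deriv 1 smooth_step"
  have pc: "continuous_on A p" for A
    unfolding p_def by (intro smooth_imp_continuous smooth_dir_deriv smooth_smooth_step)
  have p0: "p s = 0" if "s \<notin> {0..1}" for s
    using smooth_step_deriv_eq_0[of s] that by (auto simp: p_def)
  have [measurable]: "p \<in> borel_measurable borel" by (rule borel_measurable_continuous_onI[OF pc])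
  have Wm: "(\<lambda>t. indicator {0..T} t *\<^sub>R W t) \<in> borel_measurable borel"
    by (rule borel_measurable_continuous_on_indicator[OF _ W]) simp
  have "bounded (W ` {0..T})" "bounded (p ` {0..1})"
    by (intro compact_imp_bounded compact_continuous_image W pc compact_Icc)+
  then obtain B B' where BB: "\<forall>x\<in>W ` {0..T}. norm x \<le> B" "\<forall>x\<in>p ` {0..1}. norm x \<le> B'"
    unfolding bounded_iff by blast
  have B: "\<bar>W t\<bar> \<le> B" if "t \<in> {0..T}" for t using BB(1) that by auto
  have B': "\<bar>p t\<bar> \<le> B'" if "t \<in> {0..1}" for t using BB(2) that by auto
  have in_T: "c + s / (real n + R) \<in> {0..T}" if "s \<in> {0..1}" for s n
  proof -
    have "s / (real n + R) \<le> 1 / R" using that R by (intro frac_le) auto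
    moreover have "0 \<le> s / (real n + R)" using that R by simp
    ultimately show ?thesis using c R by auto
  qed
  have eq: "(LBINT t:{0..T}. (real n + R) * p ((real n + R) * (t - c)) * W t)
      = (\<integral>s. p s * (indicator {0..T} (c + s / (real n + R)) *\<^sub>R W (c + s / (real n + R))) \<partial>lborel)" for n
  proof -
    define r where "r = real n + R"
    have r: "0 < r" using R by (simp add: r_def)
    have "(LBINT t:{0..T}. r * p (r * (t - c)) * W t) = (\<integral>t. r * p (r * (t - c)) * (indicator {0..T} t *\<^sub>R W t) \<partial>lborel)"
      unfolding set_lebesgue_integral_def by (simp add: mult_ac)
    also have "\<dots> = \<bar>1 / r\<bar> *\<^sub>R (\<integral>s. r * p (r * ((c + 1 / r * s) - c)) * (indicator {0..T} (c + 1 / r * s) *\<^sub>R W (c + 1 / r * s)) \<partial>lborel)"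
      using r by (intro lborel_integral_real_affine) auto
    also have "\<dots> = (\<integral>s. p s * (indicator {0..T} (c + s / r) *\<^sub>R W (c + s / r)) \<partial>lborel)"
      using r by (simp add: mult.assoc flip: integral_mult_right_zero)
    finally show ?thesis by (simp add: r_def)
  qed
  \<comment> \<open>After the substitution s = (n + R) (t - c) the weight \<open>p\<close> is
    independent of n and lives on [0, 1]; only the argument of \<open>W\<close> moves.\<close>
  have lim: "(\<lambda>n. \<integral>s. p s * (indicator {0..T} (c + s / (real n + R)) *\<^sub>R W (c + s / (real n + R))) \<partial>lborel)
      \<longlonglongrightarrow> (\<integral>s. p s * W c \<partial>lborel)"
  proof (rule integral_dominated_convergence[where w="\<lambda>s. B' * B * indicator {0..1} s"])
    show "integrable lborel (\<lambda>s::real. B' * B * indicator {0..1} s)"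
      by (intro integrable_mult_right integrable_real_indicator) (simp_all add: emeasure_lborel_Icc_eq)
    show "AE s in lborel. (\<lambda>n. p s * (indicator {0..T} (c + s / (real n + R)) *\<^sub>R W (c + s / (real n + R)))) \<longlonglongrightarrow> p s * W c"
    proof (rule AE_I2)
      fix s
      show "(\<lambda>n. p s * (indicator {0..T} (c + s / (real n + R)) *\<^sub>R W (c + s / (real n + R)))) \<longlonglongrightarrow> p s * W c"
      proof (cases "s \<in> {0..1}")
        case True
        have "filterlim (\<lambda>n. real n + R) at_top sequentially"
          by (subst add.commute) (rule filterlim_tendsto_add_at_top[OF tendsto_const filterlim_real_sequentially])
        then have "(\<lambda>n. c + s / (real n + R)) \<longlonglongrightarrow> c + 0"
          by (intro tendsto_add tendsto_const tendsto_divide_0[OF tendsto_const] filterlim_at_top_imp_at_infinity)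
        then have "(\<lambda>n. W (c + s / (real n + R))) \<longlonglongrightarrow> W c"
          using continuous_on_tendsto_compose[OF W, of "\<lambda>n. c + s / (real n + R)" c] in_T[OF True] c by simp
        then show ?thesis
          using in_T[OF True] by (auto intro!: tendsto_intros)
      qed (simp add: p0)
    qed
    fix n
    show "AE s in lborel. norm (p s * (indicator {0..T} (c + s / (real n + R)) *\<^sub>R W (c + s / (real n + R)))) \<le> B' * B * indicator {0..1} s"
    proof (rule AE_I2)
      fix s
      show "norm (p s * (indicator {0..T} (c + s / (real n + R)) *\<^sub>R W (c + s / (real n + R)))) \<le> B' * B * indicator {0..1} s"
      proof (cases "s \<in> {0..1}")
        case True
        then show ?thesis
          using B[OF in_T[OF True, of n]] B'[OF True] in_T[OF True, of n]
          by (auto simp: abs_mult intro!: mult_mono intro: order_trans[OF abs_ge_zero])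
      qed (simp add: p0)
    qed
    show "(\<lambda>s. p s * (indicator {0..T} (c + s / (real n + R)) *\<^sub>R W (c + s / (real n + R)))) \<in> borel_measurable lborel"
      using measurable_compose[OF _ Wm, of "\<lambda>s. c + s / (real n + R)" borel] by simp
  qed simp
  \<comment> \<open>The mass of the weight is the increment of \<open>smooth_step\<close> over
    [0, 1], namely 1.\<close>
  have "(\<integral>s. p s \<partial>lborel) = (LBINT s:{0..1}. p s)"
    unfolding set_lebesgue_integral_def
    by (intro Bochner_Integration.integral_cong refl) (use p0 in \<open>auto split: split_indicator\<close>)
  also have "\<dots> = smooth_step 1 - smooth_step 0"
    unfolding set_lebesgue_integral_def
    by (rule integral_FTC_Icc) (auto simp: p_def intro!: has_real_derivative_smooth[OF smooth_smooth_step, THEN has_field_derivative_at_within, unfolded has_real_derivative_iff_has_vector_derivative] pc[unfolded p_def])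
  also have "\<dots> = 1" by (simp add: smooth_step_0 smooth_step_1)
  finally have "(\<integral>s. p s * W c \<partial>lborel) = W c" by simp
  with lim show ?thesis unfolding p_def[symmetric] eq by (simp only:)
qed

text \<open>Differences of two steep smooth steps approximate the indicator of [a, b], and their
  derivatives approximate point masses of opposite signs at \<open>a\<close> and \<open>b\<close>.
  Dominated convergence handles \<open>N\<close>, which is merely integrable.\<close>

lemma weak_time_derivative:
  fixes W N :: "real \<Rightarrow> real"
  assumes W: "continuous_on {0..T} W" and N: "set_integrable lborel {0..T} N"
    and weak: "\<And>\<theta>. smooth \<theta> \<Longrightarrow> \<exists>a b. 0 < a \<and> b < T \<and> (\<forall>t. t \<notin> {a..b} \<longrightarrow> \<theta> t = 0) \<Longrightarrow>
      (LBINT t:{0..T}. dir_deriv 1 \<theta> t * W t + \<theta> t * N t) = 0"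
    and ab: "0 < a" "a < b" "b < T"
  shows "W b - W a = (LBINT t:{a..b}. N t)"
proof -
  \<comment> \<open>With this choice the step at \<open>b\<close> is complete by the midpoint of
    \<open>b\<close> and \<open>T\<close>, so every cut-off has its support inside (0, T).\<close>
  define R where "R = 2 / (T - b)"
  have "1 / R = (T - b) / 2" by (simp add: R_def)
  then have R: "0 < R" "1 / R < T - b" "1 / R < T - a" using ab by (simp_all add: R_def)
  define r where "r n = real n + R" for n
  have r: "0 < r n" "1 / r n \<le> 1 / R" for n using R by (auto simp: r_def intro: frac_le)
  define \<theta> where "\<theta> n t = smooth_step (r n * (t - a)) - smooth_step (r n * (t - b))" for n t
  define p where "p = dir_deriv 1 smooth_step"
  have sm1: "smooth (\<lambda>t. smooth_step (r n * (t - c)))" for n c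
    by (intro smooth_compose[OF smooth_smooth_step] smooth_mult smooth_diff smooth_const smooth_ident)
  have sm: "smooth (\<theta> n)" for n
    unfolding \<theta>_def by (intro smooth_diff sm1)
  have D\<theta>: "dir_deriv 1 (\<theta> n) t = r n * p (r n * (t - a)) - r n * p (r n * (t - b))" for n t
  proof -
    have "((\<lambda>t. smooth_step (r n * (t - c))) has_real_derivative p (r n * (t - c)) * r n) (at t)" for c
      unfolding p_def by (rule DERIV_chain2[OF has_real_derivative_smooth[OF smooth_smooth_step]])
        (auto intro!: derivative_eq_intros)
    then have "(\<theta> n has_real_derivative p (r n * (t - a)) * r n - p (r n * (t - b)) * r n) (at t)"
      unfolding \<theta>_def by (intro DERIV_diff)
    from DERIV_unique[OF has_real_derivative_smooth[OF sm] this] show ?thesis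
      by (simp add: mult.commute)
  qed
  have supp: "\<theta> n t = 0" if "t \<notin> {a..b + 1 / R}" for n t
  proof (cases "t < a")
    case True
    then have "r n * (t - a) \<le> 0" "r n * (t - b) \<le> 0"
      using r(1)[of n] ab by (auto intro!: mult_nonneg_nonpos)
    then show ?thesis by (simp add: \<theta>_def smooth_step_0)
  next
    case False
    then have t: "1 / r n \<le> t - b" using that r(2)[of n] by auto
    then have "1 \<le> r n * (t - b)" using r(1)[of n] by (simp add: field_simps)
    moreover have "r n * (t - b) \<le> r n * (t - a)" using r(1)[of n] ab by (intro mult_left_mono) auto
    ultimately show ?thesis by (simp add: \<theta>_def smooth_step_1)
  qed
  have \<theta>_le: "\<bar>\<theta> n t\<bar> \<le> 1" for n t
    using smooth_step_bounds[of "r n * (t - a)"] smooth_step_bounds[of "r n * (t - b)"] by (auto simp: \<theta>_def)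
  have pc: "continuous_on A p" for A
    unfolding p_def by (intro smooth_imp_continuous smooth_dir_deriv smooth_smooth_step)
  have intW: "set_integrable lborel {0..T} (\<lambda>t. r n * p (r n * (t - c)) * W t)" for n c
    unfolding set_integrable_def
    by (rule borel_integrable_compact) (auto intro!: continuous_intros W continuous_on_compose2[OF pc[of UNIV]])
  have [measurable]: "\<theta> n \<in> borel_measurable borel" for n
    by (rule borel_measurable_continuous_onI[OF smooth_imp_continuous[OF sm]])
  have intN: "integrable lborel (\<lambda>t. indicator {0..T} t *\<^sub>R N t)" using N by (simp add: set_integrable_def)
  note [measurable] = borel_measurable_integrable[OF intN]
  have meas: "(\<lambda>t. \<theta> n t * (indicator {0..T} t *\<^sub>R N t)) \<in> borel_measurable lborel" for n
    by measurable
  have intN': "set_integrable lborel {0..T} (\<lambda>t. \<theta> n t * N t)" for n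
  proof -
    have "integrable lborel (\<lambda>t. \<theta> n t * (indicator {0..T} t *\<^sub>R N t))"
      by (rule Bochner_Integration.integrable_bound[OF intN meas])
        (auto simp: abs_mult intro!: AE_I2 mult_left_le_one_le \<theta>_le mult_right_le_one_le)
    then show ?thesis by (simp add: set_integrable_def mult_ac)
  qed
  have zero: "(LBINT t:{0..T}. r n * p (r n * (t - a)) * W t) - (LBINT t:{0..T}. r n * p (r n * (t - b)) * W t)
      + (LBINT t:{0..T}. \<theta> n t * N t) = 0" for n
  proof -
    have "0 = (LBINT t:{0..T}. dir_deriv 1 (\<theta> n) t * W t + \<theta> n t * N t)"
      using weak[OF sm, of n] supp[of _ n] ab R by (metis add_diff_cancel_left' diff_less_eq add.commute less_diff_eq)
    also have "\<dots> = (LBINT t:{0..T}. (r n * p (r n * (t - a)) * W t - r n * p (r n * (t - b)) * W t) + \<theta> n t * N t)"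
      by (simp add: D\<theta> left_diff_distrib)
    also have "\<dots> = (LBINT t:{0..T}. r n * p (r n * (t - a)) * W t) - (LBINT t:{0..T}. r n * p (r n * (t - b)) * W t)
      + (LBINT t:{0..T}. \<theta> n t * N t)"
      by (simp add: intW intN' set_integral_add set_integral_diff)
    finally show ?thesis by simp
  qed
  have limN: "(\<lambda>n. LBINT t:{0..T}. \<theta> n t * N t) \<longlonglongrightarrow> (LBINT t:{a..b}. N t)"
    unfolding set_lebesgue_integral_def
  proof (rule integral_dominated_convergence[where w="\<lambda>t. norm (indicator {0..T} t *\<^sub>R N t)"])
    show "integrable lborel (\<lambda>t. norm (indicator {0..T} t *\<^sub>R N t))" by (rule integrable_norm[OF intN])
    have "{a..b} \<subseteq> {0..T}" using ab by auto
    then have "set_integrable lborel {a..b} N" by (rule set_integrable_subset[OF N, rotated]) simp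
    then show "(\<lambda>t. indicator {a..b} t *\<^sub>R N t) \<in> borel_measurable lborel"
      unfolding set_integrable_def by (rule borel_measurable_integrable)
    show "(\<lambda>t. indicator {0..T} t *\<^sub>R (\<theta> n t * N t)) \<in> borel_measurable lborel" for n
      using meas[of n] by (simp add: mult_ac)
    show "AE t in lborel. norm (indicator {0..T} t *\<^sub>R (\<theta> n t * N t)) \<le> norm (indicator {0..T} t *\<^sub>R N t)" for n
      using \<theta>_le by (auto simp: abs_mult intro!: AE_I2 mult_left_mono mult_left_le_one_le)
    show "AE t in lborel. (\<lambda>n. indicator {0..T} t *\<^sub>R (\<theta> n t * N t)) \<longlonglongrightarrow> indicator {a..b} t *\<^sub>R N t"
      \<comment> \<open>At t = a every cut-off is 0 while the indicator is 1, so this point is left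
        out.\<close>
      using AE_lborel_singleton[of a]
    proof eventually_elim
      case (elim t)
      have step: "\<forall>\<^sub>F n in sequentially. smooth_step (r n * (t - c)) = 1" if "c < t" for c
      proof -
        obtain m where m: "1 / (t - c) < real m" using reals_Archimedean2 by blast
        have "smooth_step (r n * (t - c)) = 1" if "m \<le> n" for n
        proof (rule smooth_step_1)
          have "1 / (t - c) \<le> r n" using m that R by (simp add: r_def)
          then show "1 \<le> r n * (t - c)" using \<open>c < t\<close> by (simp add: divide_le_eq)
        qed
        then show ?thesis unfolding eventually_sequentially by blast
      qed
      have step0: "smooth_step (r n * (t - c)) = 0" if "t \<le> c" for n c
        using that r(1)[of n] by (intro smooth_step_0 mult_nonneg_nonpos) auto
      have "\<forall>\<^sub>F n in sequentially. \<theta> n t = indicator {a..b} t"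
      proof -
        consider "t < a" | "a < t" "t \<le> b" | "b < t" using elim by linarith
        then show ?thesis
        proof cases
          case 1
          then show ?thesis using ab by (simp add: \<theta>_def step0)
        next
          case 2
          then show ?thesis using step[of a] by (auto simp: \<theta>_def step0 elim: eventually_mono)
        next
          case 3
          then have "\<forall>\<^sub>F n in sequentially. smooth_step (r n * (t - a)) = 1 \<and> smooth_step (r n * (t - b)) = 1"
            using ab by (intro eventually_conj step) auto
          then show ?thesis by (rule eventually_mono) (use 3 in \<open>simp add: \<theta>_def\<close>)
        qed
      qed
      then have "(\<lambda>n. \<theta> n t) \<longlonglongrightarrow> indicator {a..b} t" by (rule tendsto_eventually)
      then have "(\<lambda>n. indicator {0..T} t *\<^sub>R (\<theta> n t * N t)) \<longlonglongrightarrow> indicator {0..T} t *\<^sub>R (indicator {a..b} t * N t)"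
        by (intro tendsto_intros)
      also have "indicator {0..T} t *\<^sub>R (indicator {a..b} t * N t) = indicator {a..b} t *\<^sub>R N t"
        using ab by (auto split: split_indicator)
      finally show ?case .
    qed
  qed
  have "(\<lambda>n. (LBINT t:{0..T}. r n * p (r n * (t - a)) * W t) - (LBINT t:{0..T}. r n * p (r n * (t - b)) * W t)
      + (LBINT t:{0..T}. \<theta> n t * N t)) \<longlonglongrightarrow> W a - W b + (LBINT t:{a..b}. N t)"
    unfolding r_def p_def
    using smooth_step_deriv_tendsto[OF W, of a R] smooth_step_deriv_tendsto[OF W, of b R] limN ab R
    by (intro tendsto_intros) auto
  then have "W a - W b + (LBINT t:{a..b}. N t) = 0"
    unfolding zero by (simp add: LIMSEQ_const_iff)
  then show ?thesis by simp
qed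

subsection \<open>Square integrable fields\<close>

definition torus_L2 :: "(real ^ 'd \<Rightarrow> real ^ 3) \<Rightarrow> bool" where
  "torus_L2 f \<longleftrightarrow> f \<in> borel_measurable borel \<and> periodic f \<and> integrable torus (\<lambda>x. (norm (f x))\<^sup>2)"

lemma norm_add_square_le: "(norm (a + b :: 'a::real_normed_vector))\<^sup>2 \<le> 2 * (norm a)\<^sup>2 + 2 * (norm b)\<^sup>2"
proof -
  have "(norm (a + b))\<^sup>2 \<le> (norm a + norm b)\<^sup>2" by (intro power_mono norm_triangle_ineq) auto
  also have "\<dots> \<le> 2 * (norm a)\<^sup>2 + 2 * (norm b)\<^sup>2"
    using zero_le_power2[of "norm a - norm b"] unfolding power2_diff power2_sum by linarith
  finally show ?thesis .
qed

lemma torus_L2_diff: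
  assumes "torus_L2 f" "torus_L2 g"
  shows "torus_L2 (\<lambda>x. f x - g x)"
proof -
  have [measurable]: "f \<in> borel_measurable borel" "g \<in> borel_measurable borel"
    using assms by (auto simp: torus_L2_def)
  have "integrable torus (\<lambda>x. (norm (f x - g x))\<^sup>2)"
    by (rule Bochner_Integration.integrable_bound[of torus "\<lambda>x. 2 * (norm (f x))\<^sup>2 + 2 * (norm (g x))\<^sup>2"])
      (use assms norm_add_square_le[of "f _" "- g _"] in \<open>auto simp: torus_L2_def\<close>)
  then show ?thesis using assms by (auto simp: torus_L2_def periodic_def)
qed

lemma le_add_square_divide:
  fixes s \<delta> :: real
  assumes "0 < \<delta>"
  shows "s \<le> \<delta> + s\<^sup>2 / \<delta>"
proof -
  have "0 \<le> (2 * \<delta> - s)\<^sup>2 + 3 * s\<^sup>2" by simp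
  then have "s * \<delta> \<le> \<delta>\<^sup>2 + s\<^sup>2" by (simp add: power2_eq_square algebra_simps)
  then show ?thesis using assms by (simp add: field_simps power2_eq_square)
qed

lemma torus_L2_L1:
  assumes "torus_L2 f"
  shows "torus_L1 f"
proof -
  have "integrable torus f"
    by (rule Bochner_Integration.integrable_bound[of torus "\<lambda>x. 1 + (norm (f x))\<^sup>2"])
      (use assms le_add_square_divide[of 1 "norm (f _)"] in \<open>auto simp: torus_L2_def\<close>)
  then show ?thesis using assms by (simp add: torus_L1_def torus_L2_def)
qed

lemma torus_L2_mult:
  assumes f: "torus_L2 f" and g: "torus_L2 g"
  shows "torus_L1 (\<lambda>x. f x $ i * g x $ j)"
proof -
  have [measurable]: "(\<lambda>x. f x $ i) \<in> borel_measurable borel" "(\<lambda>x. g x $ j) \<in> borel_measurable borel"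
    using torus_L1_measurable[OF torus_L1_vec_nth[OF torus_L2_L1[OF f]]]
      torus_L1_measurable[OF torus_L1_vec_nth[OF torus_L2_L1[OF g]]] by auto
  have le: "norm (f x $ i * g x $ j) \<le> norm ((norm (f x))\<^sup>2 + (norm (g x))\<^sup>2)" for x
  proof -
    have "norm (f x $ i * g x $ j) \<le> norm (f x) * norm (g x)"
      unfolding norm_mult by (intro mult_mono) (use component_le_norm_cart in auto)
    also have "\<dots> \<le> (norm (f x))\<^sup>2 + (norm (g x))\<^sup>2"
      using sum_squares_bound[of "norm (f x)" "norm (g x)"]
        mult_nonneg_nonneg[OF norm_ge_zero norm_ge_zero, of "f x" "g x"] by linarith
    finally show ?thesis by simp
  qed
  have "integrable torus (\<lambda>x. f x $ i * g x $ j)"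
    by (rule Bochner_Integration.integrable_bound[of torus "\<lambda>x. (norm (f x))\<^sup>2 + (norm (g x))\<^sup>2"])
      (use f g le in \<open>auto simp: torus_L2_def\<close>)
  then show ?thesis using f g by (auto simp: torus_L1_def torus_L2_def periodic_def)
qed

text \<open>Young's inequality with weight \<delta> on the cross term. The part that does not shrink
  with a - b carries the factor \<delta>, which is fixed before a - b is made small.\<close>

lemma square_diff_le:
  fixes a b :: "'a::real_inner"
  assumes \<delta>: "0 < \<delta>"
  shows "\<bar>(norm a)\<^sup>2 - (norm b)\<^sup>2\<bar> \<le> \<delta> * (norm b)\<^sup>2 + (1 + 1 / \<delta>) * (norm (a - b))\<^sup>2"
proof -
  define d where "d = a - b"
  have a: "a = b + d" by (simp add: d_def)
  have "(norm a)\<^sup>2 - (norm b)\<^sup>2 = 2 * (b \<bullet> d) + (norm d)\<^sup>2"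
    by (simp add: a power2_norm_eq_inner inner_add_left inner_add_right inner_commute)
  moreover have "\<bar>2 * (b \<bullet> d)\<bar> \<le> \<delta> * (norm b)\<^sup>2 + (norm d)\<^sup>2 / \<delta>"
  proof -
    have "0 \<le> (\<delta> * norm b - norm d)\<^sup>2" by simp
    then have "2 * (norm b * norm d) * \<delta> \<le> (\<delta> * (norm b)\<^sup>2 + (norm d)\<^sup>2 / \<delta>) * \<delta>"
      using \<delta> by (simp add: power2_eq_square algebra_simps)
    then have "2 * (norm b * norm d) \<le> \<delta> * (norm b)\<^sup>2 + (norm d)\<^sup>2 / \<delta>"
      using \<delta> by (simp only: mult_le_cancel_right_pos)
    moreover have "\<bar>b \<bullet> d\<bar> \<le> norm b * norm d" by (rule Cauchy_Schwarz_ineq2)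
    ultimately show ?thesis by linarith
  qed
  moreover have "0 \<le> (norm d)\<^sup>2 / \<delta>" "0 \<le> \<delta> * (norm b)\<^sup>2" "0 \<le> (norm d)\<^sup>2" using \<delta> by auto
  ultimately have "\<bar>(norm a)\<^sup>2 - (norm b)\<^sup>2\<bar> \<le> \<delta> * (norm b)\<^sup>2 + ((norm d)\<^sup>2 + (norm d)\<^sup>2 / \<delta>)"
    by linarith
  then show ?thesis by (simp add: d_def distrib_right)
qed

lemma L2_norm_diff_le:
  assumes f: "torus_L2 f" and g: "torus_L2 g" and \<delta>: "0 < \<delta>"
  shows "\<bar>(\<integral>x. (norm (f x))\<^sup>2 \<partial>torus) - (\<integral>x. (norm (g x))\<^sup>2 \<partial>torus)\<bar>
    \<le> \<delta> * (\<integral>x. (norm (g x))\<^sup>2 \<partial>torus) + (1 + 1 / \<delta>) * (\<integral>x. (norm (f x - g x))\<^sup>2 \<partial>torus)"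
proof -
  have int: "integrable torus (\<lambda>x. (norm (f x))\<^sup>2)" "integrable torus (\<lambda>x. (norm (g x))\<^sup>2)"
    "integrable torus (\<lambda>x. (norm (f x - g x))\<^sup>2)"
    using f g torus_L2_diff[OF f g] by (auto simp: torus_L2_def)
  have "\<bar>(\<integral>x. (norm (f x))\<^sup>2 \<partial>torus) - (\<integral>x. (norm (g x))\<^sup>2 \<partial>torus)\<bar> = \<bar>\<integral>x. (norm (f x))\<^sup>2 - (norm (g x))\<^sup>2 \<partial>torus\<bar>"
    using int by simp
  also have "\<dots> \<le> (\<integral>x. \<bar>(norm (f x))\<^sup>2 - (norm (g x))\<^sup>2\<bar> \<partial>torus)" by (rule integral_abs_bound)
  also have "\<dots> \<le> (\<integral>x. \<delta> * (norm (g x))\<^sup>2 + (1 + 1 / \<delta>) * (norm (f x - g x))\<^sup>2 \<partial>torus)"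
    using int by (intro integral_mono square_diff_le \<delta>) auto
  finally show ?thesis using int by simp
qed

text \<open>The free weight replaces Cauchy-Schwarz: once the integral of the square is below
  \<delta>^2, the L^1 norm is below 2 * \<delta>.\<close>

lemma L1_le_L2:
  assumes f: "torus_L2 f" and \<delta>: "0 < \<delta>"
  shows "(\<integral>x. norm (f x) \<partial>torus) \<le> \<delta> + (\<integral>x. (norm (f x))\<^sup>2 \<partial>torus) / \<delta>"
proof -
  have int: "integrable torus (\<lambda>x. (norm (f x))\<^sup>2)" using f by (simp add: torus_L2_def)
  have "(\<integral>x. norm (f x) \<partial>torus) \<le> (\<integral>x. \<delta> + (norm (f x))\<^sup>2 / \<delta> \<partial>torus)"
    using int torus_L1_integrable[OF torus_L2_L1[OF f]]
    by (intro integral_mono le_add_square_divide \<delta>) auto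
  then show ?thesis using int by simp
qed

lemma L2_norm_tendsto:
  assumes L2: "\<And>t. torus_L2 (v t)"
    and lim: "((\<lambda>t. \<integral>x. (norm (v t x - v s x))\<^sup>2 \<partial>torus) \<longlongrightarrow> 0) F"
  shows "((\<lambda>t. \<integral>x. (norm (v t x))\<^sup>2 \<partial>torus) \<longlongrightarrow> (\<integral>x. (norm (v s x))\<^sup>2 \<partial>torus)) F"
  unfolding tendsto_iff
proof (intro allI impI)
  fix e :: real assume e: "0 < e"
  define N where "N = (\<integral>x. (norm (v s x))\<^sup>2 \<partial>torus)"
  have N: "0 \<le> N" unfolding N_def by (rule Bochner_Integration.integral_nonneg) simp
  \<comment> \<open>Half of \<open>e\<close> pays for the term \<delta> * N; the added 1 covers N =
    0.\<close>
  define \<delta> where "\<delta> = e / 2 / (N + 1)"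
  have \<delta>: "0 < \<delta>" using e N by (simp add: \<delta>_def)
  have \<delta>N: "\<delta> * N \<le> e / 2"
  proof -
    have "\<delta> * N \<le> \<delta> * (N + 1)" using \<delta> by (intro mult_left_mono) auto
    also have "\<dots> = e / 2" using nonzero_eq_divide_eq[of "N + 1" \<delta> "e / 2"] N \<delta>_def by simp
    finally show ?thesis .
  qed
  define c where "c = 1 + 1 / \<delta>"
  have p: "0 < c" using \<delta> unfolding c_def by (intro add_pos_pos) auto
  have "0 < e / (2 * c)" using e p by simp
  then have "\<forall>\<^sub>F t in F. dist (\<integral>x. (norm (v t x - v s x))\<^sup>2 \<partial>torus) 0 < e / (2 * c)"
    using lim unfolding tendsto_iff by blast
  then show "\<forall>\<^sub>F t in F. dist (\<integral>x. (norm (v t x))\<^sup>2 \<partial>torus) (\<integral>x. (norm (v s x))\<^sup>2 \<partial>torus) < e"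
  proof eventually_elim
    case (elim t)
    have "(\<integral>x. (norm (v t x - v s x))\<^sup>2 \<partial>torus) < e / (2 * c)" using elim by simp
    then have "c * (\<integral>x. (norm (v t x - v s x))\<^sup>2 \<partial>torus) < c * (e / (2 * c))"
      using p by (rule mult_strict_left_mono)
    also have "\<dots> = e / 2" using p by simp
    finally show ?case
      using L2_norm_diff_le[OF L2[of t] L2[of s] \<delta>] \<delta>N unfolding dist_real_def N_def c_def by linarith
  qed
qed

lemma L1_norm_tendsto:
  assumes L2: "\<And>t. torus_L2 (v t)"
    and lim: "((\<lambda>t. \<integral>x. (norm (v t x - v s x))\<^sup>2 \<partial>torus) \<longlongrightarrow> 0) F"
  shows "((\<lambda>t. \<integral>x. norm (v t x - v s x) \<partial>torus) \<longlongrightarrow> 0) F"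
  unfolding tendsto_iff
proof (intro allI impI)
  fix e :: real assume e: "0 < e"
  then have "0 < e / 2 * (e / 2)" by simp
  then have "\<forall>\<^sub>F t in F. dist (\<integral>x. (norm (v t x - v s x))\<^sup>2 \<partial>torus) 0 < e / 2 * (e / 2)"
    using lim unfolding tendsto_iff by blast
  then show "\<forall>\<^sub>F t in F. dist (\<integral>x. norm (v t x - v s x) \<partial>torus) 0 < e"
  proof eventually_elim
    case (elim t)
    have "0 \<le> (\<integral>x. norm (v t x - v s x) \<partial>torus)"
      by (rule Bochner_Integration.integral_nonneg) simp
    moreover have "(\<integral>x. norm (v t x - v s x) \<partial>torus) \<le> e / 2 + (\<integral>x. (norm (v t x - v s x))\<^sup>2 \<partial>torus) / (e / 2)"
      by (rule L1_le_L2[OF torus_L2_diff[OF L2 L2]]) (use e in simp)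
    moreover have "(\<integral>x. (norm (v t x - v s x))\<^sup>2 \<partial>torus) / (e / 2) < e / 2"
      using elim e by (subst pos_divide_less_eq) auto
    ultimately show ?case by simp
  qed
qed

section \<open>Pairings and fluxes of square integrable fields with smooth test fields\<close>

lemma norm_integral_inner_le:
  assumes v: "torus_L1 v" and \<psi>: "continuous_on UNIV \<psi>" "\<And>x. norm (\<psi> x) \<le> P"
  shows "integrable torus (\<lambda>x. \<psi> x \<bullet> v x)"
    and "\<bar>\<integral>x. \<psi> x \<bullet> v x \<partial>torus\<bar> \<le> P * (\<integral>x. norm (v x) \<partial>torus)"
proof -
  note [measurable] = borel_measurable_continuous_onI[OF \<psi>(1)] torus_L1_measurable[OF v]
  have le: "\<bar>\<psi> x \<bullet> v x\<bar> \<le> P * norm (v x)" for x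
    using order_trans[OF Cauchy_Schwarz_ineq2 mult_right_mono[OF \<psi>(2) norm_ge_zero]] .
  have int: "integrable torus (\<lambda>x. P * norm (v x))"
    by (intro integrable_mult_right integrable_norm torus_L1_integrable v)
  show I: "integrable torus (\<lambda>x. \<psi> x \<bullet> v x)"
    by (rule Bochner_Integration.integrable_bound[OF int])
      (auto intro!: AE_I2 order_trans[OF le abs_ge_self])
  have "\<bar>\<integral>x. \<psi> x \<bullet> v x \<partial>torus\<bar> \<le> (\<integral>x. \<bar>\<psi> x \<bullet> v x\<bar> \<partial>torus)" by (rule integral_abs_bound)
  also have "\<dots> \<le> (\<integral>x. P * norm (v x) \<partial>torus)"
    by (rule integral_mono[OF integrable_abs[OF I] int le])
  finally show "\<bar>\<integral>x. \<psi> x \<bullet> v x \<partial>torus\<bar> \<le> P * (\<integral>x. norm (v x) \<partial>torus)" by simp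
qed

lemma component_products_le:
  fixes a b :: "real ^ 3"
  shows "\<bar>a $ i * a $ k - b $ i * b $ k\<bar> \<le> (norm a)\<^sup>2 + (norm b)\<^sup>2"
    and "\<bar>b $ i * a $ k - a $ i * b $ k\<bar> \<le> (norm a)\<^sup>2 + (norm b)\<^sup>2"
    and "\<bar>b $ i * b $ k\<bar> \<le> (norm a)\<^sup>2 + (norm b)\<^sup>2"
proof -
  have le: "\<bar>v $ i * w $ k\<bar> \<le> norm v * norm w" for v w :: "real ^ 3" and i k
    unfolding abs_mult by (intro mult_mono component_le_norm_cart) auto
  show "\<bar>a $ i * a $ k - b $ i * b $ k\<bar> \<le> (norm a)\<^sup>2 + (norm b)\<^sup>2"
    using le[of a i a k] le[of b i b k] abs_triangle_ineq4[of "a $ i * a $ k" "b $ i * b $ k"]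
    by (simp add: power2_eq_square)
  show "\<bar>b $ i * b $ k\<bar> \<le> (norm a)\<^sup>2 + (norm b)\<^sup>2"
    using le[of b i b k] zero_le_power2[of "norm a"] unfolding power2_eq_square by linarith
  have "2 * (norm a * norm b) \<le> (norm a)\<^sup>2 + (norm b)\<^sup>2"
    using sum_squares_bound[of "norm a" "norm b"] by (simp add: mult.assoc)
  then show "\<bar>b $ i * a $ k - a $ i * b $ k\<bar> \<le> (norm a)\<^sup>2 + (norm b)\<^sup>2"
    using le[of b i a k] le[of a i b k] abs_triangle_ineq4[of "b $ i * a $ k" "a $ i * b $ k"]
    by (simp add: mult.commute)
qed

context
  fixes \<iota> :: "'d::finite \<Rightarrow> 3" and u h :: "real ^ 'd \<Rightarrow> real ^ 3"
  assumes u: "torus_L2 u" and h: "torus_L2 h"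
begin

lemma flux_terms_integrable:
  fixes g :: "real ^ 'd \<Rightarrow> real"
  assumes g: "smooth g" "periodic g"
  shows "integrable torus (\<lambda>x. g x * (u x $ i * u x $ k - h x $ i * h x $ k))"
    and "integrable torus (\<lambda>x. g x * (h x $ i * u x $ k - u x $ i * h x $ k))"
    and "integrable torus (\<lambda>x. h x $ i * h x $ k * g x)"
proof -
  have int: "integrable torus (\<lambda>x. g x * (f x $ i * f' x $ k))" if "torus_L2 f" "torus_L2 f'" for f f' i k
    using integrable_mult_smooth_periodic[OF torus_L2_mult[OF that] g] by (simp add: mult.commute)
  show "integrable torus (\<lambda>x. g x * (u x $ i * u x $ k - h x $ i * h x $ k))"
    "integrable torus (\<lambda>x. g x * (h x $ i * u x $ k - u x $ i * h x $ k))"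
    unfolding right_diff_distrib by (intro Bochner_Integration.integrable_diff int u h)+
  show "integrable torus (\<lambda>x. h x $ i * h x $ k * g x)"
    using int[OF h h] by (simp add: mult.commute)
qed

context
  fixes \<psi> :: "real ^ 'd \<Rightarrow> real ^ 3"
  assumes \<psi>: "smooth \<psi>" "periodic \<psi>"
begin

lemma momentum_integrable:
  "integrable torus (\<lambda>x. \<Sum>i\<in>UNIV. \<Sum>k\<in>UNIV.
     partial \<iota> k \<psi> x $ i * (u x $ i * u x $ k - h x $ i * h x $ k))"
  by (intro Bochner_Integration.integrable_sum flux_terms_integrable smooth_vec_nth periodic_vec_nth
      smooth_partial periodic_partial \<psi>)

lemma induction_integrable:
  "integrable torus (\<lambda>x. \<Sum>i\<in>UNIV. \<Sum>k\<in>UNIV.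
     partial \<iota> k \<psi> x $ i * (h x $ i * u x $ k - u x $ i * h x $ k))"
  "integrable torus (\<lambda>x. \<Sum>i\<in>UNIV. \<Sum>k\<in>UNIV. h x $ i * h x $ k * partial \<iota> k (curl \<iota> \<psi>) x $ i)"
  by (intro Bochner_Integration.integrable_sum flux_terms_integrable smooth_vec_nth periodic_vec_nth
      smooth_partial periodic_partial smooth_curl periodic_curl \<psi>)+

lemma energy_integrable: "integrable torus (\<lambda>x. (norm (u x))\<^sup>2 + (norm (h x))\<^sup>2)"
  using u h by (intro Bochner_Integration.integrable_add) (auto simp: torus_L2_def)

text \<open>Nine index pairs, each at most \<open>P\<close> times the energy density. All
  derivatives are on the test field, so no regularity of the solution enters.\<close>

lemma momentum_flux_le:
  assumes P: "\<And>k x i. \<bar>partial \<iota> k \<psi> x $ i\<bar> \<le> P"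
  shows "\<bar>momentum_flux \<iota> u h \<psi>\<bar> \<le> 9 * P * (\<integral>x. (norm (u x))\<^sup>2 + (norm (h x))\<^sup>2 \<partial>torus)"
proof -
  have le: "\<bar>\<Sum>i\<in>UNIV. \<Sum>k\<in>UNIV. partial \<iota> k \<psi> x $ i * (u x $ i * u x $ k - h x $ i * h x $ k)\<bar>
      \<le> 9 * P * ((norm (u x))\<^sup>2 + (norm (h x))\<^sup>2)" for x
  proof -
    have "\<bar>\<Sum>i\<in>UNIV. \<Sum>k\<in>UNIV. partial \<iota> k \<psi> x $ i * (u x $ i * u x $ k - h x $ i * h x $ k)\<bar>
      \<le> (\<Sum>i\<in>(UNIV::3 set). \<Sum>k\<in>(UNIV::3 set). P * ((norm (u x))\<^sup>2 + (norm (h x))\<^sup>2))"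
      by (rule order_trans[OF sum_abs sum_mono], rule order_trans[OF sum_abs sum_mono])
        (unfold abs_mult, intro mult_mono P component_products_le, auto intro: order_trans[OF abs_ge_zero P])
    then show ?thesis by simp
  qed
  have "\<bar>momentum_flux \<iota> u h \<psi>\<bar> \<le> (\<integral>x. \<bar>\<Sum>i\<in>UNIV. \<Sum>k\<in>UNIV. partial \<iota> k \<psi> x $ i * (u x $ i * u x $ k - h x $ i * h x $ k)\<bar> \<partial>torus)"
    unfolding momentum_flux_def by (rule integral_abs_bound)
  also have "\<dots> \<le> (\<integral>x. 9 * P * ((norm (u x))\<^sup>2 + (norm (h x))\<^sup>2) \<partial>torus)"
    by (rule integral_mono[OF integrable_abs[OF momentum_integrable] integrable_mult_right[OF energy_integrable] le])
  finally show ?thesis by simp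
qed

lemma induction_flux_le:
  assumes P: "\<And>k x i. \<bar>partial \<iota> k \<psi> x $ i\<bar> \<le> P" and Q: "\<And>k x i. \<bar>partial \<iota> k (curl \<iota> \<psi>) x $ i\<bar> \<le> Q"
  shows "\<bar>induction_flux \<iota> u h \<psi>\<bar> \<le> 9 * (P + Q) * (\<integral>x. (norm (u x))\<^sup>2 + (norm (h x))\<^sup>2 \<partial>torus)"
proof -
  let ?e = "\<lambda>x. (norm (u x))\<^sup>2 + (norm (h x))\<^sup>2"
  let ?A = "\<lambda>x. \<Sum>i\<in>UNIV. \<Sum>k\<in>UNIV. partial \<iota> k \<psi> x $ i * (h x $ i * u x $ k - u x $ i * h x $ k)"
  let ?B = "\<lambda>x. \<Sum>i\<in>UNIV. \<Sum>k\<in>UNIV. h x $ i * h x $ k * partial \<iota> k (curl \<iota> \<psi>) x $ i"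
  have A: "\<bar>?A x\<bar> \<le> 9 * P * ?e x" for x
  proof -
    have "\<bar>?A x\<bar> \<le> (\<Sum>i\<in>(UNIV::3 set). \<Sum>k\<in>(UNIV::3 set). P * ?e x)"
      by (rule order_trans[OF sum_abs sum_mono], rule order_trans[OF sum_abs sum_mono])
        (unfold abs_mult, intro mult_mono P component_products_le, auto intro: order_trans[OF abs_ge_zero P])
    then show ?thesis by simp
  qed
  have B: "\<bar>?B x\<bar> \<le> 9 * Q * ?e x" for x
  proof -
    have "\<bar>h x $ i * h x $ k * partial \<iota> k (curl \<iota> \<psi>) x $ i\<bar> \<le> Q * ?e x" for i k
      unfolding abs_mult[of "h x $ i * h x $ k"] mult.commute[of Q]
      by (intro mult_mono Q component_products_le) auto
    then have "\<bar>?B x\<bar> \<le> (\<Sum>i\<in>(UNIV::3 set). \<Sum>k\<in>(UNIV::3 set). Q * ?e x)"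
      by (intro order_trans[OF sum_abs sum_mono])
    then show ?thesis by simp
  qed
  have "\<bar>induction_flux \<iota> u h \<psi>\<bar> \<le> (\<integral>x. \<bar>?A x + ?B x\<bar> \<partial>torus)"
    unfolding induction_flux_def by (rule integral_abs_bound)
  also have "\<dots> \<le> (\<integral>x. 9 * (P + Q) * ?e x \<partial>torus)"
  proof (rule integral_mono[OF integrable_abs integrable_mult_right[OF energy_integrable]])
    show "integrable torus (\<lambda>x. ?A x + ?B x)" by (intro Bochner_Integration.integrable_add induction_integrable)
    show "\<bar>?A x + ?B x\<bar> \<le> 9 * (P + Q) * ?e x" for x
      using order_trans[OF abs_triangle_ineq add_mono[OF A B], of x x] by (simp add: algebra_simps)
  qed
  finally show ?thesis by simp
qed

end

lemma partial_diff:
  fixes f g :: "real ^ 'd \<Rightarrow> 'b::real_normed_vector"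
  assumes "smooth f" "smooth g"
  shows "partial \<iota> k (\<lambda>x. f x - g x) x = partial \<iota> k f x - partial \<iota> k g x"
  unfolding partial_smooth[OF smooth_diff[OF assms]] partial_smooth[OF assms(1)] partial_smooth[OF assms(2)]
  by (intro dir_deriv_eq has_derivative_diff smooth_has_derivative assms)

text \<open>Linearity in the test field reduces the change of the flux between two freezing times to
  the flux of a mollified difference.\<close>

lemma flux_diff:
  fixes \<psi> \<phi> :: "real ^ 'd \<Rightarrow> real ^ 3"
  assumes \<psi>: "smooth \<psi>" "periodic \<psi>" and \<phi>: "smooth \<phi>" "periodic \<phi>"
  shows "momentum_flux \<iota> u h (\<lambda>x. \<psi> x - \<phi> x) = momentum_flux \<iota> u h \<psi> - momentum_flux \<iota> u h \<phi>"
    and "induction_flux \<iota> u h (\<lambda>x. \<psi> x - \<phi> x) = induction_flux \<iota> u h \<psi> - induction_flux \<iota> u h \<phi>"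
proof -
  have c: "curl \<iota> (\<lambda>x. \<psi> x - \<phi> x) = (\<lambda>x. curl \<iota> \<psi> x - curl \<iota> \<phi> x)"
    unfolding fun_eq_iff vec_eq_iff forall_3
    by (simp add: curl_components partial_diff \<psi> \<phi>)
  show "momentum_flux \<iota> u h (\<lambda>x. \<psi> x - \<phi> x) = momentum_flux \<iota> u h \<psi> - momentum_flux \<iota> u h \<phi>"
    unfolding momentum_flux_def
    by (subst Bochner_Integration.integral_diff[symmetric, OF momentum_integrable[OF \<psi>] momentum_integrable[OF \<phi>]])
      (simp add: partial_diff \<psi> \<phi> left_diff_distrib sum_subtractf)
  show "induction_flux \<iota> u h (\<lambda>x. \<psi> x - \<phi> x) = induction_flux \<iota> u h \<psi> - induction_flux \<iota> u h \<phi>"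
    unfolding induction_flux_def c
    by (subst Bochner_Integration.integral_diff[symmetric,
          OF Bochner_Integration.integrable_add[OF induction_integrable[OF \<psi>]]
            Bochner_Integration.integrable_add[OF induction_integrable[OF \<phi>]]])
      (simp add: partial_diff \<psi> \<phi> smooth_curl left_diff_distrib right_diff_distrib sum_subtractf
        sum.distrib algebra_simps)
qed

end

lemma measurable_vec_nth:
  fixes f :: "'a \<Rightarrow> real ^ 'n"
  shows "f \<in> borel_measurable M \<Longrightarrow> (\<lambda>x. f x $ i) \<in> borel_measurable M"
  by (rule borel_measurable_continuous_on[OF linear_continuous_on[OF bounded_linear_vec_nth]])

lemma measurable_torus_integral:
  fixes f :: "'t \<Rightarrow> real ^ 'd \<Rightarrow> real"
  assumes "(\<lambda>(t, x). f t x) \<in> borel_measurable (M \<Otimes>\<^sub>M borel)"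
  shows "(\<lambda>t. \<integral>x. f t x \<partial>torus) \<in> borel_measurable M"
proof (rule torus.borel_measurable_lebesgue_integral)
  have "sets (M \<Otimes>\<^sub>M torus) = sets (M \<Otimes>\<^sub>M (borel :: (real ^ 'd) measure))"
    by (intro sets_pair_measure_cong) auto
  then show "(\<lambda>(t, x). f t x) \<in> borel_measurable (M \<Otimes>\<^sub>M torus)"
    using assms measurable_cong_sets by blast
qed

lemma measurable_flux:
  fixes u h \<psi> :: "'t \<Rightarrow> real ^ 'd \<Rightarrow> real ^ 3"
  assumes um: "(\<lambda>(t, x). u t x) \<in> borel_measurable (M \<Otimes>\<^sub>M borel)"
    and hm: "(\<lambda>(t, x). h t x) \<in> borel_measurable (M \<Otimes>\<^sub>M borel)"
    and \<psi>m: "\<And>k. (\<lambda>(t, x). partial \<iota> k (\<psi> t) x) \<in> borel_measurable (M \<Otimes>\<^sub>M borel)"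
  shows "(\<lambda>t. momentum_flux \<iota> (u t) (h t) (\<psi> t)) \<in> borel_measurable M"
    and "(\<And>k. (\<lambda>(t, x). partial \<iota> k (curl \<iota> (\<psi> t)) x) \<in> borel_measurable (M \<Otimes>\<^sub>M borel)) \<Longrightarrow>
      (\<lambda>t. induction_flux \<iota> (u t) (h t) (\<psi> t)) \<in> borel_measurable M"
proof -
  note nth = measurable_vec_nth[OF um] measurable_vec_nth[OF hm] measurable_vec_nth[OF \<psi>m]
  note nth' = nth[unfolded split_beta']
  show "(\<lambda>t. momentum_flux \<iota> (u t) (h t) (\<psi> t)) \<in> borel_measurable M"
    unfolding momentum_flux_def
    by (rule measurable_torus_integral, unfold split_beta')
      (intro borel_measurable_sum borel_measurable_times borel_measurable_diff nth')
  assume cm: "\<And>k. (\<lambda>(t, x). partial \<iota> k (curl \<iota> (\<psi> t)) x) \<in> borel_measurable (M \<Otimes>\<^sub>M borel)"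
  show "(\<lambda>t. induction_flux \<iota> (u t) (h t) (\<psi> t)) \<in> borel_measurable M"
    unfolding induction_flux_def
    by (rule measurable_torus_integral, unfold split_beta')
      (intro borel_measurable_add borel_measurable_sum borel_measurable_times borel_measurable_diff nth'
        measurable_vec_nth[OF cm, unfolded split_beta'])
qed

text \<open>The inner convolution bounds the field uniformly by its L^1 norm, the outer one takes
  the derivatives. The constant depends on the mollifier and hence on \<epsilon>; it is used only
  while the mollifier is fixed.\<close>

lemma double_convolve_bound:
  fixes \<eta> :: "real ^ 'd \<Rightarrow> real"
  assumes \<eta>: "kernel \<eta>"
  obtains B where "0 \<le> B"
    "\<And>v x k i. torus_L1 v \<Longrightarrow> \<bar>partial \<iota> k (convolve \<eta> (convolve \<eta> (v :: real ^ 'd \<Rightarrow> real ^ 3))) x $ i\<bar> \<le> B * (\<integral>x. norm (v x) \<partial>torus)"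
    "\<And>v x k i. torus_L1 v \<Longrightarrow> \<bar>partial \<iota> k (curl \<iota> (convolve \<eta> (convolve \<eta> (v :: real ^ 'd \<Rightarrow> real ^ 3)))) x $ i\<bar> \<le> B * (\<integral>x. norm (v x) \<partial>torus)"
proof -
  obtain B0 where B0: "0 < B0" "\<And>y. \<bar>\<eta> y\<bar> \<le> B0 * indicator (ball 0 (1/2)) y"
    using kernel_bound[OF \<eta>] by blast
  have dbl: "\<exists>b. 0 \<le> b \<and> (\<forall>(v :: real ^ 'd \<Rightarrow> real ^ 3) x. torus_L1 v \<longrightarrow> norm (convolve K (convolve \<eta> v) x) \<le> b * (\<integral>x. norm (v x) \<partial>torus))"
    if K: "kernel K" for K
  proof -
    obtain B1 where B1: "0 < B1" "\<And>y. \<bar>K y\<bar> \<le> B1 * indicator (ball 0 (1/2)) y"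
      using kernel_bound[OF K] by blast
    have "norm (convolve K (convolve \<eta> v) x) \<le> B1 * B0 * (\<integral>x. norm (v x) \<partial>torus)" if v: "torus_L1 v"
      for v :: "real ^ 'd \<Rightarrow> real ^ 3" and x
    proof -
      have "norm (convolve K (convolve \<eta> v) x) \<le> B1 * (\<integral>x. norm (convolve \<eta> v x) \<partial>torus)"
        by (rule convolve_norm_le[OF K B1(2) torus_L1_convolve[OF \<eta> v]])
      also have "(\<integral>x. norm (convolve \<eta> v x) \<partial>torus) \<le> (\<integral>x. B0 * (\<integral>x. norm (v x) \<partial>torus) \<partial>(torus :: (real ^ 'd) measure))"
        by (rule integral_mono[OF integrable_norm[OF torus_L1_integrable[OF torus_L1_convolve[OF \<eta> v]]]
              torus.integrable_const convolve_norm_le[OF \<eta> B0(2) v]])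
      finally show ?thesis using B1(1) by (simp add: mult.assoc)
    qed
    moreover have "0 \<le> B1 * B0" using B0 B1 by simp
    ultimately show ?thesis by blast
  qed
  have "\<forall>k. \<exists>b. 0 \<le> b \<and> (\<forall>(v :: real ^ 'd \<Rightarrow> real ^ 3) x. torus_L1 v \<longrightarrow>
      norm (convolve (dir_deriv (direction \<iota> k) \<eta>) (convolve \<eta> v) x) \<le> b * (\<integral>x. norm (v x) \<partial>torus))"
    using dbl[OF kernel_dir_deriv[OF \<eta>]] by blast
  from choice[OF this] obtain b1 where b1: "\<And>k. 0 \<le> b1 k"
    "\<And>k v x. torus_L1 (v :: real ^ 'd \<Rightarrow> real ^ 3) \<Longrightarrow> norm (convolve (dir_deriv (direction \<iota> k) \<eta>) (convolve \<eta> v) x) \<le> b1 k * (\<integral>x. norm (v x) \<partial>torus)"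
    by blast
  have "\<forall>p. \<exists>b. 0 \<le> b \<and> (\<forall>(v :: real ^ 'd \<Rightarrow> real ^ 3) x. torus_L1 v \<longrightarrow>
      norm (convolve (dir_deriv (direction \<iota> (fst p)) (dir_deriv (direction \<iota> (snd p)) \<eta>)) (convolve \<eta> v) x) \<le> b * (\<integral>x. norm (v x) \<partial>torus))"
    using dbl[OF kernel_dir_deriv[OF kernel_dir_deriv[OF \<eta>]]] by blast
  from choice[OF this] obtain b2 where b2: "\<And>p. 0 \<le> b2 p"
    "\<And>p v x. torus_L1 (v :: real ^ 'd \<Rightarrow> real ^ 3) \<Longrightarrow>
      norm (convolve (dir_deriv (direction \<iota> (fst p)) (dir_deriv (direction \<iota> (snd p)) \<eta>)) (convolve \<eta> v) x) \<le> b2 p * (\<integral>x. norm (v x) \<partial>torus)"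
    by blast
  \<comment> \<open>The factor 2 is for the curl, whose components are differences of two
    derivatives.\<close>
  define B where "B = (\<Sum>k\<in>UNIV. b1 k) + 2 * (\<Sum>p\<in>UNIV. b2 p)"
  have nn: "0 \<le> (\<Sum>k\<in>UNIV. b1 k)" "0 \<le> (\<Sum>p\<in>UNIV. b2 p)" by (intro sum_nonneg b1 b2)+
  have Bb: "b1 k \<le> B" "2 * b2 p \<le> B" for k p
    using member_le_sum[of k UNIV b1] member_le_sum[of p UNIV b2] b1(1) b2(1) nn by (auto simp: B_def)
  have L1n: "0 \<le> (\<integral>x. norm (v x) \<partial>torus)" for v :: "real ^ 'd \<Rightarrow> real ^ 3"
    by (rule Bochner_Integration.integral_nonneg) simp
  show ?thesis
  proof (rule that[of B])
    show "0 \<le> B" using nn by (simp add: B_def)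
    fix v :: "real ^ 'd \<Rightarrow> real ^ 3" and x k i
    assume v: "torus_L1 v"
    have V: "torus_L1 (convolve \<eta> v)" by (rule torus_L1_convolve[OF \<eta> v])
    show "\<bar>partial \<iota> k (convolve \<eta> (convolve \<eta> v)) x $ i\<bar> \<le> B * (\<integral>x. norm (v x) \<partial>torus)"
      unfolding partial_convolve[OF \<eta> V]
      by (rule order_trans[OF component_le_norm_cart order_trans[OF b1(2)[OF v] mult_right_mono[OF Bb(1) L1n]]])
    have "\<bar>partial \<iota> k (partial \<iota> j (convolve \<eta> (convolve \<eta> v))) x $ l\<bar> \<le> B / 2 * (\<integral>x. norm (v x) \<partial>torus)" for j l
    proof -
      have "b2 (k, j) \<le> B / 2" using Bb(2)[of "(k, j)"] by simp
      then show ?thesis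
        unfolding partial_convolve[OF \<eta> V] partial_convolve[OF kernel_dir_deriv[OF \<eta>] V]
        by (rule order_trans[OF component_le_norm_cart order_trans[OF
              b2(2)[OF v, of "(k, j)", unfolded fst_conv snd_conv] mult_right_mono[OF _ L1n]]])
    qed
    from partial_curl_le[OF smooth_convolve_L1[OF \<eta> V] this]
    show "\<bar>partial \<iota> k (curl \<iota> (convolve \<eta> (convolve \<eta> v))) x $ i\<bar> \<le> B * (\<integral>x. norm (v x) \<partial>torus)"
      by simp
  qed
qed

lemma convolve_diff:
  assumes "kernel K" "locally_integrable v" "locally_integrable w"
  shows "convolve K (\<lambda>x. v x - w x) x = convolve K v x - convolve K w x"
  unfolding convolve_def
  by (simp add: scaleR_right_diff_distrib Bochner_Integration.integral_diff convolve_integrable assms)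

text \<open>Spatial derivatives are rewritten as convolutions with derivatives of the kernel, for
  which joint measurability is known.\<close>

lemma measurable_convolve_fluxes:
  fixes v :: "'t \<Rightarrow> real ^ 'd \<Rightarrow> real ^ 3"
  assumes \<eta>: "kernel \<eta>" and v: "(\<lambda>(t, x). v t x) \<in> borel_measurable (M \<Otimes>\<^sub>M borel)" and L1: "\<And>t. torus_L1 (v t)"
  shows "(\<lambda>(t, x). partial \<iota> k (convolve \<eta> (convolve \<eta> (v t))) x) \<in> borel_measurable (M \<Otimes>\<^sub>M borel)"
    and "(\<lambda>(t, x). partial \<iota> k (curl \<iota> (convolve \<eta> (convolve \<eta> (v t)))) x) \<in> borel_measurable (M \<Otimes>\<^sub>M borel)"
proof -
  have V: "torus_L1 (convolve \<eta> (v t))" for t by (rule torus_L1_convolve[OF \<eta> L1])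
  note m1 = measurable_convolve[OF \<eta> v]
  show "(\<lambda>(t, x). partial \<iota> k (convolve \<eta> (convolve \<eta> (v t))) x) \<in> borel_measurable (M \<Otimes>\<^sub>M borel)"
    unfolding partial_convolve[OF \<eta> V] by (rule measurable_convolve[OF kernel_dir_deriv[OF \<eta>] m1])
  have m2: "(\<lambda>(t, x). partial \<iota> k (partial \<iota> j (convolve \<eta> (convolve \<eta> (v t)))) x) \<in> borel_measurable (M \<Otimes>\<^sub>M borel)" for j
    unfolding partial_convolve[OF \<eta> V] partial_convolve[OF kernel_dir_deriv[OF \<eta>] V]
    by (rule measurable_convolve[OF kernel_dir_deriv[OF kernel_dir_deriv[OF \<eta>]] m1])
  note nth = measurable_vec_nth[OF m2, unfolded split_beta']
  have "(\<lambda>p. partial \<iota> k (curl \<iota> (convolve \<eta> (convolve \<eta> (v (fst p))))) (snd p) $ i) \<in> borel_measurable (M \<Otimes>\<^sub>M borel)" for i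
    using exhaust_3[of i]
    by (elim disjE) (simp_all add: partial_curl_components[OF smooth_convolve_L1[OF \<eta> V]] nth borel_measurable_diff)
  then show "(\<lambda>(t, x). partial \<iota> k (curl \<iota> (convolve \<eta> (convolve \<eta> (v t)))) x) \<in> borel_measurable (M \<Otimes>\<^sub>M borel)"
    by (subst borel_measurable_euclidean_space) (auto simp: Basis_vec_def inner_axis split_beta')
qed

text \<open>Moves one of two mollifications to the other factor, so that pairing the solution with a
  twice mollified field becomes an inner product of mollified fields.\<close>

lemma integral_convolve_inner:
  fixes V v :: "real ^ 'd \<Rightarrow> real ^ 3"
  assumes K: "kernel K" "\<And>y. K (- y) = K y" and V: "smooth V" "periodic V" and v: "torus_L1 v"
  shows "(\<integral>x. convolve K V x \<bullet> v x \<partial>torus) = (\<integral>x. V x \<bullet> convolve K v x \<partial>torus)"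
proof -
  have V1: "torus_L1 V" using V by (simp add: torus_L1_smooth)
  have "(\<integral>x. convolve K V x \<bullet> v x \<partial>torus) = (\<integral>x. (\<Sum>i\<in>UNIV. v x $ i * convolve K (\<lambda>x. V x $ i) x) \<partial>torus)"
    by (simp add: inner_vec_def convolve_vec_nth[OF K(1) torus_L1_locally_integrable[OF V1]] mult.commute)
  also have "\<dots> = (\<Sum>i\<in>UNIV. \<integral>x. v x $ i * convolve K (\<lambda>x. V x $ i) x \<partial>torus)"
    by (intro Bochner_Integration.integral_sum integrable_mult_smooth_periodic torus_L1_vec_nth v
        smooth_convolve_L1 K periodic_convolve periodic_vec_nth V V1)
  also have "\<dots> = (\<Sum>i\<in>UNIV. \<integral>x. convolve K (\<lambda>x. v x $ i) x * V x $ i \<partial>torus)"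
    by (intro sum.cong refl convolve_even_adjoint K torus_L1_vec_nth v smooth_vec_nth periodic_vec_nth V)
  also have "\<dots> = (\<integral>x. (\<Sum>i\<in>UNIV. convolve K (\<lambda>x. v x $ i) x * V x $ i) \<partial>torus)"
    by (intro Bochner_Integration.integral_sum[symmetric] integrable_mult_smooth_periodic torus_L1_convolve
        torus_L1_vec_nth v K smooth_vec_nth periodic_vec_nth V)
  also have "\<dots> = (\<integral>x. V x \<bullet> convolve K v x \<partial>torus)"
    by (simp add: inner_vec_def convolve_vec_nth[OF K(1) torus_L1_locally_integrable[OF v]] mult.commute)
  finally show ?thesis .
qed

subsection \<open>The mollified energy balance\<close>

text \<open>The form of the problem used from here on. Test fields are split into a time factor and
  a spatial factor, and the conditions at a fixed time hold for every real time, which spares side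
  conditions; the cut-off fields below provide this. Continuity and the equations refer to [0, T]
  only.\<close>

locale hall_mhd =
  fixes \<iota> :: "'d::finite \<Rightarrow> 3" and T :: real and u h :: "real \<Rightarrow> real ^ 'd \<Rightarrow> real ^ 3"
  assumes T: "0 < T"
    and measurable_u: "(\<lambda>(t, x). u t x) \<in> borel_measurable (borel \<Otimes>\<^sub>M borel)"
    and measurable_h: "(\<lambda>(t, x). h t x) \<in> borel_measurable (borel \<Otimes>\<^sub>M borel)"
    and L2_u: "torus_L2 (u t)" and L2_h: "torus_L2 (h t)"
    and cont_u: "s \<in> {0..T} \<Longrightarrow> ((\<lambda>t. \<integral>x. (norm (u t x - u s x))\<^sup>2 \<partial>torus) \<longlongrightarrow> 0) (at s within {0..T})"
    and cont_h: "s \<in> {0..T} \<Longrightarrow> ((\<lambda>t. \<integral>x. (norm (h t x - h s x))\<^sup>2 \<partial>torus) \<longlongrightarrow> 0) (at s within {0..T})"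
    and div_u: "weakly_div_free \<iota> (u t)" and div_h: "weakly_div_free \<iota> (h t)"
    and weak_u: "\<And>\<theta> \<psi>. smooth \<theta> \<Longrightarrow> \<exists>a b. 0 < a \<and> b < T \<and> (\<forall>t. t \<notin> {a..b} \<longrightarrow> \<theta> t = 0) \<Longrightarrow>
      smooth \<psi> \<Longrightarrow> periodic \<psi> \<Longrightarrow> \<forall>x. divergence \<iota> \<psi> x = 0 \<Longrightarrow>
      (LBINT t:{0..T}. dir_deriv 1 \<theta> t * (\<integral>x. \<psi> x \<bullet> u t x \<partial>torus) + \<theta> t * momentum_flux \<iota> (u t) (h t) \<psi>) = 0"
    and weak_h: "\<And>\<theta> \<psi>. smooth \<theta> \<Longrightarrow> \<exists>a b. 0 < a \<and> b < T \<and> (\<forall>t. t \<notin> {a..b} \<longrightarrow> \<theta> t = 0) \<Longrightarrow>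
      smooth \<psi> \<Longrightarrow> periodic \<psi> \<Longrightarrow> \<forall>x. divergence \<iota> \<psi> x = 0 \<Longrightarrow>
      (LBINT t:{0..T}. dir_deriv 1 \<theta> t * (\<integral>x. \<psi> x \<bullet> h t x \<partial>torus) + \<theta> t * induction_flux \<iota> (u t) (h t) \<psi>) = 0"
begin

text \<open>Twice the energy of the theorem, which saves a factor 1/2 throughout.\<close>

definition energy :: "real \<Rightarrow> real" where
  "energy t = (\<integral>x. (norm (u t x))\<^sup>2 + (norm (h t x))\<^sup>2 \<partial>torus)"

lemma L1_u: "torus_L1 (u t)" and L1_h: "torus_L1 (h t)"
  by (intro torus_L2_L1 L2_u L2_h)+

lemma energy_eq: "energy t = (\<integral>x. (norm (u t x))\<^sup>2 \<partial>torus) + (\<integral>x. (norm (h t x))\<^sup>2 \<partial>torus)"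
  unfolding energy_def by (rule Bochner_Integration.integral_add) (use L2_u L2_h in \<open>auto simp: torus_L2_def\<close>)

lemma continuous_energy: "continuous_on {0..T} energy"
  unfolding energy_eq continuous_on_def
  by (intro ballI tendsto_add L2_norm_tendsto L2_u L2_h cont_u cont_h)

lemma energy_nonneg: "0 \<le> energy t"
  unfolding energy_def by (rule Bochner_Integration.integral_nonneg) simp

lemma energy_bounded:
  obtains M where "0 < M" "\<And>t. t \<in> {0..T} \<Longrightarrow> energy t \<le> M"
proof -
  have "bounded (energy ` {0..T})"
    by (intro compact_imp_bounded compact_continuous_image continuous_energy compact_Icc)
  then obtain M where "0 < M" "\<forall>x\<in>energy ` {0..T}. norm x \<le> M" unfolding bounded_pos by blast
  then show ?thesis using that[of M] by (force simp: abs_le_iff)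
qed

text \<open>L^1 rather than L^2, because the fluxes are bounded by the L^1 norm of the field inside
  the twice mollified test field.\<close>

definition L1_dist :: "real \<Rightarrow> real \<Rightarrow> real" where
  "L1_dist t s = (\<integral>x. norm (u t x - u s x) \<partial>torus) + (\<integral>x. norm (h t x - h s x) \<partial>torus)"

lemma L1_dist_tendsto: "s \<in> {0..T} \<Longrightarrow> ((\<lambda>t. L1_dist t s) \<longlongrightarrow> 0) (at s within {0..T})"
  using tendsto_add[OF L1_norm_tendsto[OF L2_u cont_u, of s] L1_norm_tendsto[OF L2_h cont_h, of s]]
  by (simp add: L1_dist_def)

lemma L1_dist_triangle: "L1_dist t s \<le> L1_dist t r + L1_dist s r"
proof -
  have "(\<integral>x. norm (v t x - v s x) \<partial>torus) \<le> (\<integral>x. norm (v t x - v r x) \<partial>torus) + (\<integral>x. norm (v s x - v r x) \<partial>torus)"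
    if v: "\<And>t. torus_L2 (v t)" for v :: "real \<Rightarrow> real ^ 'd \<Rightarrow> real ^ 3"
  proof -
    have int: "integrable torus (\<lambda>x. norm (v t x - v s x))" for t s
      by (intro integrable_norm torus_L1_integrable torus_L2_L1 torus_L2_diff v)
    have "(\<integral>x. norm (v t x - v s x) \<partial>torus) \<le> (\<integral>x. norm (v t x - v r x) + norm (v s x - v r x) \<partial>torus)"
    proof (intro integral_mono int Bochner_Integration.integrable_add)
      show "norm (v t x - v s x) \<le> norm (v t x - v r x) + norm (v s x - v r x)" for x
        using norm_triangle_ineq4[of "v t x - v r x" "v s x - v r x"] by simp
    qed
    then show ?thesis by (simp add: int)
  qed
  from this[where v=u, OF L2_u] this[where v=h, OF L2_h] show ?thesis by (simp add: L1_dist_def)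
qed

lemma L1_dist_nonneg: "0 \<le> L1_dist t s"
  unfolding L1_dist_def by (intro add_nonneg_nonneg Bochner_Integration.integral_nonneg) auto

lemma continuous_inner:
  assumes v: "\<And>t. torus_L2 (v t)"
    and c: "\<And>s. s \<in> {0..T} \<Longrightarrow> ((\<lambda>t. \<integral>x. (norm (v t x - v s x))\<^sup>2 \<partial>torus) \<longlongrightarrow> 0) (at s within {0..T})"
    and \<psi>: "smooth \<psi>" "periodic \<psi>"
  shows "continuous_on {0..T} (\<lambda>t. \<integral>x. \<psi> x \<bullet> v t x \<partial>torus)"
  unfolding continuous_on_def
proof
  fix s assume s: "s \<in> {0..T}"
  have cp: "continuous_on UNIV \<psi>" by (rule smooth_imp_continuous[OF \<psi>(1)])
  obtain P where P: "\<And>x. norm (\<psi> x) \<le> P" using periodic_bounded[OF \<psi>(2) cp] by blast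
  note ip = norm_integral_inner_le[OF torus_L2_L1[OF v] cp P]
  have "((\<lambda>t. (\<integral>x. \<psi> x \<bullet> v t x \<partial>torus) - (\<integral>x. \<psi> x \<bullet> v s x \<partial>torus)) \<longlongrightarrow> 0) (at s within {0..T})"
  proof (rule Lim_null_comparison)
    show "((\<lambda>t. P * (\<integral>x. norm (v t x - v s x) \<partial>torus)) \<longlongrightarrow> 0) (at s within {0..T})"
      by (intro tendsto_mult_right_zero L1_norm_tendsto v c s)
    have "norm ((\<integral>x. \<psi> x \<bullet> v t x \<partial>torus) - (\<integral>x. \<psi> x \<bullet> v s x \<partial>torus)) \<le> P * (\<integral>x. norm (v t x - v s x) \<partial>torus)" for t
      using norm_integral_inner_le(2)[OF torus_L2_L1[OF torus_L2_diff[OF v v]] cp P, of t s] ip(1)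
      by (simp add: inner_diff_right)
    then show "\<forall>\<^sub>F t in at s within {0..T}. norm ((\<integral>x. \<psi> x \<bullet> v t x \<partial>torus) - (\<integral>x. \<psi> x \<bullet> v s x \<partial>torus))
        \<le> P * (\<integral>x. norm (v t x - v s x) \<partial>torus)"
      by simp
  qed
  then show "((\<lambda>t. \<integral>x. \<psi> x \<bullet> v t x \<partial>torus) \<longlongrightarrow> (\<integral>x. \<psi> x \<bullet> v s x \<partial>torus)) (at s within {0..T})"
    by (rule Lim_null[THEN iffD2])
qed

lemma set_integrable_bounded:
  fixes F :: "real \<Rightarrow> real"
  assumes "F \<in> borel_measurable borel" "\<And>t. t \<in> {0..T} \<Longrightarrow> \<bar>F t\<bar> \<le> B"
  shows "set_integrable lborel {0..T} F"
  unfolding set_integrable_def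
  by (rule integrableI_bounded_set_indicator[where B=B])
    (use assms in \<open>auto simp: emeasure_lborel_Icc_eq\<close>)

context
  fixes \<eta> :: "real ^ 'd \<Rightarrow> real"
  assumes \<eta>: "kernel \<eta>" and even: "\<And>y. \<eta> (- y) = \<eta> y"
begin

abbreviation dbl :: "(real ^ 'd \<Rightarrow> real ^ 3) \<Rightarrow> real ^ 'd \<Rightarrow> real ^ 3" where
  "dbl v \<equiv> convolve \<eta> (convolve \<eta> v)"

text \<open>Two times occur: the solution is taken at \<tau>, while the test fields are frozen at
  s.\<close>

definition total_flux :: "real \<Rightarrow> real \<Rightarrow> real" where
  "total_flux \<tau> s = momentum_flux \<iota> (u \<tau>) (h \<tau>) (dbl (u s)) + induction_flux \<iota> (u \<tau>) (h \<tau>) (dbl (h s))"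

definition mollified_energy :: "real \<Rightarrow> real" where
  "mollified_energy t = (\<integral>x. (norm (convolve \<eta> (u t) x))\<^sup>2 \<partial>torus) + (\<integral>x. (norm (convolve \<eta> (h t) x))\<^sup>2 \<partial>torus)"

lemma dbl_smooth: "torus_L1 v \<Longrightarrow> smooth (dbl v)"
  and dbl_periodic: "torus_L1 v \<Longrightarrow> periodic (dbl v)"
  by (intro smooth_convolve_L1 periodic_convolve torus_L1_convolve \<eta> torus_L1_periodic; assumption)+

lemma dbl_div_free: "torus_L1 v \<Longrightarrow> weakly_div_free \<iota> v \<Longrightarrow> divergence \<iota> (dbl v) x = 0"
  by (rule divergence_convolve[OF \<eta> even torus_L1_convolve[OF \<eta>] weakly_div_free_convolve[OF \<eta> even]])

lemma measurable_time_independent: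
  fixes g :: "real ^ 'd \<Rightarrow> real ^ 3"
  assumes "smooth g"
  shows "(\<lambda>(t :: real, x). g x) \<in> borel_measurable (borel \<Otimes>\<^sub>M borel)"
  using measurable_compose[OF measurable_snd borel_measurable_continuous_onI[OF smooth_imp_continuous[OF assms]]]
  by (simp add: split_beta')

lemma total_flux_measurable:
  "(\<lambda>\<tau>. total_flux \<tau> s) \<in> borel_measurable borel" "(\<lambda>\<tau>. total_flux \<tau> \<tau>) \<in> borel_measurable borel"
proof -
  show "(\<lambda>\<tau>. total_flux \<tau> s) \<in> borel_measurable borel"
    unfolding total_flux_def
    by (intro borel_measurable_add measurable_flux measurable_u measurable_h measurable_time_independent smooth_partial smooth_curl
        dbl_smooth L1_u L1_h)
  show "(\<lambda>\<tau>. total_flux \<tau> \<tau>) \<in> borel_measurable borel"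
    unfolding total_flux_def
    by (intro borel_measurable_add measurable_flux measurable_u measurable_h measurable_convolve_fluxes \<eta> L1_u L1_h)
qed

text \<open>The energy is bounded on [0, T], so the quadratic dependence on the solution is absorbed
  into \<open>K\<close> and a bound linear in \<open>v\<close> remains.\<close>

lemma flux_bounds:
  obtains K where "0 \<le> K"
    "\<And>\<tau> v. \<tau> \<in> {0..T} \<Longrightarrow> torus_L1 v \<Longrightarrow> \<bar>momentum_flux \<iota> (u \<tau>) (h \<tau>) (dbl v)\<bar> \<le> K * (\<integral>x. norm (v x) \<partial>torus)"
    "\<And>\<tau> v. \<tau> \<in> {0..T} \<Longrightarrow> torus_L1 v \<Longrightarrow> \<bar>induction_flux \<iota> (u \<tau>) (h \<tau>) (dbl v)\<bar> \<le> K * (\<integral>x. norm (v x) \<partial>torus)"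
proof -
  obtain M where M: "0 < M" "\<And>t. t \<in> {0..T} \<Longrightarrow> energy t \<le> M" using energy_bounded by blast
  obtain B where B: "0 \<le> B"
    "\<And>v x k i. torus_L1 v \<Longrightarrow> \<bar>partial \<iota> k (dbl v) x $ i\<bar> \<le> B * (\<integral>x. norm (v x) \<partial>torus)"
    "\<And>v x k i. torus_L1 v \<Longrightarrow> \<bar>partial \<iota> k (curl \<iota> (dbl v)) x $ i\<bar> \<le> B * (\<integral>x. norm (v x) \<partial>torus)"
    using double_convolve_bound[OF \<eta>, of \<iota>] by blast
  show ?thesis
  proof (rule that[of "18 * B * M"])
    show "0 \<le> 18 * B * M" using B M by simp
    fix \<tau> v assume \<tau>: "\<tau> \<in> {0..T}" and v: "torus_L1 (v :: real ^ 'd \<Rightarrow> real ^ 3)"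
    have nn: "0 \<le> (\<integral>x. norm (v x) \<partial>torus)" by (rule Bochner_Integration.integral_nonneg) simp
    define b where "b = B * (\<integral>x. norm (v x) \<partial>torus)"
    have b: "0 \<le> b" using B(1) nn by (simp add: b_def)
    have "\<bar>momentum_flux \<iota> (u \<tau>) (h \<tau>) (dbl v)\<bar> \<le> 9 * b * energy \<tau>"
      unfolding energy_def b_def
      by (rule momentum_flux_le[OF L2_u L2_h dbl_smooth[OF v] dbl_periodic[OF v] B(2)[OF v]])
    also have "\<dots> \<le> 18 * b * M"
      using b M(2)[OF \<tau>] energy_nonneg[of \<tau>] by (intro mult_mono) auto
    finally show "\<bar>momentum_flux \<iota> (u \<tau>) (h \<tau>) (dbl v)\<bar> \<le> 18 * B * M * (\<integral>x. norm (v x) \<partial>torus)"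
      by (simp add: b_def mult_ac)
    have "\<bar>induction_flux \<iota> (u \<tau>) (h \<tau>) (dbl v)\<bar> \<le> 9 * (b + b) * energy \<tau>"
      unfolding energy_def b_def
      by (rule induction_flux_le[OF L2_u L2_h dbl_smooth[OF v] dbl_periodic[OF v] B(2)[OF v] B(3)[OF v]])
    also have "9 * (b + b) * energy \<tau> = 18 * b * energy \<tau>" by simp
    also have "\<dots> \<le> 18 * b * M"
      using b M(2)[OF \<tau>] by (intro mult_left_mono) auto
    finally show "\<bar>induction_flux \<iota> (u \<tau>) (h \<tau>) (dbl v)\<bar> \<le> 18 * B * M * (\<integral>x. norm (v x) \<partial>torus)"
      by (simp add: b_def mult_ac)
  qed
qed

lemma norm_L1_le_energy: "(\<integral>x. norm (u t x) \<partial>torus) \<le> 1 + energy t" "(\<integral>x. norm (h t x) \<partial>torus) \<le> 1 + energy t"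
proof -
  have "0 \<le> (\<integral>x. (norm (u t x))\<^sup>2 \<partial>torus)" "0 \<le> (\<integral>x. (norm (h t x))\<^sup>2 \<partial>torus)"
    by (rule Bochner_Integration.integral_nonneg, simp)+
  then show "(\<integral>x. norm (u t x) \<partial>torus) \<le> 1 + energy t" "(\<integral>x. norm (h t x) \<partial>torus) \<le> 1 + energy t"
    using L1_le_L2[OF L2_u, of 1 t] L1_le_L2[OF L2_h, of 1 t] unfolding energy_eq by linarith+
qed

lemma total_flux_bounds:
  obtains K where "0 \<le> K" "\<And>\<tau> s. \<tau> \<in> {0..T} \<Longrightarrow> \<bar>total_flux \<tau> s - total_flux \<tau> \<tau>\<bar> \<le> K * L1_dist s \<tau>"
    "\<And>\<tau> s. \<tau> \<in> {0..T} \<Longrightarrow> s \<in> {0..T} \<Longrightarrow> \<bar>total_flux \<tau> s\<bar> \<le> K"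
proof -
  obtain K where K: "0 \<le> K"
    "\<And>\<tau> v. \<tau> \<in> {0..T} \<Longrightarrow> torus_L1 v \<Longrightarrow> \<bar>momentum_flux \<iota> (u \<tau>) (h \<tau>) (dbl v)\<bar> \<le> K * (\<integral>x. norm (v x) \<partial>torus)"
    "\<And>\<tau> v. \<tau> \<in> {0..T} \<Longrightarrow> torus_L1 v \<Longrightarrow> \<bar>induction_flux \<iota> (u \<tau>) (h \<tau>) (dbl v)\<bar> \<le> K * (\<integral>x. norm (v x) \<partial>torus)"
    using flux_bounds by blast
  obtain M where M: "0 < M" "\<And>t. t \<in> {0..T} \<Longrightarrow> energy t \<le> M" using energy_bounded by blast
  have dbl_diff: "(\<lambda>x. dbl v x - dbl w x) = dbl (\<lambda>x. v x - w x)" if "torus_L1 v" "torus_L1 w" for v w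
  proof -
    have "convolve \<eta> (\<lambda>x. v x - w x) = (\<lambda>x. convolve \<eta> v x - convolve \<eta> w x)"
      using convolve_diff[OF \<eta> torus_L1_locally_integrable[OF that(1)] torus_L1_locally_integrable[OF that(2)]] by blast
    then show ?thesis
      using convolve_diff[OF \<eta> torus_L1_locally_integrable[OF torus_L1_convolve[OF \<eta> that(1)]]
          torus_L1_locally_integrable[OF torus_L1_convolve[OF \<eta> that(2)]]] by auto
  qed
  show ?thesis
  \<comment> \<open>One constant that dominates both \<open>K\<close> and the bound 2 * K * (1 + M)
    for the flux itself.\<close>
  proof (rule that[of "K * (2 * (1 + M) + 1)"])
    show "0 \<le> K * (2 * (1 + M) + 1)" using K M by simp
    fix \<tau> s assume \<tau>: "\<tau> \<in> {0..T}"
    have du: "torus_L1 (\<lambda>x. u s x - u \<tau> x)" and dh: "torus_L1 (\<lambda>x. h s x - h \<tau> x)"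
      by (intro torus_L2_L1 torus_L2_diff L2_u L2_h)+
    have "total_flux \<tau> s - total_flux \<tau> \<tau> = momentum_flux \<iota> (u \<tau>) (h \<tau>) (dbl (\<lambda>x. u s x - u \<tau> x))
        + induction_flux \<iota> (u \<tau>) (h \<tau>) (dbl (\<lambda>x. h s x - h \<tau> x))"
      unfolding total_flux_def dbl_diff[OF L1_u L1_u, symmetric] dbl_diff[OF L1_h L1_h, symmetric]
      by (subst flux_diff[OF L2_u L2_h], (intro dbl_smooth dbl_periodic L1_u L1_h)+)+ simp
    then have "\<bar>total_flux \<tau> s - total_flux \<tau> \<tau>\<bar> \<le> K * L1_dist s \<tau>"
      using K(2)[OF \<tau> du] K(3)[OF \<tau> dh] unfolding L1_dist_def distrib_left by linarith
    also have "\<dots> \<le> K * (2 * (1 + M) + 1) * L1_dist s \<tau>"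
      using K(1) M(1) L1_dist_nonneg[of s \<tau>] by (intro mult_right_mono) (auto simp: mult_le_cancel_left1)
    finally show "\<bar>total_flux \<tau> s - total_flux \<tau> \<tau>\<bar> \<le> K * (2 * (1 + M) + 1) * L1_dist s \<tau>" .
    assume s: "s \<in> {0..T}"
    have "\<bar>total_flux \<tau> s\<bar> \<le> K * (\<integral>x. norm (u s x) \<partial>torus) + K * (\<integral>x. norm (h s x) \<partial>torus)"
      using K(2)[OF \<tau> L1_u, of s] K(3)[OF \<tau> L1_h, of s] unfolding total_flux_def by linarith
    also have "\<dots> \<le> K * (1 + M) + K * (1 + M)"
      using norm_L1_le_energy[of s] M(2)[OF s] K(1) by (intro add_mono mult_left_mono) auto
    also have "\<dots> \<le> K * (2 * (1 + M) + 1)" using K(1) by (simp add: algebra_simps)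
    finally show "\<bar>total_flux \<tau> s\<bar> \<le> K * (2 * (1 + M) + 1)" .
  qed
qed

lemma total_flux_integrable:
  assumes s: "s \<in> {0..T}"
  shows "set_integrable lborel {0..T} (\<lambda>\<tau>. total_flux \<tau> s)" "set_integrable lborel {0..T} (\<lambda>\<tau>. total_flux \<tau> \<tau>)"
proof -
  obtain K where K: "0 \<le> K" "\<And>\<tau> s. \<tau> \<in> {0..T} \<Longrightarrow> \<bar>total_flux \<tau> s - total_flux \<tau> \<tau>\<bar> \<le> K * L1_dist s \<tau>"
    "\<And>\<tau> s. \<tau> \<in> {0..T} \<Longrightarrow> s \<in> {0..T} \<Longrightarrow> \<bar>total_flux \<tau> s\<bar> \<le> K"
    using total_flux_bounds by blast
  show "set_integrable lborel {0..T} (\<lambda>\<tau>. total_flux \<tau> s)" "set_integrable lborel {0..T} (\<lambda>\<tau>. total_flux \<tau> \<tau>)"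
    by (rule set_integrable_bounded[OF total_flux_measurable(1)], rule K(3), assumption, rule s)
      (rule set_integrable_bounded[OF total_flux_measurable(2)], rule K(3))
qed

text \<open>The difference of two squared norms is the increment paired with both end values: the
  mixed terms cancel when the equations are tested with the fields frozen at \<open>a\<close> and at
  \<open>b\<close>. This is why the flux appears twice.\<close>

lemma energy_increment:
  assumes ab: "0 < a" "a < b" "b < T"
  shows "mollified_energy b - mollified_energy a = (LBINT \<tau>:{a..b}. total_flux \<tau> a + total_flux \<tau> b)"
proof -
  obtain K where K: "0 \<le> K"
    "\<And>\<tau> v. \<tau> \<in> {0..T} \<Longrightarrow> torus_L1 v \<Longrightarrow> \<bar>momentum_flux \<iota> (u \<tau>) (h \<tau>) (dbl v)\<bar> \<le> K * (\<integral>x. norm (v x) \<partial>torus)"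
    "\<And>\<tau> v. \<tau> \<in> {0..T} \<Longrightarrow> torus_L1 v \<Longrightarrow> \<bar>induction_flux \<iota> (u \<tau>) (h \<tau>) (dbl v)\<bar> \<le> K * (\<integral>x. norm (v x) \<partial>torus)"
    using flux_bounds by blast
  have intu: "set_integrable lborel {0..T} (\<lambda>\<tau>. momentum_flux \<iota> (u \<tau>) (h \<tau>) (dbl (u s)))" for s
    by (rule set_integrable_bounded[where B="K * (\<integral>x. norm (u s x) \<partial>torus)"],
        intro measurable_flux measurable_u measurable_h measurable_time_independent smooth_partial dbl_smooth L1_u)
      (intro K L1_u, assumption)
  have inth: "set_integrable lborel {0..T} (\<lambda>\<tau>. induction_flux \<iota> (u \<tau>) (h \<tau>) (dbl (h s)))" for s
    by (rule set_integrable_bounded[where B="K * (\<integral>x. norm (h s x) \<partial>torus)"],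
        intro measurable_flux measurable_u measurable_h measurable_time_independent smooth_partial smooth_curl dbl_smooth L1_h)
      (intro K L1_h, assumption)
  have sub: "{a..b} \<subseteq> {0..T}" using ab by auto
  note intu' = set_integrable_subset[OF intu _ sub] and inth' = set_integrable_subset[OF inth _ sub]
  have inner: "(\<integral>x. dbl v x \<bullet> w x \<partial>torus) = (\<integral>x. convolve \<eta> v x \<bullet> convolve \<eta> w x \<partial>torus)"
    if "torus_L1 v" "torus_L1 w" for v w :: "real ^ 'd \<Rightarrow> real ^ 3"
    by (intro integral_convolve_inner \<eta> even smooth_convolve_L1 periodic_convolve torus_L1_periodic that)
  have eu: "(\<integral>x. dbl (u s) x \<bullet> u b x \<partial>torus) - (\<integral>x. dbl (u s) x \<bullet> u a x \<partial>torus)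
      = (LBINT \<tau>:{a..b}. momentum_flux \<iota> (u \<tau>) (h \<tau>) (dbl (u s)))" for s
    by (rule weak_time_derivative[OF continuous_inner[OF L2_u cont_u dbl_smooth[OF L1_u] dbl_periodic[OF L1_u]] intu _ ab])
      (assumption, rule weak_u[OF _ _ dbl_smooth[OF L1_u] dbl_periodic[OF L1_u]], assumption+, simp add: dbl_div_free L1_u div_u)
  have eh: "(\<integral>x. dbl (h s) x \<bullet> h b x \<partial>torus) - (\<integral>x. dbl (h s) x \<bullet> h a x \<partial>torus)
      = (LBINT \<tau>:{a..b}. induction_flux \<iota> (u \<tau>) (h \<tau>) (dbl (h s)))" for s
    by (rule weak_time_derivative[OF continuous_inner[OF L2_h cont_h dbl_smooth[OF L1_h] dbl_periodic[OF L1_h]] inth _ ab])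
      (assumption, rule weak_h[OF _ _ dbl_smooth[OF L1_h] dbl_periodic[OF L1_h]], assumption+, simp add: dbl_div_free L1_h div_h)
  have sum: "(LBINT \<tau>:{a..b}. total_flux \<tau> a + total_flux \<tau> b) =
      ((LBINT \<tau>:{a..b}. momentum_flux \<iota> (u \<tau>) (h \<tau>) (dbl (u a))) + (LBINT \<tau>:{a..b}. induction_flux \<iota> (u \<tau>) (h \<tau>) (dbl (h a))))
      + ((LBINT \<tau>:{a..b}. momentum_flux \<iota> (u \<tau>) (h \<tau>) (dbl (u b))) + (LBINT \<tau>:{a..b}. induction_flux \<iota> (u \<tau>) (h \<tau>) (dbl (h b))))"
    unfolding total_flux_def by (simp add: intu' inth' set_integral_add)
  show ?thesis
    unfolding sum eu[symmetric] eh[symmetric] inner[OF L1_u L1_u] inner[OF L1_h L1_h] mollified_energy_def power2_norm_eq_inner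
    by (simp add: inner_commute)
qed

lemma mollified_energy_balance:
  assumes ab: "a \<in> {0<..<T}" "b \<in> {0<..<T}"
  shows "\<bar>mollified_energy b - mollified_energy a\<bar> \<le> 2 * (LBINT \<tau>:{0..T}. \<bar>total_flux \<tau> \<tau>\<bar>)"
proof -
  let ?F = "\<lambda>\<tau>. total_flux \<tau> \<tau>"
  have F: "set_integrable lborel {0..T} ?F" by (rule total_flux_integrable(2)[of 0]) (use T in simp)
  have Fab: "set_integrable lborel {a..b} ?F" if "0 \<le> a" "b \<le> T" for a b
    by (rule set_integrable_subset[OF F]) (use that in auto)
  obtain K where K: "0 \<le> K" "\<And>\<tau> s. \<tau> \<in> {0..T} \<Longrightarrow> \<bar>total_flux \<tau> s - total_flux \<tau> \<tau>\<bar> \<le> K * L1_dist s \<tau>"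
    "\<And>\<tau> s. \<tau> \<in> {0..T} \<Longrightarrow> s \<in> {0..T} \<Longrightarrow> \<bar>total_flux \<tau> s\<bar> \<le> K"
    using total_flux_bounds by blast
  define G where "G t = mollified_energy t - 2 * (LBINT \<tau>:{0..t}. ?F \<tau>)" for t
  \<comment> \<open>The Henstock-Kurzweil integral supplies additivity over adjacent
    intervals.\<close>
  have LI: "(LBINT \<tau>:{a..b}. ?F \<tau>) = integral {a..b} ?F" "?F integrable_on {a..b}" if "0 \<le> a" "b \<le> T" for a b
    using set_borel_integral_eq_integral[OF Fab[OF that]] by auto
  have comb: "(LBINT \<tau>:{0..b}. ?F \<tau>) - (LBINT \<tau>:{0..a}. ?F \<tau>) = (LBINT \<tau>:{a..b}. ?F \<tau>)"
    if "0 \<le> a" "a \<le> b" "b \<le> T" for a b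
    using Henstock_Kurzweil_Integration.integral_combine[OF that(1,2), of ?F] LI[of 0 b] LI[of 0 a] LI[of a b] that by simp
  have est: "\<bar>G b - G a\<bar> \<le> K * D * (b - a)"
    if ab: "0 < a" "a < b" "b < T" and D: "\<And>\<tau>. \<tau> \<in> {a..b} \<Longrightarrow> L1_dist a \<tau> + L1_dist b \<tau> \<le> D" for a b D
  proof -
    have sub: "{a..b} \<subseteq> {0..T}" using ab by auto
    have int: "set_integrable lborel {a..b} (\<lambda>\<tau>. total_flux \<tau> a + total_flux \<tau> b)"
      by (intro set_integral_add set_integrable_subset[OF total_flux_integrable(1) _ sub]) (use ab in auto)
    have int2: "set_integrable lborel {a..b} (\<lambda>\<tau>. 2 * ?F \<tau>)"
      using Fab[of a b] ab by simp
    have "G b - G a = (LBINT \<tau>:{a..b}. total_flux \<tau> a + total_flux \<tau> b) - 2 * (LBINT \<tau>:{a..b}. ?F \<tau>)"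
      using energy_increment[OF ab] comb[of a b] ab by (simp add: G_def)
    also have "\<dots> = (LBINT \<tau>:{a..b}. (total_flux \<tau> a + total_flux \<tau> b) - 2 * ?F \<tau>)"
      using set_integral_diff(2)[OF int int2] by simp
    finally have "\<bar>G b - G a\<bar> = \<bar>\<integral>\<tau>. indicator {a..b} \<tau> *\<^sub>R ((total_flux \<tau> a + total_flux \<tau> b) - 2 * ?F \<tau>) \<partial>lborel\<bar>"
      by (simp add: set_lebesgue_integral_def)
    also have "\<dots> \<le> (\<integral>\<tau>. \<bar>indicator {a..b} \<tau> *\<^sub>R ((total_flux \<tau> a + total_flux \<tau> b) - 2 * ?F \<tau>)\<bar> \<partial>lborel)"
      by (rule integral_abs_bound)
    also have "\<dots> \<le> (\<integral>\<tau>. (K * D) * indicator {a..b} \<tau> \<partial>lborel)"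
    proof (rule integral_mono)
      show "integrable lborel (\<lambda>\<tau>. \<bar>indicator {a..b} \<tau> *\<^sub>R ((total_flux \<tau> a + total_flux \<tau> b) - 2 * ?F \<tau>)\<bar>)"
        using integrable_abs[OF set_integral_diff(1)[OF int int2, unfolded set_integrable_def]] .
      show "integrable lborel (\<lambda>\<tau>::real. (K * D) * indicator {a..b} \<tau>)"
        by (intro integrable_mult_right integrable_real_indicator) (simp_all add: emeasure_lborel_Icc_eq)
      show "\<bar>indicator {a..b} \<tau> *\<^sub>R ((total_flux \<tau> a + total_flux \<tau> b) - 2 * ?F \<tau>)\<bar> \<le> (K * D) * indicator {a..b} \<tau>" for \<tau>
      proof (cases "\<tau> \<in> {a..b}")
        case True
        then have \<tau>: "\<tau> \<in> {0..T}" using sub by auto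
        have "\<bar>(total_flux \<tau> a + total_flux \<tau> b) - 2 * ?F \<tau>\<bar> \<le> K * L1_dist a \<tau> + K * L1_dist b \<tau>"
          using K(2)[OF \<tau>, of a] K(2)[OF \<tau>, of b] by linarith
        also have "\<dots> = K * (L1_dist a \<tau> + L1_dist b \<tau>)" by (simp add: distrib_left)
        also have "\<dots> \<le> K * D" by (rule mult_left_mono[OF D[OF True] K(1)])
        finally show ?thesis using True by simp
      qed simp
    qed
    also have "\<dots> = K * D * (b - a)" using ab by simp
    finally show ?thesis .
  qed
  have der: "(G has_derivative (\<lambda>h. 0)) (at t within {0<..<T})" if t: "t \<in> {0<..<T}" for t
    unfolding has_derivative_within_alt
  proof (intro conjI allI impI bounded_linear_zero)
    fix e :: real assume e: "0 < e"
    \<comment> \<open>Four L^1 distances will each be at most \<delta>; the added 1 covers K =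
      0.\<close>
    define \<delta> where "\<delta> = e / (4 * K + 1)"
    have \<delta>: "0 < \<delta>" "4 * K * \<delta> \<le> e"
    proof -
      show "0 < \<delta>" using e K(1) by (simp add: \<delta>_def)
      then have "4 * K * \<delta> \<le> \<delta> * (4 * K + 1)" by (simp add: algebra_simps)
      also have "\<dots> = e" using nonzero_eq_divide_eq[of "4 * K + 1" \<delta> e] K(1) \<delta>_def by simp
      finally show "4 * K * \<delta> \<le> e" .
    qed
    have "((\<lambda>s. L1_dist s t) \<longlongrightarrow> 0) (at t within {0..T})" using t by (intro L1_dist_tendsto) auto
    then have "\<forall>\<^sub>F s in at t within {0..T}. dist (L1_dist s t) 0 < \<delta>"
      using \<delta>(1) unfolding tendsto_iff by blast
    then obtain d where d: "0 < d" "\<And>s. s \<in> {0..T} \<Longrightarrow> s \<noteq> t \<Longrightarrow> dist s t < d \<Longrightarrow> L1_dist s t < \<delta>"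
      unfolding eventually_at using L1_dist_nonneg by fastforce
    have d': "L1_dist s t \<le> \<delta>" if "s \<in> {0..T}" "dist s t < d" for s
      using d(2)[OF that(1) _ that(2)] \<delta>(1) by (cases "s = t") (auto simp: L1_dist_def)
    show "\<exists>d>0. \<forall>y\<in>{0<..<T}. norm (y - t) < d \<longrightarrow> norm (G y - G t - 0) \<le> e * norm (y - t)"
    proof (intro exI[of _ d] conjI ballI impI d(1))
      fix y assume y: "y \<in> {0<..<T}" "norm (y - t) < d"
      \<comment> \<open>By the triangle inequality through \<open>t\<close>, each of the two
        distances is at most twice \<delta>.\<close>
      have D: "L1_dist (min y t) \<tau> + L1_dist (max y t) \<tau> \<le> 4 * \<delta>" if "\<tau> \<in> {min y t..max y t}" for \<tau>
      proof -
        have "\<tau> \<in> {0..T}" "dist \<tau> t < d" using that y t by (auto simp: dist_real_def)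
        moreover have "min y t \<in> {0..T}" "dist (min y t) t < d" "max y t \<in> {0..T}" "dist (max y t) t < d"
          using y t d(1) by (auto simp: dist_real_def min_def max_def)
        ultimately have "L1_dist \<tau> t \<le> \<delta>" "L1_dist (min y t) t \<le> \<delta>" "L1_dist (max y t) t \<le> \<delta>"
          using d' by blast+
        then show ?thesis
          using L1_dist_triangle[of "min y t" \<tau> t] L1_dist_triangle[of "max y t" \<tau> t] by linarith
      qed
      show "norm (G y - G t - 0) \<le> e * norm (y - t)"
      proof (cases "y = t")
        case False
        have "\<bar>G (max y t) - G (min y t)\<bar> \<le> K * (4 * \<delta>) * (max y t - min y t)"
          by (rule est[OF _ _ _ D]) (use y t False in auto)
        also have "\<dots> \<le> e * (max y t - min y t)"
          using \<delta>(2) by (intro mult_right_mono) (auto simp: mult_ac)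
        finally show ?thesis by (auto simp: max_def min_def abs_minus_commute split: if_splits)
      qed simp
    qed
  qed
  have "G b = G a"
    by (rule has_derivative_zero_unique[OF convex_real_interval(8) der ab(2,1)])
  then have "mollified_energy b - mollified_energy a = 2 * ((LBINT \<tau>:{0..b}. ?F \<tau>) - (LBINT \<tau>:{0..a}. ?F \<tau>))"
    by (simp add: G_def algebra_simps)
  moreover have "\<bar>(LBINT \<tau>:{0..b}. ?F \<tau>) - (LBINT \<tau>:{0..a}. ?F \<tau>)\<bar> \<le> (LBINT \<tau>:{0..T}. \<bar>?F \<tau>\<bar>)"
  proof -
    have le: "\<bar>LBINT \<tau>:{c..d}. ?F \<tau>\<bar> \<le> (LBINT \<tau>:{0..T}. \<bar>?F \<tau>\<bar>)" if "0 \<le> c" "d \<le> T" for c d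
    proof -
      have "\<bar>LBINT \<tau>:{c..d}. ?F \<tau>\<bar> \<le> (\<integral>\<tau>. \<bar>indicator {c..d} \<tau> *\<^sub>R ?F \<tau>\<bar> \<partial>lborel)"
        unfolding set_lebesgue_integral_def by (rule integral_abs_bound)
      also have "\<dots> \<le> (LBINT \<tau>:{0..T}. \<bar>?F \<tau>\<bar>)"
        unfolding set_lebesgue_integral_def
      proof (rule integral_mono)
        show "integrable lborel (\<lambda>\<tau>. \<bar>indicator {c..d} \<tau> *\<^sub>R ?F \<tau>\<bar>)"
          using integrable_abs[OF Fab[OF that, unfolded set_integrable_def]] .
        show "integrable lborel (\<lambda>\<tau>. indicator {0..T} \<tau> *\<^sub>R \<bar>?F \<tau>\<bar>)"
          using integrable_abs[OF F[unfolded set_integrable_def]] by (simp add: abs_mult)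
        show "\<bar>indicator {c..d} \<tau> *\<^sub>R ?F \<tau>\<bar> \<le> indicator {0..T} \<tau> *\<^sub>R \<bar>?F \<tau>\<bar>" for \<tau>
          using that by (auto split: split_indicator)
      qed
      finally show ?thesis .
    qed
    show ?thesis
      using comb[of a b] comb[of b a] le[of a b] le[of b a] ab by (cases "a \<le> b") auto
  qed
  ultimately show ?thesis by (simp add: abs_mult)
qed

end

end

subsection \<open>Vanishing of the energy flux\<close>

text \<open>The approximating constants may vary with \<rho>, so they are replaced by the mean
  \<open>m\<close>. If a constant is within \<rho> of \<open>f\<close> in L^1, then \<open>m\<close>
  differs from it by at most \<rho> / T, so \<open>m\<close> is within 2 * \<rho> of
  \<open>f\<close>. Hence \<open>f\<close> equals \<open>m\<close> in L^1, and by continuity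
  everywhere.\<close>

lemma continuous_approx_const:
  fixes f :: "real \<Rightarrow> real"
  assumes T: "0 < T" and f: "continuous_on {0..T} f"
    and approx: "\<And>\<rho>. 0 < \<rho> \<Longrightarrow> \<exists>c. (LBINT t:{0..T}. \<bar>f t - c\<bar>) \<le> \<rho>"
    and t: "t \<in> {0..T}" and s: "s \<in> {0..T}"
  shows "f t = f s"
proof -
  define m where "m = (LBINT t:{0..T}. f t) / T"
  have int: "set_integrable lborel {0..T} g" if "continuous_on {0..T} g" for g :: "real \<Rightarrow> real"
    unfolding set_integrable_def by (rule borel_integrable_compact) (use that in auto)
  have c: "continuous_on {0..T} (\<lambda>t. \<bar>f t - c\<bar>)" "continuous_on {0..T} (\<lambda>t. f t - c)" for c
    by (intro continuous_intros f)+
  have const: "(LBINT t:{0..T}. c) = T * c" for c :: real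
    unfolding set_lebesgue_integral_def using T by simp
  have "(LBINT t:{0..T}. \<bar>f t - m\<bar>) \<le> e" if e: "0 < e" for e
  proof -
    obtain d where d: "(LBINT t:{0..T}. \<bar>f t - d\<bar>) \<le> e / 2" using approx[of "e / 2"] e by auto
    have "T * \<bar>m - d\<bar> = \<bar>LBINT t:{0..T}. f t - d\<bar>"
    proof -
      have "(LBINT t:{0..T}. f t - d) = (LBINT t:{0..T}. f t) - T * d"
        using int[OF f] int[OF continuous_on_const] by (simp add: set_integral_diff const)
      also have "\<dots> = T * (m - d)" using T by (simp add: m_def right_diff_distrib)
      finally show ?thesis using T by (simp add: abs_mult)
    qed
    also have "\<dots> \<le> (LBINT t:{0..T}. \<bar>f t - d\<bar>)"
      unfolding set_lebesgue_integral_def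
      by (rule order_trans[OF integral_abs_bound]) (simp add: abs_mult)
    finally have md: "T * \<bar>m - d\<bar> \<le> e / 2" using d by simp
    have "(LBINT t:{0..T}. \<bar>f t - m\<bar>) \<le> (LBINT t:{0..T}. \<bar>f t - d\<bar> + \<bar>m - d\<bar>)"
      by (intro set_integral_mono int c continuous_intros) auto
    also have "\<dots> = (LBINT t:{0..T}. \<bar>f t - d\<bar>) + T * \<bar>m - d\<bar>"
      using int[OF c(1)] int[OF continuous_on_const] by (simp add: set_integral_add const)
    finally show ?thesis using d md by linarith
  qed
  then have "(LBINT t:{0..T}. \<bar>f t - m\<bar>) \<le> 0" by (rule field_le_epsilon) simp
  moreover have "0 \<le> (LBINT t:{0..T}. \<bar>f t - m\<bar>)"
    unfolding set_lebesgue_integral_def by (rule Bochner_Integration.integral_nonneg) simp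
  ultimately have "integral (cbox 0 T) (\<lambda>t. \<bar>f t - m\<bar>) = 0"
    using set_borel_integral_eq_integral(2)[OF int[OF c(1)]] by simp
  then have "\<forall>t\<in>{0..T}. \<bar>f t - m\<bar> = 0"
    by (subst (asm) integral_cbox_eq_0_iff) (use c T in auto)
  then show ?thesis using t s by auto
qed

context mollified
begin

text \<open>Only cubes of increments are controlled, while the energy is quadratic. Splitting at a
  threshold bounds a square by \<mu> plus the cube divided by \<mu>; the large factor 1/\<mu> is
  beaten afterwards by letting \<epsilon> tend to 0.\<close>

lemma mollify_square_le:
  assumes f: "torus_L3 f" and \<mu>: "0 < \<mu>" "\<mu> \<le> 1"
  shows "integrable torus (\<lambda>x. (norm (convolve \<eta> f x - f x))\<^sup>2) \<Longrightarrow>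
    (\<integral>x. (norm (convolve \<eta> f x - f x))\<^sup>2 \<partial>torus) \<le> C\<^sup>2 * (\<mu> + (\<integral>x. increment_avg \<epsilon> f x \<partial>torus) / \<mu>)"
proof -
  assume int: "integrable torus (\<lambda>x. (norm (convolve \<eta> f x - f x))\<^sup>2)"
  have sq: "s\<^sup>2 \<le> \<mu> + s ^ 3 / \<mu>" if "0 \<le> s" for s
  proof (cases "s\<^sup>2 \<le> \<mu>")
    case True
    then show ?thesis using that \<mu> by (simp add: add_increasing2)
  next
    case False
    \<comment> \<open>Since \<mu> \<le> 1, a value of s below \<mu> would have its square below
      \<mu>^2 and hence below \<mu>.\<close>
    then have "\<mu> \<le> s"
      using \<mu> that power2_le_imp_le[of \<mu> s] power_le_one[of \<mu> 2] by (smt (verit) mult_left_le power2_eq_square)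
    then have "s\<^sup>2 * \<mu> \<le> s\<^sup>2 * s" by (intro mult_left_mono) auto
    then have "s\<^sup>2 \<le> s ^ 3 / \<mu>" using \<mu> by (simp add: pos_le_divide_eq power3_eq_cube power2_eq_square)
    then show ?thesis using \<mu> by simp
  qed
  have le: "(norm (convolve \<eta> f x - f x))\<^sup>2 \<le> C\<^sup>2 * (\<mu> + increment_avg \<epsilon> f x / \<mu>)" for x
  proof -
    have "(norm (convolve \<eta> f x - f x))\<^sup>2 \<le> (C * increment_mean \<epsilon> f x)\<^sup>2"
      by (intro power_mono mollify_minus_le f) simp
    also have "\<dots> = C\<^sup>2 * (increment_mean \<epsilon> f x)\<^sup>2" by (simp add: power_mult_distrib)
    also have "\<dots> \<le> C\<^sup>2 * (\<mu> + increment_mean \<epsilon> f x ^ 3 / \<mu>)"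
      by (intro mult_left_mono sq increment_mean_nonneg) simp
    also have "\<dots> \<le> C\<^sup>2 * (\<mu> + increment_avg \<epsilon> f x / \<mu>)"
      using jensen_cube[OF increment_cubic[OF f \<epsilon>, of x]] \<mu>
      by (intro mult_left_mono add_left_mono divide_right_mono) (auto simp: increment_mean_def increment_avg_def)
    finally show ?thesis .
  qed
  have inc: "integrable torus (increment_avg \<epsilon> f)" by (rule integrable_increment_avg[OF f \<epsilon>])
  have "(\<integral>x. (norm (convolve \<eta> f x - f x))\<^sup>2 \<partial>torus) \<le> (\<integral>x. C\<^sup>2 * (\<mu> + increment_avg \<epsilon> f x / \<mu>) \<partial>torus)"
    by (rule integral_mono[OF int _ le]) (use inc in simp)
  also have "\<dots> = C\<^sup>2 * (\<mu> + (\<integral>x. increment_avg \<epsilon> f x \<partial>torus) / \<mu>)"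
    using inc by simp
  finally show ?thesis .
qed

end

text \<open>The dominating factor blows up as \<epsilon> tends to 0, which does no harm: only the
  existence of the time integral at a fixed \<epsilon> is at stake.\<close>

lemma time_increment_integrable:
  fixes v :: "real \<Rightarrow> real ^ 'd \<Rightarrow> real ^ 3"
  assumes v: "(\<lambda>(t, x). v t x) \<in> borel_measurable (borel \<Otimes>\<^sub>M borel)"
    and L3: "AE t in lborel. t \<in> {0..T} \<longrightarrow> torus_L3 (v t)"
    and int: "set_integrable lborel {0..T} (\<lambda>t. \<integral>x. norm (v t x) ^ 3 \<partial>torus)"
    and \<epsilon>: "0 < \<epsilon>" "\<epsilon> \<le> 1/2"
  shows "set_integrable lborel {0..T} (\<lambda>t. \<integral>x. increment_avg \<epsilon> (v t) x \<partial>torus)"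
  unfolding set_integrable_def
proof (rule Bochner_Integration.integrable_bound)
  let ?c = "4 + 4 / measure lborel (ball (0 :: real ^ 'd) \<epsilon>)"
  show "integrable lborel (\<lambda>t. ?c * (indicator {0..T} t *\<^sub>R (\<integral>x. norm (v t x) ^ 3 \<partial>torus)))"
    using int unfolding set_integrable_def by (rule integrable_mult_right)
  have "(\<lambda>t. \<integral>x. increment_avg \<epsilon> (v t) x \<partial>torus) \<in> borel_measurable borel"
    by (rule measurable_torus_integral[OF measurable_increment_avg[OF \<epsilon>(1) v]])
  then show "(\<lambda>t. indicator {0..T} t *\<^sub>R (\<integral>x. increment_avg \<epsilon> (v t) x \<partial>torus)) \<in> borel_measurable lborel"
    by simp
  show "AE t in lborel. norm (indicator {0..T} t *\<^sub>R (\<integral>x. increment_avg \<epsilon> (v t) x \<partial>torus))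
      \<le> norm (?c * (indicator {0..T} t *\<^sub>R (\<integral>x. norm (v t x) ^ 3 \<partial>torus)))"
    using L3
  proof eventually_elim
    case (elim t)
    show ?case
    proof (cases "t \<in> {0..T}")
      case True
      then have vt: "torus_L3 (v t)" using elim by simp
      have n3: "integrable torus (\<lambda>x. norm (v t x) ^ 3)" using vt by (simp add: torus_L3_def)
      have "(\<integral>x. increment_avg \<epsilon> (v t) x \<partial>torus) \<le> (\<integral>x. 4 * norm (v t x) ^ 3
          + 4 / measure lborel (ball (0 :: real ^ 'd) \<epsilon>) * (\<integral>x. norm (v t x) ^ 3 \<partial>torus) \<partial>torus)"
        using n3 by (intro integral_mono integrable_increment_avg[OF vt \<epsilon>] increment_avg_le[OF vt \<epsilon>]) simp
      also have "\<dots> = ?c * (\<integral>x. norm (v t x) ^ 3 \<partial>torus)"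
        using n3 by (simp add: distrib_right)
      finally have "(\<integral>x. increment_avg \<epsilon> (v t) x \<partial>torus) \<le> ?c * (\<integral>x. norm (v t x) ^ 3 \<partial>torus)" .
      moreover have "0 \<le> (\<integral>x. increment_avg \<epsilon> (v t) x \<partial>torus)"
        by (rule Bochner_Integration.integral_nonneg) (rule increment_avg_nonneg)
      ultimately show ?thesis using True by (simp add: order_trans[OF _ abs_ge_self])
    qed simp
  qed
qed

context hall_mhd
begin

text \<open>Two errors are added: that of replacing the energy by the mollified energy, and the
  variation of the mollified energy in time, bounded by the flux. The first is controlled only at
  times where the fields lie in L^3, and through a quantity integrable in time, so closeness is
  measured in L^1 over time.\<close>

lemma energy_close_to_const:
  assumes L3u: "AE t in lborel. t \<in> {0..T} \<longrightarrow> torus_L3 (u t)"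
    and L3h: "AE t in lborel. t \<in> {0..T} \<longrightarrow> torus_L3 (h t)"
    and intu: "set_integrable lborel {0..T} (\<lambda>t. \<integral>x. norm (u t x) ^ 3 \<partial>torus)"
    and inth: "set_integrable lborel {0..T} (\<lambda>t. \<integral>x. norm (h t x) ^ 3 \<partial>torus)"
    and moll: "mollified \<iota> C \<epsilon> \<eta>" and \<delta>: "0 < \<delta>" "\<delta> \<le> 1" and M: "\<And>t. t \<in> {0..T} \<Longrightarrow> energy t \<le> M"
  defines "A \<equiv> \<lambda>v. LBINT t:{0..T}. \<integral>x. increment_avg \<epsilon> (v t) x \<partial>torus"
  shows "\<exists>c. (LBINT t:{0..T}. \<bar>energy t - c\<bar>) \<le> \<delta> * (M + 4 * C\<^sup>2) * T
    + (1 + 1 / \<delta>) * C\<^sup>2 * (A u + A h) / \<delta>\<^sup>2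
    + 432 * C ^ 3 * T * (1 / \<epsilon> * (A u + A h) + 1 / \<epsilon>\<^sup>2 * A h)"
proof -
  interpret mollified \<iota> C \<epsilon> \<eta> by fact
  define D where "D = 216 * C ^ 3 * (1 / \<epsilon> * (A u + A h) + 1 / \<epsilon>\<^sup>2 * A h)"
  let ?I = "\<lambda>v t. \<integral>x. increment_avg \<epsilon> (v t) x \<partial>torus"
  have Iu: "set_integrable lborel {0..T} (?I u)" and Ih: "set_integrable lborel {0..T} (?I h)"
    by (intro time_increment_integrable measurable_u measurable_h L3u L3h intu inth \<epsilon>)+
  have F: "set_integrable lborel {0..T} (\<lambda>\<tau>. total_flux \<eta> \<tau> \<tau>)"
    by (rule total_flux_integrable(2)[OF kernel even, of 0]) (use T in simp)
  have flux: "(LBINT \<tau>:{0..T}. \<bar>total_flux \<eta> \<tau> \<tau>\<bar>) \<le> D"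
  proof -
    have int: "set_integrable lborel {0..T} (\<lambda>\<tau>. 216 * C ^ 3 * (1 / \<epsilon> * (?I u \<tau> + ?I h \<tau>) + 1 / \<epsilon>\<^sup>2 * ?I h \<tau>))"
      by (intro set_integrable_mult_right set_integral_add Iu Ih)
    have "(LBINT \<tau>:{0..T}. \<bar>total_flux \<eta> \<tau> \<tau>\<bar>)
        \<le> (LBINT \<tau>:{0..T}. 216 * C ^ 3 * (1 / \<epsilon> * (?I u \<tau> + ?I h \<tau>) + 1 / \<epsilon>\<^sup>2 * ?I h \<tau>))"
      unfolding set_lebesgue_integral_def
    proof (rule integral_mono_AE)
      show "integrable lborel (\<lambda>\<tau>. indicator {0..T} \<tau> *\<^sub>R \<bar>total_flux \<eta> \<tau> \<tau>\<bar>)"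
        using integrable_abs[OF F[unfolded set_integrable_def]] by (simp add: abs_mult)
      show "integrable lborel (\<lambda>\<tau>. indicator {0..T} \<tau> *\<^sub>R (216 * C ^ 3 * (1 / \<epsilon> * (?I u \<tau> + ?I h \<tau>) + 1 / \<epsilon>\<^sup>2 * ?I h \<tau>)))"
        using int by (simp add: set_integrable_def)
      show "AE \<tau> in lborel. indicator {0..T} \<tau> *\<^sub>R \<bar>total_flux \<eta> \<tau> \<tau>\<bar>
          \<le> indicator {0..T} \<tau> *\<^sub>R (216 * C ^ 3 * (1 / \<epsilon> * (?I u \<tau> + ?I h \<tau>) + 1 / \<epsilon>\<^sup>2 * ?I h \<tau>))"
        using L3u L3h
      proof eventually_elim
        case (elim \<tau>)
        show ?case
        proof (cases "\<tau> \<in> {0..T}")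
          case True
          then have L3: "torus_L3 (u \<tau>)" "torus_L3 (h \<tau>)" using elim by auto
          show ?thesis
            using flux_bound[OF L3(1) div_u L3(2) div_h] True
            by (simp add: total_flux_def[OF kernel even] integrable_increment_avg[OF L3(1) \<epsilon>] integrable_increment_avg[OF L3(2) \<epsilon>])
        qed simp
      qed
    qed
    also have "\<dots> = D"
      unfolding D_def A_def using Iu Ih
      by (simp add: set_integral_add set_integral_mult_right)
    finally show ?thesis .
  qed
  \<comment> \<open>The midpoint serves as a reference time inside (0, T), where the mollified
    balance holds.\<close>
  define c where "c = mollified_energy \<eta> (T / 2)"
  define R where "R t = \<delta> * M + (1 + 1 / \<delta>) * (C\<^sup>2 * (2 * \<delta>\<^sup>2 + (?I u t + ?I h t) / \<delta>\<^sup>2)) + 2 * D" for t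
  have close: "\<bar>energy t - c\<bar> \<le> R t" if t: "t \<in> {0<..<T}" and L3: "torus_L3 (u t)" "torus_L3 (h t)" for t
  proof -
    have L2: "torus_L2 (convolve \<eta> v)" if "torus_L1 v" for v
      using torus_L1_convolve[OF kernel that] smooth_convolve_L1[OF kernel that]
      by (auto simp: torus_L2_def torus_L1_def power2_norm_eq_inner
          intro!: integrable_torus_smooth_periodic smooth_inner periodic_inner)
    have part: "\<bar>(\<integral>x. (norm (convolve \<eta> v x))\<^sup>2 \<partial>torus) - (\<integral>x. (norm (v x))\<^sup>2 \<partial>torus)\<bar>
        \<le> \<delta> * (\<integral>x. (norm (v x))\<^sup>2 \<partial>torus) + (1 + 1 / \<delta>) * (C\<^sup>2 * (\<delta>\<^sup>2 + (\<integral>x. increment_avg \<epsilon> v x \<partial>torus) / \<delta>\<^sup>2))"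
      if v: "torus_L2 v" "torus_L3 v" for v
    proof -
      have d2: "torus_L2 (\<lambda>x. convolve \<eta> v x - v x)"
        by (rule torus_L2_diff[OF L2[OF torus_L2_L1[OF v(1)]] v(1)])
      \<comment> \<open>The threshold \<delta>^2 keeps its product with 1 + 1/\<delta> of order
        \<delta>.\<close>
      have "(\<integral>x. (norm (convolve \<eta> v x - v x))\<^sup>2 \<partial>torus) \<le> C\<^sup>2 * (\<delta>\<^sup>2 + (\<integral>x. increment_avg \<epsilon> v x \<partial>torus) / \<delta>\<^sup>2)"
        by (rule mollify_square_le[OF v(2)]) (use \<delta> d2 in \<open>auto simp: torus_L2_def power_le_one\<close>)
      then have "(1 + 1 / \<delta>) * (\<integral>x. (norm (convolve \<eta> v x - v x))\<^sup>2 \<partial>torus)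
          \<le> (1 + 1 / \<delta>) * (C\<^sup>2 * (\<delta>\<^sup>2 + (\<integral>x. increment_avg \<epsilon> v x \<partial>torus) / \<delta>\<^sup>2))"
        using \<delta> by (intro mult_left_mono) auto
      then show ?thesis
        using L2_norm_diff_le[OF L2[OF torus_L2_L1[OF v(1)]] v(1) \<delta>(1)] by linarith
    qed
    have "\<bar>mollified_energy \<eta> t - energy t\<bar> \<le> \<delta> * energy t
        + (1 + 1 / \<delta>) * (C\<^sup>2 * (\<delta>\<^sup>2 + ?I u t / \<delta>\<^sup>2)) + (1 + 1 / \<delta>) * (C\<^sup>2 * (\<delta>\<^sup>2 + ?I h t / \<delta>\<^sup>2))"
      using part[OF L2_u L3(1)] part[OF L2_h L3(2)]
      unfolding energy_eq mollified_energy_def[OF kernel even] distrib_left[of \<delta>] by linarith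
    also have "\<dots> = \<delta> * energy t + (1 + 1 / \<delta>) * (C\<^sup>2 * (2 * \<delta>\<^sup>2 + (?I u t + ?I h t) / \<delta>\<^sup>2))"
      unfolding add_divide_distrib by (simp add: distrib_left)
    also have "\<dots> \<le> \<delta> * M + (1 + 1 / \<delta>) * (C\<^sup>2 * (2 * \<delta>\<^sup>2 + (?I u t + ?I h t) / \<delta>\<^sup>2))"
      using M[of t] t \<delta> by (intro add_right_mono mult_left_mono) auto
    finally have 1: "\<bar>mollified_energy \<eta> t - energy t\<bar> \<le> \<dots>" .
    have 2: "\<bar>mollified_energy \<eta> t - c\<bar> \<le> 2 * D"
      using mollified_energy_balance[OF kernel even, of "T / 2" t] t T flux by (simp add: c_def)
    show ?thesis using 1 2 unfolding R_def by linarith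
  qed
  have Req: "(\<delta> * M + 2 * D + (1 + 1 / \<delta>) * (C\<^sup>2 * (2 * \<delta>\<^sup>2))) + ((1 + 1 / \<delta>) * C\<^sup>2 / \<delta>\<^sup>2) * (?I u t + ?I h t) = R t" for t
    unfolding R_def by (simp add: distrib_left add_divide_distrib)
  have Rint: "set_integrable lborel {0..T} R"
  proof -
    have "set_integrable lborel {0..T} (\<lambda>t. (\<delta> * M + 2 * D + (1 + 1 / \<delta>) * (C\<^sup>2 * (2 * \<delta>\<^sup>2)))
        + ((1 + 1 / \<delta>) * C\<^sup>2 / \<delta>\<^sup>2) * (?I u t + ?I h t))"
      by (intro set_integral_add set_integrable_mult_right Iu Ih set_integrable_bounded[where B="\<bar>\<delta> * M + 2 * D + (1 + 1 / \<delta>) * (C\<^sup>2 * (2 * \<delta>\<^sup>2))\<bar>"]) auto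
    then show ?thesis by (simp only: Req)
  qed
  have const: "(LBINT t:{0..T}. k) = T * k" for k :: real
    unfolding set_lebesgue_integral_def using T by simp
  have "(LBINT t:{0..T}. \<bar>energy t - c\<bar>) \<le> (LBINT t:{0..T}. R t)"
    unfolding set_lebesgue_integral_def
  proof (rule integral_mono_AE)
    show "integrable lborel (\<lambda>t. indicator {0..T} t *\<^sub>R \<bar>energy t - c\<bar>)"
      by (rule borel_integrable_compact) (auto intro!: continuous_intros continuous_energy)
    show "integrable lborel (\<lambda>t. indicator {0..T} t *\<^sub>R R t)"
      using Rint by (simp add: set_integrable_def)
    show "AE t in lborel. indicator {0..T} t *\<^sub>R \<bar>energy t - c\<bar> \<le> indicator {0..T} t *\<^sub>R R t"
      \<comment> \<open>The pointwise estimate holds in the open interval; the two end points are a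
        null set.\<close>
      using L3u L3h AE_lborel_singleton[of 0] AE_lborel_singleton[of T]
    proof eventually_elim
      case (elim t)
      then show ?case using close[of t] by (cases "t \<in> {0..T}") auto
    qed
  qed
  also have "(LBINT t:{0..T}. R t) = T * (\<delta> * M + 2 * D + (1 + 1 / \<delta>) * (C\<^sup>2 * (2 * \<delta>\<^sup>2)))
      + ((1 + 1 / \<delta>) * C\<^sup>2 / \<delta>\<^sup>2) * (A u + A h)"
  proof -
    have "(LBINT t:{0..T}. R t) = (LBINT t:{0..T}. (\<delta> * M + 2 * D + (1 + 1 / \<delta>) * (C\<^sup>2 * (2 * \<delta>\<^sup>2)))
        + ((1 + 1 / \<delta>) * C\<^sup>2 / \<delta>\<^sup>2) * (?I u t + ?I h t))"
      by (simp only: Req)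
    also have "\<dots> = T * (\<delta> * M + 2 * D + (1 + 1 / \<delta>) * (C\<^sup>2 * (2 * \<delta>\<^sup>2)))
        + ((1 + 1 / \<delta>) * C\<^sup>2 / \<delta>\<^sup>2) * (A u + A h)"
    proof (subst set_integral_add(2))
      show "set_integrable lborel {0..T} (\<lambda>t. \<delta> * M + 2 * D + (1 + 1 / \<delta>) * (C\<^sup>2 * (2 * \<delta>\<^sup>2)))"
        by (rule set_integrable_bounded[where B="\<bar>\<delta> * M + 2 * D + (1 + 1 / \<delta>) * (C\<^sup>2 * (2 * \<delta>\<^sup>2))\<bar>"]) auto
      show "set_integrable lborel {0..T} (\<lambda>t. ((1 + 1 / \<delta>) * C\<^sup>2 / \<delta>\<^sup>2) * (?I u t + ?I h t))"
        by (intro set_integrable_mult_right set_integral_add Iu Ih)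
    qed (simp only: const set_integral_mult_right set_integral_add(2)[OF Iu Ih] A_def)
    finally show ?thesis .
  qed
  also have "\<dots> \<le> \<delta> * (M + 4 * C\<^sup>2) * T + (1 + 1 / \<delta>) * C\<^sup>2 * (A u + A h) / \<delta>\<^sup>2
      + 432 * C ^ 3 * T * (1 / \<epsilon> * (A u + A h) + 1 / \<epsilon>\<^sup>2 * A h)"
  proof -
    \<comment> \<open>As \<delta> \<le> 1, the sum of \<delta>^2 and \<delta> is at most 2 *
      \<delta>; this is the source of the summand 4 times the square of \<open>C\<close>.\<close>
    have "(1 + 1 / \<delta>) * (C\<^sup>2 * (2 * \<delta>\<^sup>2)) = 2 * C\<^sup>2 * (\<delta>\<^sup>2 + \<delta>)"
      using \<delta> by (simp add: power2_eq_square field_simps)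
    also have "\<dots> \<le> 2 * C\<^sup>2 * (2 * \<delta>)"
      using \<delta> by (intro mult_left_mono) (auto simp: power2_eq_square mult_left_le)
    finally have "T * ((1 + 1 / \<delta>) * (C\<^sup>2 * (2 * \<delta>\<^sup>2))) \<le> T * (2 * C\<^sup>2 * (2 * \<delta>))"
      using T by (intro mult_left_mono) auto
    then show ?thesis by (simp add: D_def algebra_simps)
  qed
  finally show ?thesis by blast
qed

text \<open>The order of choices matters: \<delta> is chosen from \<rho>, then \<epsilon> from
  \<delta>, because the remaining error has negative powers of \<delta> but tends to 0 with
  \<epsilon>. This is possible because \<open>C\<close> does not depend on \<epsilon>.\<close>

lemma energy_conserved:
  assumes L3u: "AE t in lborel. t \<in> {0..T} \<longrightarrow> torus_L3 (u t)"
    and L3h: "AE t in lborel. t \<in> {0..T} \<longrightarrow> torus_L3 (h t)"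
    and intu: "set_integrable lborel {0..T} (\<lambda>t. \<integral>x. norm (u t x) ^ 3 \<partial>torus)"
    and inth: "set_integrable lborel {0..T} (\<lambda>t. \<integral>x. norm (h t x) ^ 3 \<partial>torus)"
    and limu: "((\<lambda>\<epsilon>. 1 / \<epsilon> * (LBINT t:{0..T}. \<integral>x. increment_avg \<epsilon> (u t) x \<partial>torus)) \<longlongrightarrow> 0) (at_right 0)"
    and limh: "((\<lambda>\<epsilon>. 1 / \<epsilon>\<^sup>2 * (LBINT t:{0..T}. \<integral>x. increment_avg \<epsilon> (h t) x \<partial>torus)) \<longlongrightarrow> 0) (at_right 0)"
    and t: "t \<in> {0..T}" and s: "s \<in> {0..T}"
  shows "energy t = energy s"
proof (rule continuous_approx_const[OF T continuous_energy _ t s])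
  fix \<rho> :: real assume \<rho>: "0 < \<rho>"
  define A where "A \<epsilon> v = (LBINT t:{0..T}. \<integral>x. increment_avg \<epsilon> (v t) x \<partial>torus)" for \<epsilon> and v :: "real \<Rightarrow> real ^ 'd \<Rightarrow> real ^ 3"
  obtain M where M: "0 < M" "\<And>t. t \<in> {0..T} \<Longrightarrow> energy t \<le> M" using energy_bounded by blast
  obtain C where C: "1 \<le> C" "\<And>\<epsilon>. 0 < \<epsilon> \<Longrightarrow> \<epsilon> < 1/2 \<Longrightarrow> \<exists>\<eta>. mollifier \<iota> C \<epsilon> \<eta>"
    using mollifier_exists[of \<iota>] by blast
  \<comment> \<open>Twice the coefficient of \<delta> in the error, so that the first part of the
    error is at most half of \<rho>.\<close>
  define q where "q = 2 * (M + 4 * C\<^sup>2) * T"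
  have q: "0 < q" using M T by (simp add: q_def add_pos_nonneg)
  define \<delta> where "\<delta> = min 1 (\<rho> / q)"
  have \<delta>: "0 < \<delta>" "\<delta> \<le> 1" "\<delta> * q \<le> \<rho>" using \<rho> q by (auto simp: \<delta>_def min_def divide_simps)
  have lim_id: "((\<lambda>\<epsilon>::real. \<epsilon>) \<longlongrightarrow> 0) (at_right 0)" by (rule tendsto_ident_at)
  \<comment> \<open>The rate for \<open>h\<close> is better by one power of \<epsilon>, so
    \<open>h\<close> also satisfies what is asked of \<open>u\<close>.\<close>
  have limh1: "((\<lambda>\<epsilon>. 1 / \<epsilon> * A \<epsilon> h) \<longlongrightarrow> 0) (at_right 0)"
  proof (rule Lim_transform_eventually)
    show "((\<lambda>\<epsilon>. \<epsilon> * (1 / \<epsilon>\<^sup>2 * A \<epsilon> h)) \<longlongrightarrow> 0) (at_right 0)"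
      using tendsto_mult[OF lim_id limh] by (simp add: A_def)
    show "\<forall>\<^sub>F \<epsilon> in at_right 0. \<epsilon> * (1 / \<epsilon>\<^sup>2 * A \<epsilon> h) = 1 / \<epsilon> * A \<epsilon> h"
      by (auto simp: eventually_at_right_field power2_eq_square intro!: exI[of _ 1])
  qed
  have lim1: "((\<lambda>\<epsilon>. 1 / \<epsilon> * (A \<epsilon> u + A \<epsilon> h)) \<longlongrightarrow> 0) (at_right 0)"
    using tendsto_add[OF limu limh1] by (simp add: A_def distrib_left)
  have lim0: "((\<lambda>\<epsilon>. A \<epsilon> u + A \<epsilon> h) \<longlongrightarrow> 0) (at_right 0)"
  proof (rule Lim_transform_eventually)
    show "((\<lambda>\<epsilon>. \<epsilon> * (1 / \<epsilon> * (A \<epsilon> u + A \<epsilon> h))) \<longlongrightarrow> 0) (at_right 0)"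
      using tendsto_mult[OF lim_id lim1] by simp
    show "\<forall>\<^sub>F \<epsilon> in at_right 0. \<epsilon> * (1 / \<epsilon> * (A \<epsilon> u + A \<epsilon> h)) = A \<epsilon> u + A \<epsilon> h"
      by (auto simp: eventually_at_right_field intro!: exI[of _ 1])
  qed
  define E where "E \<epsilon> = ((1 + 1 / \<delta>) * C\<^sup>2 / \<delta>\<^sup>2) * (A \<epsilon> u + A \<epsilon> h)
    + 432 * C ^ 3 * T * (1 / \<epsilon> * (A \<epsilon> u + A \<epsilon> h) + 1 / \<epsilon>\<^sup>2 * A \<epsilon> h)" for \<epsilon>
  have "(E \<longlongrightarrow> ((1 + 1 / \<delta>) * C\<^sup>2 / \<delta>\<^sup>2) * 0 + 432 * C ^ 3 * T * (0 + 0)) (at_right 0)"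
    unfolding E_def using limh by (intro tendsto_add tendsto_mult tendsto_const lim0 lim1) (simp add: A_def)
  then have "(E \<longlongrightarrow> 0) (at_right 0)" by simp
  then have "\<forall>\<^sub>F \<epsilon> in at_right 0. dist (E \<epsilon>) 0 < \<rho> / 2"
    by (rule tendstoD) (use \<rho> in simp)
  moreover have "\<forall>\<^sub>F \<epsilon> in at_right (0::real). 0 < \<epsilon> \<and> \<epsilon> < 1/2"
    by (auto simp: eventually_at_right_field intro!: exI[of _ "1/2"])
  ultimately have "\<forall>\<^sub>F \<epsilon> in at_right 0. dist (E \<epsilon>) 0 < \<rho> / 2 \<and> 0 < \<epsilon> \<and> \<epsilon> < 1/2"
    by (rule eventually_conj)
  then obtain \<epsilon> where \<epsilon>: "dist (E \<epsilon>) 0 < \<rho> / 2" "0 < \<epsilon>" "\<epsilon> < 1/2"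
    using eventually_happens'[OF trivial_limit_at_right_real] by blast
  obtain \<eta> where "mollifier \<iota> C \<epsilon> \<eta>" using C(2) \<epsilon> by blast
  then have "mollified \<iota> C \<epsilon> \<eta>" using C(1) \<epsilon> by (simp add: mollified_def)
  from energy_close_to_const[OF L3u L3h intu inth this \<delta>(1,2) M(2), folded A_def]
  obtain c where "(LBINT t:{0..T}. \<bar>energy t - c\<bar>) \<le> \<delta> * (M + 4 * C\<^sup>2) * T + E \<epsilon>"
    unfolding E_def by (auto simp: add.assoc)
  also have "\<dots> \<le> \<rho> / 2 + \<rho> / 2"
    using \<epsilon>(1) \<delta>(3) by (intro add_mono) (auto simp: q_def mult_ac)
  finally show "\<exists>c. (LBINT t:{0..T}. \<bar>energy t - c\<bar>) \<le> \<rho>" by auto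
qed

end

section \<open>From the hypotheses of the theorem to the energy argument\<close>

lemma measurable_time_section:
  assumes "(\<lambda>(t, x). v t x) \<in> borel_measurable (borel \<Otimes>\<^sub>M borel)"
  shows "v t \<in> borel_measurable borel"
  using measurable_compose[OF measurable_Pair1'[of t borel borel] assms] by simp

text \<open>The hypotheses control the representatives only for times in \<open>[0, T]\<close>.\<close>

definition cut_off :: "real \<Rightarrow> (real \<Rightarrow> real ^ 'd \<Rightarrow> real ^ 3) \<Rightarrow> real \<Rightarrow> real ^ 'd \<Rightarrow> real ^ 3" where
  "cut_off T f t x = indicator {0..T} t *\<^sub>R f t x"

lemma cut_off_in: "t \<in> {0..T} \<Longrightarrow> cut_off T f t = f t"
  and cut_off_out: "t \<notin> {0..T} \<Longrightarrow> cut_off T f t = (\<lambda>_. 0)"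
  by (auto simp: cut_off_def fun_eq_iff)

lemma measurable_cut_off:
  fixes f :: "real \<Rightarrow> real ^ 'd \<Rightarrow> real ^ 3"
  assumes "time_field T f"
  shows "(\<lambda>(t, x). cut_off T f t x) \<in> borel_measurable (borel \<Otimes>\<^sub>M borel)"
proof -
  have "(\<lambda>(t, x). cut_off T f t x) = (\<lambda>p. indicator ({0..T} \<times> UNIV) p *\<^sub>R (case p of (t, x) \<Rightarrow> f t x))"
    by (auto simp: cut_off_def fun_eq_iff indicator_times)
  then show ?thesis
    using assms by (simp add: time_field_def set_borel_measurable_def borel_prod)
qed

text \<open>For q = r = 3 the inner exponent r / q is 1, and cubing removes the outer exponent 1 /
  r, so the cube of the Besov-VMO quantity is a multiple of the integral of
  \<open>increment_avg\<close>. Real powers become natural ones, since all bases involved are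
  nonnegative.\<close>

lemma besov_increment_avg:
  fixes f :: "real \<Rightarrow> real ^ 'd \<Rightarrow> real ^ 3"
  assumes f: "in_Lr_Besov_VMO 3 \<alpha> 3 T f"
  shows "AE t in lborel. t \<in> {0..T} \<longrightarrow> torus_L3 (cut_off T f t)"
    and "set_integrable lborel {0..T} (\<lambda>t. \<integral>x. norm (cut_off T f t x) ^ 3 \<partial>torus)"
    and "((\<lambda>\<epsilon>. (1 / \<epsilon> powr \<alpha>) ^ 3 * (LBINT t:{0..T}. \<integral>x. increment_avg \<epsilon> (cut_off T f t) x \<partial>torus)) \<longlongrightarrow> 0) (at_right 0)"
proof -
  let ?g = "cut_off T f"
  have tf: "time_field T f" using f by (simp add: in_Lr_Besov_VMO_def in_LrLq_def)
  note jm = measurable_cut_off[OF tf]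
  have gm: "?g t \<in> borel_measurable borel" for t by (rule measurable_time_section[OF jm])
  have fm: "f t \<in> borel_measurable borel" if "t \<in> {0..T}" for t
    using gm[of t] by (simp only: cut_off_in[OF that])
  have m3: "(\<lambda>x. norm (f t x) ^ 3) \<in> borel_measurable borel" if "t \<in> {0..T}" for t
    using fm[OF that] by measurable
  have "AE t in lborel. t \<in> {0..T} \<longrightarrow> torus_integrable (\<lambda>x. norm (f t x) powr 3)"
    using f by (simp add: in_Lr_Besov_VMO_def in_LrLq_def)
  then show "AE t in lborel. t \<in> {0..T} \<longrightarrow> torus_L3 (?g t)"
  proof eventually_elim
    case (elim t)
    show ?case
    proof
      assume t: "t \<in> {0..T}"
      have "integrable torus (\<lambda>x. norm (f t x) ^ 3)"
        using elim t torus_integrable_eq[OF m3[OF t]] by simp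
      moreover have "periodic (f t)" using tf t by (simp add: time_field_def)
      ultimately show "torus_L3 (?g t)" using fm[OF t] by (simp only: cut_off_in[OF t] torus_L3_def)
    qed
  qed
  have 1: "torus_integral (\<lambda>x. norm (f t x) powr 3) powr (3 / 3) = (\<integral>x. norm (?g t x) ^ 3 \<partial>torus)" if t: "t \<in> {0..T}" for t
  proof -
    have "0 \<le> (\<integral>x. norm (f t x) ^ 3 \<partial>torus)" by (rule Bochner_Integration.integral_nonneg) simp
    then show ?thesis using t m3[OF t] by (simp add: cut_off_in torus_integral_eq)
  qed
  have "set_integrable lborel {0..T} (\<lambda>t. torus_integral (\<lambda>x. norm (f t x) powr 3) powr (3 / 3))"
    using f by (simp add: in_Lr_Besov_VMO_def in_LrLq_def)
  then show "set_integrable lborel {0..T} (\<lambda>t. \<integral>x. norm (?g t x) ^ 3 \<partial>torus)"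
    by (rule set_integrable_cong[THEN iffD1, rotated -1]) (use 1 in auto)
  define A where "A \<epsilon> = (LBINT t:{0..T}. \<integral>x. increment_avg \<epsilon> (?g t) x \<partial>torus)" for \<epsilon>
  have A: "0 \<le> A \<epsilon>" for \<epsilon>
    unfolding A_def set_lebesgue_integral_def
    by (intro Bochner_Integration.integral_nonneg scaleR_nonneg_nonneg) (auto simp: increment_avg_nonneg)
  have inner: "1 / measure lborel (ball (0 :: real ^ 'd) \<epsilon>) * (LBINT y:ball 0 \<epsilon>. norm (f t x - f t (x - y)) powr 3)
      = increment_avg \<epsilon> (?g t) x" if t: "t \<in> {0..T}" for t x \<epsilon>
  proof -
    have [measurable]: "f t \<in> borel_measurable borel" "(\<lambda>y. f t (x - y)) \<in> borel_measurable borel"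
      using fm[OF t] by (auto intro: borel_measurable_lborel_translate)
    have "increment_avg \<epsilon> (?g t) x = (\<integral>y. (indicator (ball 0 \<epsilon>) y / measure lborel (ball (0 :: real ^ 'd) \<epsilon>)) *\<^sub>R norm (f t x - f t (x - y)) ^ 3 \<partial>lborel)"
      unfolding increment_avg_def cut_off_in[OF t] by (rule integral_ball_measure) measurable
    then show ?thesis by (simp add: set_lebesgue_integral_def)
  qed
  have lim: "((\<lambda>\<epsilon>. 1 / \<epsilon> powr \<alpha> * A \<epsilon> powr (1 / 3)) \<longlongrightarrow> 0) (at_right 0)"
  proof (rule Lim_transform_eventually)
    show "((\<lambda>\<epsilon>. 1 / \<epsilon> powr \<alpha> * (LBINT t:{0..T}. torus_integral (\<lambda>x. 1 / measure lborel (ball (0 :: real ^ 'd) \<epsilon>) *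
        (LBINT y:ball 0 \<epsilon>. norm (f t x - f t (x - y)) powr 3)) powr (3 / 3)) powr (1 / 3)) \<longlongrightarrow> 0) (at_right 0)"
      using f by (simp only: in_Lr_Besov_VMO_def)
    have "(LBINT t:{0..T}. torus_integral (\<lambda>x. 1 / measure lborel (ball (0 :: real ^ 'd) \<epsilon>) *
        (LBINT y:ball 0 \<epsilon>. norm (f t x - f t (x - y)) powr 3)) powr (3 / 3)) = A \<epsilon>" if \<epsilon>: "0 < \<epsilon>" for \<epsilon>
      unfolding A_def
    proof (rule set_lebesgue_integral_cong)
      show "\<forall>t. t \<in> {0..T} \<longrightarrow> torus_integral (\<lambda>x. 1 / measure lborel (ball (0 :: real ^ 'd) \<epsilon>) *
        (LBINT y:ball 0 \<epsilon>. norm (f t x - f t (x - y)) powr 3)) powr (3 / 3) = (\<integral>x. increment_avg \<epsilon> (?g t) x \<partial>torus)"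
      proof (intro allI impI)
        fix t assume t: "t \<in> {0..T}"
        have "increment_avg \<epsilon> (?g t) \<in> borel_measurable borel"
          using measurable_time_section[OF measurable_increment_avg[OF \<epsilon> jm]] .
        moreover have "0 \<le> (\<integral>x. increment_avg \<epsilon> (?g t) x \<partial>torus)"
          by (rule Bochner_Integration.integral_nonneg) (rule increment_avg_nonneg)
        ultimately show "torus_integral (\<lambda>x. 1 / measure lborel (ball (0 :: real ^ 'd) \<epsilon>) *
            (LBINT y:ball 0 \<epsilon>. norm (f t x - f t (x - y)) powr 3)) powr (3 / 3) = (\<integral>x. increment_avg \<epsilon> (?g t) x \<partial>torus)"
          unfolding inner[OF t] by (simp add: torus_integral_eq)
      qed
    qed simp
    then show "\<forall>\<^sub>F \<epsilon> in at_right 0. 1 / \<epsilon> powr \<alpha> * (LBINT t:{0..T}. torus_integral (\<lambda>x. 1 / measure lborel (ball (0 :: real ^ 'd) \<epsilon>) *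
        (LBINT y:ball 0 \<epsilon>. norm (f t x - f t (x - y)) powr 3)) powr (3 / 3)) powr (1 / 3) = 1 / \<epsilon> powr \<alpha> * A \<epsilon> powr (1 / 3)"
      unfolding eventually_at_right_field by (intro exI[of _ 1]) simp
  qed
  have A3: "(A \<epsilon> powr (1 / 3)) ^ 3 = A \<epsilon>" for \<epsilon>
    using A[of \<epsilon>] powr_powr[of "A \<epsilon>" "1 / 3" 3] by simp
  have "((\<lambda>\<epsilon>. (1 / \<epsilon> powr \<alpha>) ^ 3 * A \<epsilon>) \<longlongrightarrow> 0 ^ 3) (at_right 0)"
    using tendsto_power[OF lim, of 3] by (simp only: power_mult_distrib A3)
  then show "((\<lambda>\<epsilon>. (1 / \<epsilon> powr \<alpha>) ^ 3 * (LBINT t:{0..T}. \<integral>x. increment_avg \<epsilon> (?g t) x \<partial>torus)) \<longlongrightarrow> 0) (at_right 0)"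
    by (simp add: A_def)
qed

lemma L2_torus_eq: "L2_torus f \<longleftrightarrow> torus_L2 f"
proof -
  have "f \<in> borel_measurable borel \<Longrightarrow> torus_integrable (\<lambda>x. (norm (f x))\<^sup>2) \<longleftrightarrow> integrable torus (\<lambda>x. (norm (f x))\<^sup>2)"
    by (rule torus_integrable_eq) measurable
  then show ?thesis by (auto simp: L2_torus_def torus_L2_def)
qed

lemma torus_L2_zero: "torus_L2 (\<lambda>_. 0)"
  by (simp add: torus_L2_def periodic_def)

lemma torus_L2_cut_off: "continuous_L2 T f \<Longrightarrow> torus_L2 (cut_off T f t)"
  by (cases "t \<in> {0..T}")
    (auto simp: cut_off_in cut_off_out torus_L2_zero continuous_L2_def L2_torus_eq)

lemma continuous_L2_cut_off:
  fixes f :: "real \<Rightarrow> real ^ 'd \<Rightarrow> real ^ 3"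
  assumes f: "continuous_L2 T f" and s: "s \<in> {0..T}"
  shows "((\<lambda>t. \<integral>x. (norm (cut_off T f t x - cut_off T f s x))\<^sup>2 \<partial>torus) \<longlongrightarrow> 0) (at s within {0..T})"
proof (rule Lim_transform_eventually)
  have "((\<lambda>t. sqrt (torus_integral (\<lambda>x. (norm (f t x - f s x))\<^sup>2))) \<longlongrightarrow> 0) (at s within {0..T})"
    using f s by (simp add: continuous_L2_def)
  from tendsto_power[OF this, of 2]
  show "((\<lambda>t. (sqrt (torus_integral (\<lambda>x. (norm (f t x - f s x))\<^sup>2)))\<^sup>2) \<longlongrightarrow> 0) (at s within {0..T})"
    by simp
  have "(sqrt (torus_integral (\<lambda>x. (norm (f t x - f s x))\<^sup>2)))\<^sup>2 = (\<integral>x. (norm (cut_off T f t x - cut_off T f s x))\<^sup>2 \<partial>torus)"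
    if t: "t \<in> {0..T}" for t
  proof -
    have [measurable]: "f t \<in> borel_measurable borel" "f s \<in> borel_measurable borel"
      using f s t by (auto simp: continuous_L2_def L2_torus_def)
    have "0 \<le> (\<integral>x. (norm (f t x - f s x))\<^sup>2 \<partial>torus)" by (rule Bochner_Integration.integral_nonneg) simp
    then show ?thesis by (simp add: torus_integral_eq cut_off_in[OF t] cut_off_in[OF s])
  qed
  then show "\<forall>\<^sub>F t in at s within {0..T}. (sqrt (torus_integral (\<lambda>x. (norm (f t x - f s x))\<^sup>2)))\<^sup>2
      = (\<integral>x. (norm (cut_off T f t x - cut_off T f s x))\<^sup>2 \<partial>torus)"
    unfolding eventually_at by (auto intro!: exI[of _ 1])
qed

text \<open>Products of a time cut-off and a fixed divergence-free field are the only test fields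
  inserted into the weak formulation. The time derivative falls on \<theta>, the spatial ones on
  \<psi>.\<close>

lemma test_field_product:
  fixes \<psi> :: "real ^ 'd::finite \<Rightarrow> real ^ 3"
  assumes \<theta>: "smooth \<theta>" "\<exists>a b. 0 < a \<and> b < T \<and> (\<forall>t. t \<notin> {a..b} \<longrightarrow> \<theta> t = 0)"
    and \<psi>: "smooth \<psi>" "periodic \<psi>" "\<forall>x. divergence \<iota> \<psi> x = 0"
  shows "test_field \<iota> T (\<lambda>t x. \<theta> t *\<^sub>R \<psi> x)"
    and "vector_derivative (\<lambda>s. \<theta> s *\<^sub>R \<psi> x) (at t) = dir_deriv 1 \<theta> t *\<^sub>R \<psi> x"
    and "partial \<iota> k (\<lambda>x. \<theta> t *\<^sub>R \<psi> x) x = \<theta> t *\<^sub>R partial \<iota> k \<psi> x"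
    and "partial \<iota> k (curl \<iota> (\<lambda>x. \<theta> t *\<^sub>R \<psi> x)) x = \<theta> t *\<^sub>R partial \<iota> k (curl \<iota> \<psi>) x"
proof -
  have P: "partial \<iota> k (\<lambda>x. c *\<^sub>R f x) x = c *\<^sub>R partial \<iota> k f x" if f: "smooth f" for c k x and f :: "real ^ 'd \<Rightarrow> real ^ 3"
    unfolding partial_smooth[OF f] partial_smooth[OF smooth_bounded_linear[OF bounded_linear_scaleR_right f]]
    by (rule dir_deriv_bounded_linear[OF bounded_linear_scaleR_right f])
  show "partial \<iota> k (\<lambda>x. \<theta> t *\<^sub>R \<psi> x) x = \<theta> t *\<^sub>R partial \<iota> k \<psi> x" by (rule P[OF \<psi>(1)])
  have "curl \<iota> (\<lambda>x. \<theta> t *\<^sub>R \<psi> x) = (\<lambda>x. \<theta> t *\<^sub>R curl \<iota> \<psi> x)"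
    unfolding fun_eq_iff vec_eq_iff forall_3 by (simp add: curl_components P[OF \<psi>(1)] right_diff_distrib)
  then show "partial \<iota> k (curl \<iota> (\<lambda>x. \<theta> t *\<^sub>R \<psi> x)) x = \<theta> t *\<^sub>R partial \<iota> k (curl \<iota> \<psi>) x"
    using P[OF smooth_curl[OF \<psi>(1)]] by simp
  show "vector_derivative (\<lambda>s. \<theta> s *\<^sub>R \<psi> x) (at t) = dir_deriv 1 \<theta> t *\<^sub>R \<psi> x"
  proof (rule vector_derivative_at)
    have "((\<lambda>s. \<theta> s *\<^sub>R \<psi> x) has_vector_derivative (\<theta> t *\<^sub>R 0 + dir_deriv 1 \<theta> t *\<^sub>R \<psi> x)) (at t)"
      by (intro has_vector_derivative_scaleR has_real_derivative_smooth \<theta> has_vector_derivative_const)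
    then show "((\<lambda>s. \<theta> s *\<^sub>R \<psi> x) has_vector_derivative dir_deriv 1 \<theta> t *\<^sub>R \<psi> x) (at t)"
      by simp
  qed
  have "smooth (\<lambda>p. \<theta> (fst p) *\<^sub>R \<psi> (snd p))"
    by (intro smooth_scaleR smooth_compose[OF \<theta>(1)] smooth_compose[OF \<psi>(1)] smooth_linear
        bounded_linear_fst bounded_linear_snd)
  then have "smooth (\<lambda>(t, x). \<theta> t *\<^sub>R \<psi> x)" by (simp add: split_beta')
  moreover have "divergence \<iota> (\<lambda>x. \<theta> t *\<^sub>R \<psi> x) x = 0" for t x
    using \<psi>(3) by (simp add: divergence_def P[OF \<psi>(1)] flip: sum_distrib_left)
  moreover have "\<exists>a b. 0 < a \<and> b < T \<and> (\<forall>t x. t \<notin> {a..b} \<longrightarrow> \<theta> t *\<^sub>R \<psi> x = 0)"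
    using \<theta>(2) by (metis scaleR_zero_left)
  moreover have "periodic (\<lambda>x. \<theta> t *\<^sub>R \<psi> x)" for t using \<psi>(2) by (simp add: periodic_def)
  ultimately show "test_field \<iota> T (\<lambda>t x. \<theta> t *\<^sub>R \<psi> x)" by (simp add: test_field_def)
qed

text \<open>On [0, T] the cut-off fields are the given ones; elsewhere they are 0, and the zero
  field meets the conditions that the locale imposes at every time.\<close>

lemma weak_solution_hall_mhd:
  fixes \<iota> :: "'d::finite \<Rightarrow> 3" and u h :: "real \<Rightarrow> real ^ 'd \<Rightarrow> real ^ 3"
  assumes T: "T > 0" and cont: "continuous_L2 T u" "continuous_L2 T h" and sol: "weak_solution \<iota> T u h"
  shows "hall_mhd \<iota> T (cut_off T u) (cut_off T h)"
proof
  let ?u = "cut_off T u" and ?h = "cut_off T h"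
  show "0 < T" by fact
  show "(\<lambda>(t, x). ?u t x) \<in> borel_measurable (borel \<Otimes>\<^sub>M borel)" "(\<lambda>(t, x). ?h t x) \<in> borel_measurable (borel \<Otimes>\<^sub>M borel)"
    using cont by (auto simp: continuous_L2_def intro: measurable_cut_off)
  show L2: "torus_L2 (?u t)" "torus_L2 (?h t)" for t
    using cont by (auto intro: torus_L2_cut_off)
  show "((\<lambda>t. \<integral>x. (norm (?u t x - ?u s x))\<^sup>2 \<partial>torus) \<longlongrightarrow> 0) (at s within {0..T})"
    "((\<lambda>t. \<integral>x. (norm (?h t x - ?h s x))\<^sup>2 \<partial>torus) \<longlongrightarrow> 0) (at s within {0..T})" if "s \<in> {0..T}" for s
    using continuous_L2_cut_off cont that by auto
  have zero: "weakly_div_free \<iota> (\<lambda>_. 0)"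
    by (simp add: weakly_div_free_def torus_integral_def)
  show "weakly_div_free \<iota> (?u t)" "weakly_div_free \<iota> (?h t)" for t
    using sol by (cases "t \<in> {0..T}"; simp add: weak_solution_def cut_off_in cut_off_out zero)+
  have meas: "(\<lambda>x. u t x $ i) \<in> borel_measurable borel" "(\<lambda>x. h t x $ i) \<in> borel_measurable borel" if "t \<in> {0..T}" for t i
    using cont that by (auto simp: continuous_L2_def L2_torus_def intro!: measurable_vec_nth)
  fix \<theta> :: "real \<Rightarrow> real" and \<psi> :: "real ^ 'd \<Rightarrow> real ^ 3"
  assume \<theta>: "smooth \<theta>" "\<exists>a b. 0 < a \<and> b < T \<and> (\<forall>t. t \<notin> {a..b} \<longrightarrow> \<theta> t = 0)"
    and \<psi>: "smooth \<psi>" "periodic \<psi>" "\<forall>x. divergence \<iota> \<psi> x = 0"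
  note test = test_field_product[OF \<theta> \<psi>]
  have \<psi>m: "\<psi> \<in> borel_measurable borel" "(\<lambda>x. partial \<iota> k \<psi> x $ i) \<in> borel_measurable borel"
    "(\<lambda>x. partial \<iota> k (curl \<iota> \<psi>) x $ i) \<in> borel_measurable borel" for k i
    by (intro borel_measurable_continuous_onI smooth_imp_continuous smooth_vec_nth smooth_partial smooth_curl \<psi>)+
  \<comment> \<open>Each term is integrable on its own, which allows the weak formulation to be
    split into a pairing and a flux.\<close>
  have inner_int: "integrable torus (\<lambda>x. \<psi> x \<bullet> v x)" if "torus_L2 v" for v
  proof -
    obtain P where "\<And>x. norm (\<psi> x) \<le> P" using periodic_bounded[OF \<psi>(2) smooth_imp_continuous[OF \<psi>(1)]] by blast
    then show ?thesis using norm_integral_inner_le(1)[OF torus_L2_L1[OF that] smooth_imp_continuous[OF \<psi>(1)]] by blast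
  qed
  have eq: "torus_integral (\<lambda>x. vector_derivative (\<lambda>s. \<theta> s *\<^sub>R \<psi> x) (at t) \<bullet> u t x
           + (\<Sum>i\<in>UNIV. \<Sum>k\<in>UNIV. partial \<iota> k (\<lambda>x. \<theta> t *\<^sub>R \<psi> x) x $ i *
                (u t x $ i * u t x $ k - h t x $ i * h t x $ k)))
      = dir_deriv 1 \<theta> t * (\<integral>x. \<psi> x \<bullet> ?u t x \<partial>torus) + \<theta> t * momentum_flux \<iota> (?u t) (?h t) \<psi>" (is ?A)
    and eq': "torus_integral (\<lambda>x. vector_derivative (\<lambda>s. \<theta> s *\<^sub>R \<psi> x) (at t) \<bullet> h t x
           + (\<Sum>i\<in>UNIV. \<Sum>k\<in>UNIV. partial \<iota> k (\<lambda>x. \<theta> t *\<^sub>R \<psi> x) x $ i *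
                (h t x $ i * u t x $ k - u t x $ i * h t x $ k))
           + (\<Sum>i\<in>UNIV. \<Sum>k\<in>UNIV. h t x $ i * h t x $ k *
                partial \<iota> k (curl \<iota> (\<lambda>x. \<theta> t *\<^sub>R \<psi> x)) x $ i))
      = dir_deriv 1 \<theta> t * (\<integral>x. \<psi> x \<bullet> ?h t x \<partial>torus) + \<theta> t * induction_flux \<iota> (?u t) (?h t) \<psi>" (is ?B)
    if t: "t \<in> {0..T}" for t
  proof -
    have m: "(\<lambda>x. u t x $ i) \<in> borel_measurable borel" "(\<lambda>x. h t x $ i) \<in> borel_measurable borel"
      "u t \<in> borel_measurable borel" "h t \<in> borel_measurable borel" for i
      using meas[OF t] cont t by (auto simp: continuous_L2_def L2_torus_def)
    have L: "torus_L2 (u t)" "torus_L2 (h t)" using L2[of t] by (simp_all only: cut_off_in[OF t])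
    note ints = inner_int[OF L(1)] inner_int[OF L(2)] momentum_integrable[OF L \<psi>(1,2), of \<iota>] induction_integrable[OF L \<psi>(1,2), of \<iota>]
    let ?M = "\<lambda>x. \<Sum>i\<in>UNIV. \<Sum>k\<in>UNIV. partial \<iota> k \<psi> x $ i * (u t x $ i * u t x $ k - h t x $ i * h t x $ k)"
    let ?N = "\<lambda>x. \<Sum>i\<in>UNIV. \<Sum>k\<in>UNIV. partial \<iota> k \<psi> x $ i * (h t x $ i * u t x $ k - u t x $ i * h t x $ k)"
    let ?L = "\<lambda>x. \<Sum>i\<in>UNIV. \<Sum>k\<in>UNIV. h t x $ i * h t x $ k * partial \<iota> k (curl \<iota> \<psi>) x $ i"
    have "torus_integral (\<lambda>x. dir_deriv 1 \<theta> t * (\<psi> x \<bullet> u t x) + \<theta> t * ?M x) = (\<integral>x. dir_deriv 1 \<theta> t * (\<psi> x \<bullet> u t x) + \<theta> t * ?M x \<partial>torus)"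
      by (rule torus_integral_eq) (intro borel_measurable_add borel_measurable_times borel_measurable_sum
          borel_measurable_diff borel_measurable_inner borel_measurable_const m \<psi>m)
    also have "\<dots> = dir_deriv 1 \<theta> t * (\<integral>x. \<psi> x \<bullet> u t x \<partial>torus) + \<theta> t * momentum_flux \<iota> (u t) (h t) \<psi>"
      unfolding momentum_flux_def using ints by simp
    finally show ?A
      unfolding test(2,3) cut_off_in[OF t] by (simp add: sum_distrib_left mult.assoc)
    have "torus_integral (\<lambda>x. dir_deriv 1 \<theta> t * (\<psi> x \<bullet> h t x) + \<theta> t * (?N x + ?L x)) = (\<integral>x. dir_deriv 1 \<theta> t * (\<psi> x \<bullet> h t x) + \<theta> t * (?N x + ?L x) \<partial>torus)"
      by (rule torus_integral_eq) (intro borel_measurable_add borel_measurable_times borel_measurable_sum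
          borel_measurable_diff borel_measurable_inner borel_measurable_const m \<psi>m)
    also have "\<dots> = dir_deriv 1 \<theta> t * (\<integral>x. \<psi> x \<bullet> h t x \<partial>torus) + \<theta> t * induction_flux \<iota> (u t) (h t) \<psi>"
      unfolding induction_flux_def using ints by simp
    finally show ?B
      unfolding test(2-4) cut_off_in[OF t] by (simp add: sum_distrib_left distrib_left mult.assoc mult.left_commute add.assoc)
  qed
  have "(LBINT t:{0..T}. torus_integral (\<lambda>x. vector_derivative (\<lambda>s. \<theta> s *\<^sub>R \<psi> x) (at t) \<bullet> u t x
           + (\<Sum>i\<in>UNIV. \<Sum>k\<in>UNIV. partial \<iota> k (\<lambda>x. \<theta> t *\<^sub>R \<psi> x) x $ i *
                (u t x $ i * u t x $ k - h t x $ i * h t x $ k)))) = 0"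
    "(LBINT t:{0..T}. torus_integral (\<lambda>x. vector_derivative (\<lambda>s. \<theta> s *\<^sub>R \<psi> x) (at t) \<bullet> h t x
           + (\<Sum>i\<in>UNIV. \<Sum>k\<in>UNIV. partial \<iota> k (\<lambda>x. \<theta> t *\<^sub>R \<psi> x) x $ i *
                (h t x $ i * u t x $ k - u t x $ i * h t x $ k))
           + (\<Sum>i\<in>UNIV. \<Sum>k\<in>UNIV. h t x $ i * h t x $ k *
                partial \<iota> k (curl \<iota> (\<lambda>x. \<theta> t *\<^sub>R \<psi> x)) x $ i))) = 0"
    using sol test(1) unfolding weak_solution_def by blast+
  then show "(LBINT t:{0..T}. dir_deriv 1 \<theta> t * (\<integral>x. \<psi> x \<bullet> ?u t x \<partial>torus) + \<theta> t * momentum_flux \<iota> (?u t) (?h t) \<psi>) = 0"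
    "(LBINT t:{0..T}. dir_deriv 1 \<theta> t * (\<integral>x. \<psi> x \<bullet> ?h t x \<partial>torus) + \<theta> t * induction_flux \<iota> (?u t) (?h t) \<psi>) = 0"
    using set_lebesgue_integral_cong[of "{0..T}" lborel, OF _ allI[OF impI[OF eq]]]
      set_lebesgue_integral_cong[of "{0..T}" lborel, OF _ allI[OF impI[OF eq']]] by simp_all
qed

theorem theorem1p3:
  fixes \<iota> :: "'d::finite \<Rightarrow> 3"
    and T :: real
    and u h :: "real \<Rightarrow> real ^ 'd \<Rightarrow> real ^ 3"
  assumes dim: "CARD('d) = 2 \<and> bij_betw \<iota> UNIV {1, 2} \<or> CARD('d) = 3 \<and> bij_betw \<iota> UNIV {1, 2, 3}"
    and T: "T > 0"
    and cont: "continuous_L2 T u" "continuous_L2 T h"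
    and sol: "weak_solution \<iota> T u h"
    and u: "in_Lr_Besov_VMO 3 (1/3) 3 T u"
    and h: "in_Lr_Besov_VMO 3 (2/3) 3 T h"
  shows "\<forall>t\<in>{0..T}.
    1/2 * torus_integral (\<lambda>x. (norm (u t x))\<^sup>2 + (norm (h t x))\<^sup>2) =
    1/2 * torus_integral (\<lambda>x. (norm (u 0 x))\<^sup>2 + (norm (h 0 x))\<^sup>2)"
proof
  fix t assume t: "t \<in> {0..T}"
  interpret hall_mhd \<iota> T "cut_off T u" "cut_off T h"
    by (rule weak_solution_hall_mhd[OF T cont sol])
  \<comment> \<open>Cubing turns the Besov exponents 1/3 and 2/3 into the rates \<epsilon> and
    \<epsilon>^2 that compensate the one and the two derivatives in the flux.\<close>
  have pow: "(1 / \<epsilon> powr (1/3)) ^ 3 = 1 / \<epsilon>" "(1 / \<epsilon> powr (2/3)) ^ 3 = 1 / \<epsilon>\<^sup>2" if "0 < \<epsilon>" for \<epsilon> :: real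
    using that by (simp_all add: power_divide powr_powr flip: powr_numeral)
  note bu = besov_increment_avg[OF u] and bh = besov_increment_avg[OF h]
  have "energy t = energy 0"
  proof (rule energy_conserved[OF bu(1) bh(1) bu(2) bh(2) _ _ t])
    show "((\<lambda>\<epsilon>. 1 / \<epsilon> * (LBINT t:{0..T}. \<integral>x. increment_avg \<epsilon> (cut_off T u t) x \<partial>torus)) \<longlongrightarrow> 0) (at_right 0)"
      by (rule Lim_transform_eventually[OF bu(3)]) (auto simp: eventually_at_right_field pow intro!: exI[of _ 1])
    show "((\<lambda>\<epsilon>. 1 / \<epsilon>\<^sup>2 * (LBINT t:{0..T}. \<integral>x. increment_avg \<epsilon> (cut_off T h t) x \<partial>torus)) \<longlongrightarrow> 0) (at_right 0)"
      by (rule Lim_transform_eventually[OF bh(3)]) (auto simp: eventually_at_right_field pow intro!: exI[of _ 1])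
  qed (use T in simp)
  moreover have "energy s = torus_integral (\<lambda>x. (norm (u s x))\<^sup>2 + (norm (h s x))\<^sup>2)" if s: "s \<in> {0..T}" for s
  proof -
    have [measurable]: "u s \<in> borel_measurable borel" "h s \<in> borel_measurable borel"
      using cont s by (auto simp: continuous_L2_def L2_torus_def)
    show ?thesis by (simp add: energy_def cut_off_in[OF s] torus_integral_eq)
  qed
  ultimately show "1/2 * torus_integral (\<lambda>x. (norm (u t x))\<^sup>2 + (norm (h t x))\<^sup>2) =
    1/2 * torus_integral (\<lambda>x. (norm (u 0 x))\<^sup>2 + (norm (h 0 x))\<^sup>2)"
    using t T by simp
qed

end
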